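(* Let $\mathbb{H}$ be a separable Hilbert space and let $X_1,\ldots,X_n$ be a sequence of independent random self-adjoint Hilbert–Schmidt operators $X_i:\mathbb{H}\to\mathbb{H}$ such that $\ker(\mathbb{E}X_i)=\mathbb{H}$ (that is, $\mathbb{E}X_i=0$) for $i=1,\ldots,n$. Let $\sigma\ge 0$ be a real number with $\sigma^2\geq\left\|\sum_{i=1}^n\mathbb{E}X_i^2\right\|$, and assume that $\|X_i\|\leq U$ almost surely for all $1\leq i\leq n$ and some positive $U\in\mathbb{R}$. Then, for any $t\geq\frac{1}{6}\left(U+\sqrt{U^2+36\sigma^2}\right)$, $$\mathbb{P}\left(\left\|\sum_{i=1}^n X_i\right\|>t\right)\leq 14\, r\left(\sum_{i=1}^n\mathbb{E}X_i^2\right)\exp\left[-\frac{t^2/2}{\sigma^2+tU/3}\right].$$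
   Context: $\|\cdot\|$ denotes the operator norm. For a random operator $X$ on $\mathbb{H}$, $\mathbb{E}X$ is the operator such that $\langle(\mathbb{E}X)z_1,z_2\rangle_{\mathbb{H}}=\mathbb{E}\langle Xz_1,z_2\rangle_{\mathbb{H}}$ for all $z_1,z_2\in\mathbb{H}$. For a nonnegative definite bounded operator $A$ on $\mathbb{H}$, the effective rank is $r(A):=\dfrac{\operatorname{tr}(A)}{\|A\|}\in[0,\infty]$ (with $r(0):=0$); if $\operatorname{tr}(A)=\infty$ then $r(A)=\infty$ and the bound is trivial. *)

theory Defs
  imports "HOL-Probability.Probability"
begin

text \<open>
  Hilbert spaces over the scalar field \<open>K\<close>, which is \<open>\<real>\<close> or the whole of \<open>\<complex>\<close>. The type \<open>'h\<close>
  provides addition, the norm and completeness; \<open>smul\<close> and \<open>ip\<close> are the scalar multiplication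
  and the inner product (linear in the first argument). In the real case the values of \<open>ip\<close> are
  real numbers embedded in \<open>\<complex>\<close>, and \<open>smul c\<close> is irrelevant for non-real \<open>c\<close>. Positive
  definiteness of \<open>ip\<close> is part of the axiom \<open>ip_self\<close>.
\<close>

locale hilbert_space_over =
  fixes K :: "complex set"
    and smul :: "complex \<Rightarrow> 'h::banach \<Rightarrow> 'h"
    and ip :: "'h \<Rightarrow> 'h \<Rightarrow> complex"
  assumes scalar_field: "K = \<real> \<or> K = UNIV"
    and smul_add_right: "c \<in> K \<Longrightarrow> smul c (x + y) = smul c x + smul c y"
    and smul_add_left: "c \<in> K \<Longrightarrow> d \<in> K \<Longrightarrow> smul (c + d) x = smul c x + smul d x"
    and smul_smul: "c \<in> K \<Longrightarrow> d \<in> K \<Longrightarrow> smul c (smul d x) = smul (c * d) x"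
    and smul_of_real: "smul (complex_of_real r) x = r *\<^sub>R x"
    and ip_in_K: "ip x y \<in> K"
    and ip_commute: "ip x y = cnj (ip y x)"
    and ip_add_left: "ip (x + y) z = ip x z + ip y z"
    and ip_smul_left: "c \<in> K \<Longrightarrow> ip (smul c x) y = c * ip x y"
    and ip_self: "ip x x = complex_of_real ((norm x)\<^sup>2)"

lemma hilbert_space_over_real:
  "hilbert_space_over \<real> (\<lambda>c x. Re c *\<^sub>R x)
     (\<lambda>x y. complex_of_real (x \<bullet> (y :: 'h :: {real_inner, banach})))"
  by unfold_locales
     (auto simp: algebra_simps inner_commute power2_norm_eq_inner elim!: Reals_cases)

lemma hilbert_space_over_complex:
  "hilbert_space_over UNIV (*) (\<lambda>x y. x * cnj y)"
  by unfold_locales (auto simp: algebra_simps scaleR_conv_of_real complex_norm_square simp del: of_real_power)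

text \<open>
  Bounded operators are elements of \<open>'h \<Rightarrow>\<^sub>L 'h\<close>, whose norm is the operator norm. Members of this
  type are only real-linear by construction, hence the following predicate.
\<close>

definition K_linear :: "complex set \<Rightarrow> (complex \<Rightarrow> 'h::banach \<Rightarrow> 'h) \<Rightarrow> ('h \<Rightarrow>\<^sub>L 'h) \<Rightarrow> bool" where
  "K_linear K smul A \<longleftrightarrow> (\<forall>c\<in>K. \<forall>x. blinfun_apply A (smul c x) = smul c (blinfun_apply A x))"

definition self_adjoint :: "('h \<Rightarrow> 'h \<Rightarrow> complex) \<Rightarrow> ('h::banach \<Rightarrow>\<^sub>L 'h) \<Rightarrow> bool" where
  "self_adjoint ip A \<longleftrightarrow> (\<forall>x y. ip (blinfun_apply A x) y = ip x (blinfun_apply A y))"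

definition orthonormal_basis :: "('h::banach \<Rightarrow> 'h \<Rightarrow> complex) \<Rightarrow> 'h set \<Rightarrow> bool" where
  "orthonormal_basis ip B \<longleftrightarrow>
     (\<forall>b\<in>B. ip b b = 1) \<and> (\<forall>b\<in>B. \<forall>c\<in>B. b \<noteq> c \<longrightarrow> ip b c = 0) \<and>
     (\<forall>x. (\<forall>b\<in>B. ip x b = 0) \<longrightarrow> x = 0)"

definition hilbert_schmidt :: "('h \<Rightarrow> 'h \<Rightarrow> complex) \<Rightarrow> ('h::banach \<Rightarrow>\<^sub>L 'h) \<Rightarrow> bool" where
  "hilbert_schmidt ip A \<longleftrightarrow>
     (\<exists>B. orthonormal_basis ip B \<and> (\<lambda>b. (norm (blinfun_apply A b))\<^sup>2) summable_on B)"

text \<open>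
  The trace of a nonnegative definite operator, with values in \<open>[0,\<infinity>]\<close>. It does not depend on the
  choice of the orthonormal basis, and \<open>ip (A b) b\<close> is a nonnegative real number.
\<close>

definition op_trace :: "('h \<Rightarrow> 'h \<Rightarrow> complex) \<Rightarrow> ('h::banach \<Rightarrow>\<^sub>L 'h) \<Rightarrow> ennreal" where
  "op_trace ip A =
     (\<Sum>\<^sub>\<infinity>b\<in>(SOME B. orthonormal_basis ip B). ennreal (Re (ip (blinfun_apply A b) b)))"

definition effective_rank :: "('h \<Rightarrow> 'h \<Rightarrow> complex) \<Rightarrow> ('h::banach \<Rightarrow>\<^sub>L 'h) \<Rightarrow> ennreal" where
  "effective_rank ip A = (if A = 0 then 0 else op_trace ip A / ennreal (norm A))"

text \<open>
  Random operators below are Borel measurable maps into \<open>'h \<Rightarrow>\<^sub>L 'h\<close> with Hilbert-Schmidt values. As the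
  Hilbert-Schmidt operators of a separable space are separable in the operator norm and in the
  Hilbert-Schmidt norm, such a map generates the same \<open>\<sigma>\<close>-algebra for either norm, and it is the one
  generated by the functions \<open>\<omega> \<mapsto> ip (X \<omega> z1) z2\<close>.
\<close>

definition is_op_expectation ::
    "'w measure \<Rightarrow> ('h \<Rightarrow> 'h \<Rightarrow> complex) \<Rightarrow> ('w \<Rightarrow> ('h::banach \<Rightarrow>\<^sub>L 'h)) \<Rightarrow> ('h \<Rightarrow>\<^sub>L 'h) \<Rightarrow> bool" where
  "is_op_expectation M ip X A \<longleftrightarrow>
     (\<forall>z1 z2. integrable M (\<lambda>\<omega>. ip (blinfun_apply (X \<omega>) z1) z2) \<and>
        ip (blinfun_apply A z1) z2 = (\<integral>\<omega>. ip (blinfun_apply (X \<omega>) z1) z2 \<partial>M))"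

definition op_expectation ::
    "'w measure \<Rightarrow> ('h \<Rightarrow> 'h \<Rightarrow> complex) \<Rightarrow> ('w \<Rightarrow> ('h::banach \<Rightarrow>\<^sub>L 'h)) \<Rightarrow> ('h \<Rightarrow>\<^sub>L 'h)" where
  "op_expectation M ip X = (THE A. is_op_expectation M ip X A)"

lemma (in hilbert_space_over) op_expectation_eqI:
  assumes "is_op_expectation M ip X A"
  shows "op_expectation M ip X = A"
  unfolding op_expectation_def
proof (rule the_equality[of "is_op_expectation M ip X", OF assms])
  fix B assume B: "is_op_expectation M ip X B"
  show "B = A"
  proof (rule blinfun_eqI)
    fix z
    let ?d = "blinfun_apply B z - blinfun_apply A z"
    have eq: "ip (blinfun_apply B z) w = ip (blinfun_apply A z) w" for w
      using B assms by (simp add: is_op_expectation_def)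
    have "ip ?d ?d + ip (blinfun_apply A z) ?d = ip (blinfun_apply B z) ?d"
      by (simp flip: ip_add_left)
    hence "ip ?d ?d = 0" using eq by simp
    thus "blinfun_apply B z = blinfun_apply A z" by (simp add: ip_self)
  qed
qed

end

theory Submission
  imports Defs "HOL-Real_Asymp.Real_Asymp"
begin

text \<open>
  \<open>H\<close> is regarded as a real Hilbert space and the operators are compressed to the spans of finitely many
  vectors of a complete orthogonal sequence; the norm of a self-adjoint operator exceeds \<open>t\<close> only if the
  quadratic forms of all sufficiently large compressions violate the bound \<open>t\<close>. For matrices, Markov's
  inequality is applied to the trace of \<open>2 cosh (\<theta> S) - 2\<close>. Its expectation is bounded one summand at a time
  by Lieb's concavity theorem: with \<open>V = \<gamma> E X\<^sup>2\<close> and \<open>B = 1 + X + \<gamma> X\<^sup>2 \<ge> exp X\<close>, the trace of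
  \<open>exp (H - V + X)\<close> is at most a functional linear in \<open>B\<close>, whose expectation is at most the trace of \<open>exp H\<close>.
  Lieb's theorem is obtained from an affine minorant of the relative entropy \<open>tr T (log T - log B)\<close>,
  proved as an inequality between the derivatives in the parameter of the integral representation of \<open>log\<close>.

  A complex basis of \<open>n\<close> vectors yields a real one of \<open>2 n\<close> vectors, which doubles the trace. The constant 14
  leaves room for this, because \<open>4 (exp (x/2) - 1) / (2 cosh x - 2) \<le> 14 exp (-x/2)\<close> for \<open>x \<ge> 1\<close>.
\<close>

text \<open>What makes the bound free of the dimension is that \<open>2 cosh - 2\<close> vanishes at
  0. Once the dimension is subtracted, convexity of \<open>exp\<close> bounds the trace by a
  multiple of trace over norm of the variance; this ratio is the source of the effective rank, and
  its bound is the same for all compressions.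

  The obstacle is that the summands do not commute: the exponential of a sum does not factor, so
  independence cannot be used directly. It can be used for a bound that is bilinear in
  \<open>exp H\<close> and \<open>B\<close>. Placing the tangent point at \<open>exp V\<close> makes
  \<open>E B = 1 + V\<close> diagonal in the eigenbasis of \<open>V\<close>, and all that remains is
  \<open>1 + \<alpha> \<le> exp \<alpha>\<close> for the eigenvalues \<alpha> of \<open>V\<close>.

  The dimension \<open>N\<close> runs to infinity within one argument, so matrices are functions of
  two natural numbers, read below \<open>N\<close> only, and not elements of a type of fixed
  dimension. Spectral data are chosen separately at each sample point; measurability is established
  for matrix entries and power series in them.\<close>

section \<open>Symmetric matrices\<close>

context
  fixes N :: nat
begin

definition vdot :: "(nat \<Rightarrow> real) \<Rightarrow> (nat \<Rightarrow> real) \<Rightarrow> real" where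
  "vdot x y = (\<Sum>i<N. x i * y i)"

definition mvec :: "(nat \<Rightarrow> nat \<Rightarrow> real) \<Rightarrow> (nat \<Rightarrow> real) \<Rightarrow> nat \<Rightarrow> real" where
  "mvec A x i = (\<Sum>j<N. A i j * x j)"

definition orthonormal_family :: "nat \<Rightarrow> (nat \<Rightarrow> nat \<Rightarrow> real) \<Rightarrow> bool" where
  "orthonormal_family m u \<longleftrightarrow> (\<forall>k<m. \<forall>l<m. vdot (u k) (u l) = (if k = l then 1 else 0))"

definition symmetric_mat :: "(nat \<Rightarrow> nat \<Rightarrow> real) \<Rightarrow> bool" where
  "symmetric_mat A \<longleftrightarrow> (\<forall>i<N. \<forall>j<N. A i j = A j i)"

definition spectral_decomp ::
    "(nat \<Rightarrow> nat \<Rightarrow> real) \<Rightarrow> (nat \<Rightarrow> nat \<Rightarrow> real) \<Rightarrow> (nat \<Rightarrow> real) \<Rightarrow> bool" where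
  "spectral_decomp A u a \<longleftrightarrow> orthonormal_family N u \<and>
     (\<forall>i<N. \<forall>j<N. A i j = (\<Sum>k<N. a k * u k i * u k j))"

lemma vdot_commute: "vdot x y = vdot y x"
  by (simp add: vdot_def mult.commute)

lemma vdot_add_left: "vdot (\<lambda>i. x i + y i) z = vdot x z + vdot y z"
  by (simp add: vdot_def algebra_simps sum.distrib)

lemma vdot_diff_left: "vdot (\<lambda>i. x i - y i) z = vdot x z - vdot y z"
  by (simp add: vdot_def algebra_simps sum_subtractf)

lemma vdot_scale_left: "vdot (\<lambda>i. c * x i) z = c * vdot x z"
  by (simp add: vdot_def algebra_simps sum_distrib_left)

lemma vdot_sum_left: "vdot (\<lambda>i. \<Sum>k\<in>S. f k i) z = (\<Sum>k\<in>S. vdot (f k) z)"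
  unfolding vdot_def by (simp add: sum_distrib_right) (rule sum.swap)

lemma vdot_add_right: "vdot z (\<lambda>i. x i + y i) = vdot z x + vdot z y"
  and vdot_diff_right: "vdot z (\<lambda>i. x i - y i) = vdot z x - vdot z y"
  and vdot_scale_right: "vdot z (\<lambda>i. c * x i) = c * vdot z x"
  and vdot_sum_right: "vdot z (\<lambda>i. \<Sum>k\<in>S. f k i) = (\<Sum>k\<in>S. vdot z (f k))"
  by (simp_all only: vdot_commute[of z] vdot_add_left vdot_diff_left vdot_scale_left vdot_sum_left)

lemma vdot_nonneg: "0 \<le> vdot x x"
  by (simp add: vdot_def sum_nonneg)

lemma vdot_eq_0D: "vdot x x = 0 \<Longrightarrow> i < N \<Longrightarrow> x i = 0"
  unfolding vdot_def by (subst (asm) sum_nonneg_eq_0_iff) auto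

lemma vdot_unit: "j < N \<Longrightarrow> vdot x (\<lambda>i. if i = j then 1 else 0) = x j"
  by (simp add: vdot_def if_distrib sum.delta cong: if_cong)

lemma mvec_symmetric: "symmetric_mat A \<Longrightarrow> vdot (mvec A x) y = vdot x (mvec A y)"
  unfolding vdot_def mvec_def sum_distrib_left sum_distrib_right
  by (subst sum.swap) (auto simp: symmetric_mat_def intro!: sum.cong)

section \<open>Orthonormal families: residuals, completeness, Parseval's identity\<close>

lemma bessel_residual:
  assumes "orthonormal_family m u"
  defines "r \<equiv> (\<lambda>x i. x i - (\<Sum>k<m. vdot x (u k) * u k i))"
  shows "l < m \<Longrightarrow> vdot (r x) (u l) = 0"
    and "vdot (r x) (r x) = vdot x x - (\<Sum>k<m. (vdot x (u k))\<^sup>2)"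
proof -
  have *: "vdot (r x) (u l) = 0" if "l < m" for l
  proof -
    have "(\<Sum>k<m. vdot x (u k) * vdot (u k) (u l)) = (\<Sum>k<m. if k = l then vdot x (u k) else 0)"
      using assms(1) that by (intro sum.cong) (auto simp: orthonormal_family_def)
    then show ?thesis using that
      by (simp add: r_def vdot_diff_left vdot_sum_left vdot_scale_left)
  qed
  then show "l < m \<Longrightarrow> vdot (r x) (u l) = 0" .
  have "vdot (r x) (r x) = vdot (r x) x - (\<Sum>k<m. vdot x (u k) * vdot (r x) (u k))"
    unfolding r_def by (simp add: vdot_diff_right vdot_sum_right vdot_scale_right)
  also have "\<dots> = vdot (r x) x" using * by simp
  also have "\<dots> = vdot x x - (\<Sum>k<m. (vdot x (u k))\<^sup>2)"
    by (simp add: r_def vdot_diff_left vdot_sum_left vdot_scale_left power2_eq_square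
        vdot_commute[of "u _" x])
  finally show "vdot (r x) (r x) = vdot x x - (\<Sum>k<m. (vdot x (u k))\<^sup>2)" .
qed

text \<open>Each summand is the squared norm of the residual of a unit vector, hence nonnegative.
  The value \<open>N - m\<close> therefore does the work of dimension theory: for
  \<open>m = N\<close> all residuals vanish (completeness), for \<open>m < N\<close> some residual
  is nonzero and extends the family.\<close>

lemma residual_trace:
  assumes "orthonormal_family m u"
  shows "(\<Sum>j<N. 1 - (\<Sum>k<m. (u k j)\<^sup>2)) = real N - real m"
proof -
  have "(\<Sum>j<N. \<Sum>k<m. (u k j)\<^sup>2) = (\<Sum>k<m. vdot (u k) (u k))"
    by (subst sum.swap) (simp add: vdot_def power2_eq_square)
  also have "\<dots> = real m" using assms by (simp add: orthonormal_family_def)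
  finally show ?thesis by (simp add: sum_subtractf)
qed

lemma residual_unit_nonneg:
  assumes "orthonormal_family m u" "j < N"
  shows "(\<Sum>k<m. (u k j)\<^sup>2) \<le> 1"
  using bessel_residual(2)[OF assms(1), of "\<lambda>i. if i = j then 1 else 0"] assms(2)
    vdot_nonneg[of "\<lambda>i. (if i = j then 1 else 0) - (\<Sum>k<m. vdot (\<lambda>i. if i = j then 1 else 0) (u k) * u k i)"]
  by (simp add: vdot_commute[of _ "u _"] vdot_unit)

lemma orthonormal_complete:
  assumes u: "orthonormal_family N u" and ij: "i < N" "j < N"
  shows "(\<Sum>k<N. u k i * u k j) = (if i = j then 1 else 0)"
proof -
  let ?e = "\<lambda>i. if i = j then 1 else (0::real)"
  have "(\<Sum>j<N. 1 - (\<Sum>k<N. (u k j)\<^sup>2)) = 0" using residual_trace[OF u] by simp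
  then have "1 - (\<Sum>k<N. (u k j)\<^sup>2) = 0"
    using ij(2) residual_unit_nonneg[OF u] by (subst (asm) sum_nonneg_eq_0_iff) auto
  then have "vdot (\<lambda>i. ?e i - (\<Sum>k<N. vdot ?e (u k) * u k i)) (\<lambda>i. ?e i - (\<Sum>k<N. vdot ?e (u k) * u k i)) = 0"
    using bessel_residual(2)[OF u, of ?e] ij(2) by (simp add: vdot_commute[of _ "u _"] vdot_unit)
  from vdot_eq_0D[OF this ij(1)] ij(2) show ?thesis
    by (simp add: vdot_commute[of _ "u _"] vdot_unit mult.commute)
qed

lemma parseval:
  assumes u: "orthonormal_family N u"
  shows "vdot x y = (\<Sum>k<N. vdot x (u k) * vdot y (u k))"
proof -
  have "(\<Sum>k<N. vdot x (u k) * vdot y (u k)) = (\<Sum>k<N. \<Sum>i<N. \<Sum>j<N. x i * y j * (u k i * u k j))"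
    unfolding vdot_def by (simp add: sum_product mult_ac)
  also have "\<dots> = (\<Sum>i<N. \<Sum>j<N. \<Sum>k<N. x i * y j * (u k i * u k j))"
    by (subst sum.swap) (intro sum.cong refl sum.swap)
  also have "\<dots> = (\<Sum>i<N. \<Sum>j<N. x i * y j * (if i = j then 1 else 0))"
    by (intro sum.cong refl) (simp add: sum_distrib_left[symmetric] orthonormal_complete[OF u])
  also have "\<dots> = vdot x y" by (simp add: vdot_def if_distrib sum.delta cong: if_cong)
  finally show ?thesis by simp
qed

lemma extend_unit_vector:
  assumes u: "orthonormal_family m u" and m: "m < N"
  shows "\<exists>x. vdot x x = 1 \<and> (\<forall>l<m. vdot x (u l) = 0)"
proof -
  have "\<exists>j<N. (\<Sum>k<m. (u k j)\<^sup>2) < 1"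
  proof (rule ccontr)
    assume "\<not> ?thesis"
    then have "(\<Sum>j<N. 1 - (\<Sum>k<m. (u k j)\<^sup>2)) \<le> 0" by (intro sum_nonpos) auto
    then show False using residual_trace[OF u] m by simp
  qed
  then obtain j where j: "j < N" "(\<Sum>k<m. (u k j)\<^sup>2) < 1" by blast
  let ?e = "\<lambda>i. if i = j then 1 else (0::real)"
  define r where "r = (\<lambda>i. ?e i - (\<Sum>k<m. vdot ?e (u k) * u k i))"
  have rr: "vdot r r > 0"
    using bessel_residual(2)[OF u, of ?e] j unfolding r_def
    by (simp add: vdot_commute[of _ "u _"] vdot_unit)
  define c where "c = 1 / sqrt (vdot r r)"
  have "c * (c * vdot r r) = 1"
    using rr by (simp add: c_def field_simps)
  moreover have "vdot r (u l) = 0" if "l < m" for l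
    using bessel_residual(1)[OF u that, of ?e] unfolding r_def .
  ultimately show ?thesis
    by (intro exI[of _ "\<lambda>i. c * r i"]) (simp add: vdot_scale_left vdot_scale_right)
qed

section \<open>The spectral theorem by maximising the quadratic form\<close>

lemma continuous_on_vdot [continuous_intros]:
  fixes f g :: "'a::topological_space \<Rightarrow> nat \<Rightarrow> real"
  assumes "\<And>i. continuous_on S (\<lambda>x. f x i)" "\<And>i. continuous_on S (\<lambda>x. g x i)"
  shows "continuous_on S (\<lambda>x. vdot (f x) (g x))"
  unfolding vdot_def using assms by (intro continuous_intros)

text \<open>Pinning the coordinates from \<open>N\<close> on to 0 places the section inside a
  Tychonoff cube, where closedness is enough.\<close>

lemma compact_sphere_section:
  "compact {x. (\<forall>i\<ge>N. x i = 0) \<and> vdot x x = 1 \<and> (\<forall>l<m. vdot x (u l) = 0)}" (is "compact ?S")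
proof -
  let ?B = "PiE UNIV (\<lambda>_::nat. {-1..1::real})"
  have "compactin (product_topology (\<lambda>_. euclidean) UNIV) ?B"
    by (subst compactin_PiE) auto
  then have "compact ?B"
    by (simp add: euclidean_product_topology)
  moreover have "closed ?S"
  proof -
    have "?S = (\<Inter>i\<in>{N..}. {x. x i = 0}) \<inter> {x. vdot x x = 1} \<inter> (\<Inter>l\<in>{..<m}. {x. vdot x (u l) = 0})"
      by auto
    moreover have "closed \<dots>"
      by (intro closed_Int closed_INT ballI closed_Collect_eq continuous_intros continuous_on_product_coordinates)
    ultimately show ?thesis by simp
  qed
  moreover have "?S \<subseteq> ?B"
  proof
    fix x assume x: "x \<in> ?S"
    have "x i \<in> {-1..1}" for i
    proof (cases "i < N")
      case True
      have "x i * x i \<le> vdot x x" unfolding vdot_def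
        using True by (intro member_le_sum) auto
      then have "(x i)\<^sup>2 \<le> 1" using x by (simp add: power2_eq_square)
      then show ?thesis using abs_square_le_1[of "x i"] by auto
    qed (use x in auto)
    then show "x \<in> ?B" by auto
  qed
  ultimately show ?thesis
    using compact_Int_closed[of ?B ?S] by (simp add: Int_absorb1)
qed

text \<open>The maximiser \<open>x\<close> of the quadratic form on the unit sphere orthogonal to
  the earlier eigenvectors works, with the maximum as eigenvalue \<open>c\<close>: a nonzero
  residual \<open>A x - c x\<close> would be a direction of first-order increase.\<close>

lemma eigenvector_orthogonal:
  assumes A: "symmetric_mat A" and u: "orthonormal_family m u" and m: "m < N"
    and eig: "\<And>k i. k < m \<Longrightarrow> i < N \<Longrightarrow> mvec A (u k) i = a k * u k i"
  shows "\<exists>x c. vdot x x = 1 \<and> (\<forall>l<m. vdot x (u l) = 0) \<and> (\<forall>i<N. mvec A x i = c * x i)"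
proof -
  let ?S = "{x. (\<forall>i\<ge>N. x i = 0) \<and> vdot x x = 1 \<and> (\<forall>l<m. vdot x (u l) = 0)}"
  obtain x0 where x0: "vdot x0 x0 = 1" "\<forall>l<m. vdot x0 (u l) = 0"
    using extend_unit_vector[OF u m] by blast
  \<comment> \<open>The section asks for zeros from \<open>N\<close> on, while \<open>vdot\<close>
    does not see these coordinates; truncating \<open>x0\<close> is harmless.\<close>
  have "vdot (\<lambda>i. if i < N then x0 i else 0) y = vdot x0 y" for y by (simp add: vdot_def)
  moreover have "vdot y (\<lambda>i. if i < N then x0 i else 0) = vdot y x0" for y by (simp add: vdot_def)
  ultimately have "(\<lambda>i. if i < N then x0 i else 0) \<in> ?S" using x0 by simp
  moreover have "continuous_on ?S (\<lambda>x. vdot (mvec A x) x)"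
    unfolding mvec_def
    by (intro continuous_intros continuous_on_subset[OF continuous_on_product_coordinates]) auto
  ultimately have "\<exists>x\<in>?S. \<forall>y\<in>?S. vdot (mvec A y) y \<le> vdot (mvec A x) x"
    by (intro continuous_attains_sup compact_sphere_section) auto
  then obtain x where x: "x \<in> ?S" and max: "\<And>y. y \<in> ?S \<Longrightarrow> vdot (mvec A y) y \<le> vdot (mvec A x) x"
    by (elim bexE) simp
  define c where "c = vdot (mvec A x) x"
  define r where "r = (\<lambda>i. mvec A x i - c * x i)"
  have mv_lin: "mvec A (\<lambda>i. s * y i + s' * z i) = (\<lambda>i. s * mvec A y i + s' * mvec A z i)" for s s' y z
    by (auto simp: mvec_def algebra_simps sum.distrib sum_distrib_left)
  have quad: "vdot (mvec A y) y \<le> c * vdot y y" if y: "\<forall>l<m. vdot y (u l) = 0" for y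
  proof (cases "vdot y y = 0")
    case True
    then have "y i = 0" if "i < N" for i using vdot_eq_0D that by blast
    then show ?thesis by (simp add: vdot_def)
  next
    case False
    then have yy: "vdot y y > 0" using vdot_nonneg[of y] by linarith
    define s where "s = 1 / sqrt (vdot y y)"
    have ss: "s * (s * vdot y y) = 1" using yy by (simp add: s_def field_simps)
    define y' where "y' = (\<lambda>i. if i < N then s * y i else 0)"
    have l: "vdot y' z = s * vdot y z" for z
      by (simp add: vdot_def y'_def sum_distrib_left mult.assoc)
    have r: "vdot z y' = s * vdot z y" for z using l vdot_commute by metis
    have mv: "mvec A y' i = s * mvec A y i" for i
      by (simp add: mvec_def y'_def sum_distrib_left mult_ac)
    have "y' \<in> ?S" using y ss by (auto simp: l r y'_def[THEN fun_cong])
    from max[OF this] have "s * (s * vdot (mvec A y) y) \<le> c"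
      unfolding c_def mv[THEN ext] r by (simp add: vdot_scale_left)
    also have "c = s * (s * (c * vdot y y))" using ss by (simp add: algebra_simps)
    finally have "(s * s) * vdot (mvec A y) y \<le> (s * s) * (c * vdot y y)" by (simp add: mult_ac)
    moreover have "s * s > 0" using yy by (simp add: s_def)
    ultimately show ?thesis using mult_le_cancel_left_pos by blast
  qed
  \<comment> \<open>The span of the earlier eigenvectors is invariant under the symmetric
    \<open>A\<close>, hence so is its orthogonal complement; this keeps the residual
    \<open>r\<close> an admissible direction.\<close>
  have orth_A: "vdot (mvec A x) (u l) = 0" if "l < m" for l
  proof -
    have "vdot (mvec A x) (u l) = vdot x (mvec A (u l))" by (rule mvec_symmetric[OF A])
    also have "\<dots> = vdot x (\<lambda>i. a l * u l i)" unfolding vdot_def using eig[OF that] by simp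
    also have "\<dots> = 0" using x that by (simp add: vdot_scale_right)
    finally show ?thesis .
  qed
  have r_orth: "\<forall>l<m. vdot r (u l) = 0"
    using x orth_A by (simp add: r_def vdot_diff_left vdot_scale_left)
  have xr: "vdot x r = 0"
    using x by (simp add: r_def vdot_diff_right vdot_scale_right c_def vdot_commute)
  \<comment> \<open>First variation of the Rayleigh quotient in the direction of the residual \<open>r\<close>.\<close>
  have var: "2 * s * vdot r r + s\<^sup>2 * (vdot (mvec A r) r - c * vdot r r) \<le> 0" for s
  proof -
    let ?y = "\<lambda>i. 1 * x i + s * r i"
    have "vdot (mvec A ?y) ?y \<le> c * vdot ?y ?y"
      using x r_orth by (intro quad) (simp add: vdot_add_left vdot_scale_left)
    moreover have "vdot (mvec A x) r = vdot r r"
      using xr by (simp add: r_def vdot_diff_right vdot_diff_left vdot_scale_right vdot_scale_left vdot_commute)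
    moreover have "vdot (mvec A r) x = vdot r r"
      using calculation(2) mvec_symmetric[OF A, of r x] by (simp add: vdot_commute)
    ultimately show ?thesis using xr x
      unfolding mv_lin by (simp add: vdot_add_left vdot_add_right vdot_scale_left vdot_scale_right
          c_def[symmetric] vdot_commute[of r x] algebra_simps power2_eq_square)
  qed
  have "vdot r r = 0"
  proof (rule ccontr)
    assume "vdot r r \<noteq> 0"
    then have rr: "vdot r r > 0" using vdot_nonneg[of r] by linarith
    define d where "d = vdot (mvec A r) r - c * vdot r r"
    \<comment> \<open>So small that the quadratic term cannot outweigh the linear one:
      \<open>s * \<bar>d\<bar> < vdot r r\<close>.\<close>
    define s where "s = vdot r r / (1 + \<bar>d\<bar>)"
    have s: "s > 0" using rr by (simp add: s_def)
    have "s * \<bar>d\<bar> < s * (1 + \<bar>d\<bar>)" using s by simp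
    also have "\<dots> = vdot r r" by (simp add: s_def)
    finally have "- (s * d) < 2 * vdot r r" using rr by (smt (verit) abs_ge_minus_self minus_mult_right mult_left_mono s)
    then have "0 < s * (2 * vdot r r + s * d)" using s by (intro mult_pos_pos) auto
    then show False using var[of s] by (simp add: d_def algebra_simps power2_eq_square)
  qed
  then have "mvec A x i = c * x i" if "i < N" for i
    using vdot_eq_0D[of r i] that by (simp add: r_def)
  then show ?thesis using x by blast
qed

theorem spectral_theorem:
  assumes A: "symmetric_mat A"
  shows "\<exists>u a. spectral_decomp A u a"
proof -
  have "\<exists>u a. orthonormal_family m u \<and> (\<forall>k<m. \<forall>i<N. mvec A (u k) i = a k * u k i)" if "m \<le> N" for m
    using that
  proof (induction m)
    case 0
    then show ?case by (auto simp: orthonormal_family_def)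
  next
    case (Suc m)
    then obtain u a where u: "orthonormal_family m u" "\<forall>k<m. \<forall>i<N. mvec A (u k) i = a k * u k i"
      by auto
    obtain x c where x: "vdot x x = 1" "\<forall>l<m. vdot x (u l) = 0" "\<forall>i<N. mvec A x i = c * x i"
      using eigenvector_orthogonal[OF A u(1), of a] Suc.prems u(2) by auto
    have "orthonormal_family (Suc m) (u(m := x))"
      using u(1) x(1,2) by (auto simp: orthonormal_family_def less_Suc_eq vdot_commute)
    moreover have "\<forall>k<Suc m. \<forall>i<N. mvec A ((u(m := x)) k) i = (a(m := c)) k * (u(m := x)) k i"
      using u(2) x(3) by (auto simp: less_Suc_eq)
    ultimately show ?case by blast
  qed
  then obtain u a where u: "orthonormal_family N u" and eig: "\<forall>k<N. \<forall>i<N. mvec A (u k) i = a k * u k i"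
    by blast
  have "A i j = (\<Sum>k<N. a k * u k i * u k j)" if ij: "i < N" "j < N" for i j
  proof -
    have "(\<Sum>k<N. a k * u k i * u k j) = (\<Sum>k<N. \<Sum>l<N. A i l * (u k l * u k j))"
    proof (intro sum.cong refl)
      fix k assume "k \<in> {..<N}"
      then have "(\<Sum>l<N. A i l * u k l) * u k j = a k * u k i * u k j"
        using eig ij by (simp add: mvec_def)
      then show "a k * u k i * u k j = (\<Sum>l<N. A i l * (u k l * u k j))"
        by (simp add: sum_distrib_right mult.assoc)
    qed
    also have "\<dots> = (\<Sum>l<N. A i l * (\<Sum>k<N. u k l * u k j))"
      by (subst sum.swap) (simp add: sum_distrib_left)
    also have "\<dots> = A i j" using ij by (simp add: orthonormal_complete[OF u] if_distrib cong: if_cong)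
    finally show ?thesis by simp
  qed
  then show ?thesis using u unfolding spectral_decomp_def by blast
qed

end

section \<open>Relative entropy of positive matrices\<close>

text \<open>The divided difference of \<open>ln\<close>. Its values at pairs of eigenvalues of a
  positive matrix form the kernel of the derivative of the matrix logarithm there.\<close>

definition logdiv :: "real \<Rightarrow> real \<Rightarrow> real" where
  "logdiv a b = (if a = b then 1 / a else (ln a - ln b) / (a - b))"

text \<open>The divided difference of \<open>x * ln x\<close>. Only its diagonal value
  \<open>ln c + 1\<close> survives in the final minorant.\<close>

definition xlogx_slope :: "real \<Rightarrow> real \<Rightarrow> real" where
  "xlogx_slope c d = (if c = d then ln c + 1 else (c * ln c - d * ln d) / (c - d))"

text \<open>Partial fractions. The density decays like \<open>1 / x\<close>, so its integral over
  the half-line diverges and \<open>ln (1 + x)\<close> serves as counterterm; the regularised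
  integral is \<open>xlogx_slope c d - ln a\<close>.\<close>

lemma xlogx_slope_antiderivative:
  assumes "c > 0" "d > 0" "a > 0"
  shows "\<exists>G. (\<forall>x\<ge>0. (G has_real_derivative
            (a * (c + d) + x * c * d) / ((a + x * c) * (a + x * d))) (at x)) \<and>
          ((\<lambda>x. G x - ln (1 + x)) \<longlongrightarrow> xlogx_slope c d) at_top \<and> G 0 = ln a"
proof (cases "c = d")
  case True
  let ?G = "\<lambda>x. ln (a + x * c) - a / (a + x * c) + 1"
  have "(?G has_real_derivative (a * (c + d) + x * c * d) / ((a + x * c) * (a + x * d))) (at x)"
    if x: "x \<ge> 0" for x
  proof -
    have *: "a + x * c > 0" using assms x by (simp add: add_pos_nonneg)
    have "(?G has_real_derivative c / (a + x * c) + a * c / (a + x * c)^2) (at x)"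
      using * by (auto intro!: derivative_eq_intros simp: power2_eq_square)
    also have "c / (a + x * c) + a * c / (a + x * c)^2 = (a * (c + d) + x * c * d) / ((a + x * c) * (a + x * d))"
      using * True by (simp add: divide_simps power2_eq_square) (simp add: algebra_simps)
    finally show ?thesis .
  qed
  moreover have "((\<lambda>x. ?G x - ln (1 + x)) \<longlongrightarrow> ln c + 1) at_top"
    using assms by real_asymp
  ultimately show ?thesis using True assms by (intro exI[of _ ?G]) (auto simp: xlogx_slope_def)
next
  case False
  let ?G = "\<lambda>x. (c * ln (a + x * c) - d * ln (a + x * d)) / (c - d)"
  have "(?G has_real_derivative (a * (c + d) + x * c * d) / ((a + x * c) * (a + x * d))) (at x)"
    if x: "x \<ge> 0" for x
  proof -
    have *: "a + x * c > 0" "a + x * d > 0" using assms x by (simp_all add: add_pos_nonneg)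
    have "(?G has_real_derivative (c * (c / (a + x * c)) - d * (d / (a + x * d))) / (c - d)) (at x)"
      using * False by (auto intro!: derivative_eq_intros)
    also have "(c * (c / (a + x * c)) - d * (d / (a + x * d)))
        = ((c - d) * (a * (c + d) + x * c * d)) / ((a + x * c) * (a + x * d))"
      using * by (simp add: divide_simps) (simp add: algebra_simps)
    also have "\<dots> / (c - d) = (a * (c + d) + x * c * d) / ((a + x * c) * (a + x * d))"
      using False by simp
    finally show ?thesis .
  qed
  moreover have "((\<lambda>x. ?G x - ln (1 + x)) \<longlongrightarrow> (c * ln c - d * ln d) / (c - d)) at_top"
  proof -
    have l: "((\<lambda>x. ln (a + x * e) - ln (1 + x)) \<longlongrightarrow> ln e) at_top" if "e > 0" for e
      using assms(3) that by real_asymp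
    have "((\<lambda>x. (c * (ln (a + x * c) - ln (1 + x)) - d * (ln (a + x * d) - ln (1 + x))) / (c - d))
        \<longlongrightarrow> (c * ln c - d * ln d) / (c - d)) at_top"
      using False assms by (intro tendsto_intros l) auto
    moreover have "(c * (ln (a + x * c) - ln (1 + x)) - d * (ln (a + x * d) - ln (1 + x))) / (c - d)
        = ?G x - ln (1 + x)" for x
      using False by (simp add: divide_simps) (simp add: algebra_simps)
    ultimately show ?thesis by simp
  qed
  moreover have "?G 0 = ln a" using False by (simp add: divide_simps) (simp add: algebra_simps)
  ultimately show ?thesis using False by (intro exI[of _ ?G]) (auto simp: xlogx_slope_def)
qed

text \<open>The integral of the density over the half-line is \<open>c * logdiv a b\<close>. It is
  stated through an antiderivative so that \<open>entropy_minorant\<close> can argue by monotonicity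
  instead of improper integrals.\<close>

lemma logdiv_antiderivative:
  assumes "c > 0" "a > 0" "b > 0"
  shows "\<exists>G. (\<forall>x\<ge>0. (G has_real_derivative c\<^sup>2 / ((a + x * c) * (b + x * c))) (at x)) \<and>
          (G \<longlongrightarrow> 0) at_top \<and> G 0 = - (c * logdiv a b)"
proof (cases "a = b")
  case True
  let ?G = "\<lambda>x. - c / (a + x * c)"
  have "(?G has_real_derivative c\<^sup>2 / ((a + x * c) * (b + x * c))) (at x)" if x: "x \<ge> 0" for x
  proof -
    have *: "a + x * c > 0" using assms x by (simp add: add_pos_nonneg)
    show ?thesis
      using * True by (auto intro!: derivative_eq_intros simp: power2_eq_square)
  qed
  moreover have "(?G \<longlongrightarrow> 0) at_top" using assms by real_asymp
  ultimately show ?thesis using True by (intro exI[of _ ?G]) (auto simp: logdiv_def)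
next
  case False
  let ?G = "\<lambda>x. c * (ln (b + x * c) - ln (a + x * c)) / (a - b)"
  have "(?G has_real_derivative c\<^sup>2 / ((a + x * c) * (b + x * c))) (at x)" if x: "x \<ge> 0" for x
  proof -
    have *: "a + x * c > 0" "b + x * c > 0" using assms x by (simp_all add: add_pos_nonneg)
    have "(?G has_real_derivative c * (c / (b + x * c) - c / (a + x * c)) / (a - b)) (at x)"
      using * False by (auto intro!: derivative_eq_intros)
    also have "c * (c / (b + x * c) - c / (a + x * c))
        = (c\<^sup>2 * (a - b)) / ((a + x * c) * (b + x * c))"
      using * by (simp add: divide_simps) (simp add: algebra_simps power2_eq_square)
    also have "\<dots> / (a - b) = c\<^sup>2 / ((a + x * c) * (b + x * c))"
      using False by simp
    finally show ?thesis .
  qed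
  moreover have "(?G \<longlongrightarrow> 0) at_top"
  proof -
    have "((\<lambda>x. ln (b + x * c) - ln (a + x * c)) \<longlongrightarrow> 0) at_top" using assms by real_asymp
    from tendsto_divide[OF tendsto_mult[OF tendsto_const this], of "\<lambda>_. a - b" "a - b" c] False
    show ?thesis by simp
  qed
  moreover have "?G 0 = - (c * ((ln a - ln b) / (a - b)))"
    using False by (simp add: divide_simps) (simp add: algebra_simps)
  ultimately show ?thesis using False by (intro exI[of _ ?G]) (auto simp: logdiv_def)
qed

section \<open>The affine minorant of the relative entropy\<close>

context
  fixes N :: nat
begin

text \<open>Both sides are the inner product of the vectors with coordinates \<open>p\<close> and
  \<open>q\<close> in the basis \<open>v\<close>; the left side computes it in the basis
  \<open>r\<close>.\<close>

lemma coordinate_change: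
  assumes v: "orthonormal_family N N v" and r: "orthonormal_family N N r"
  shows "(\<Sum>l<N. (\<Sum>j<N. p j * vdot N (v j) (r l)) * (\<Sum>j<N. q j * vdot N (v j) (r l)))
    = (\<Sum>j<N. p j * q j)"
proof -
  have e: "vdot N (\<lambda>i. \<Sum>j<N. p j * v j i) (r l) = (\<Sum>j<N. p j * vdot N (v j) (r l))" for p l
    by (simp add: vdot_sum_left vdot_scale_left)
  have "(\<Sum>l<N. (\<Sum>j<N. p j * vdot N (v j) (r l)) * (\<Sum>j<N. q j * vdot N (v j) (r l)))
    = vdot N (\<lambda>i. \<Sum>j<N. p j * v j i) (\<lambda>i. \<Sum>j<N. q j * v j i)"
    unfolding e[symmetric] by (rule parseval[OF r, symmetric])
  also have "\<dots> = (\<Sum>j<N. p j * (\<Sum>k<N. q k * vdot N (v j) (v k)))"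
    by (simp add: vdot_sum_left vdot_scale_left vdot_sum_right vdot_scale_right)
  also have "\<dots> = (\<Sum>j<N. p j * (\<Sum>k<N. if k = j then q k else 0))"
    using v by (intro sum.cong refl arg_cong[where f="(*) _"]) (auto simp: orthonormal_family_def)
  finally show ?thesis by simp
qed

lemma sum_sq_coordinates:
  assumes "orthonormal_family N N u" "orthonormal_family N N s" "k < N"
  shows "(\<Sum>i<N. (vdot N (u i) (s k))\<^sup>2) = 1"
  using parseval[OF assms(1), of "s k" "s k"] assms(2,3)
  by (simp add: orthonormal_family_def vdot_commute power2_eq_square)

text \<open>
  The summand on the right is the supremum over all matrices \<open>Y\<close> of an expression affine in the pair
  \<open>(T, B)\<close>, where \<open>T\<close> and \<open>B\<close> have eigendata \<open>(s, \<tau>)\<close> and \<open>(r, \<beta>)\<close>. The left-hand side is the value at the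
  \<open>Y\<close> that is optimal for the pair \<open>(C, A)\<close> with eigendata \<open>(u, c)\<close> and \<open>(v, a)\<close>.
\<close>

lemma entropy_minorant_density:
  assumes s: "orthonormal_family N N s" and r: "orthonormal_family N N r"
    and u: "orthonormal_family N N u" and v: "orthonormal_family N N v"
    and pos: "\<And>k. \<tau> k > 0" "\<And>k. \<beta> k > 0" "\<And>k. c k > 0" "\<And>k. a k > 0"
    and x: "x \<ge> 0"
  shows "(\<Sum>k<N. \<tau> k * (\<Sum>j<N. \<Sum>i<N. \<Sum>i'<N.
            vdot N (u i) (s k) * vdot N (u i') (s k) * (vdot N (u i) (v j) * vdot N (u i') (v j)) *
            ((a j * (c i + c i') + x * c i * c i') / ((a j + x * c i) * (a j + x * c i')))))
       - (\<Sum>l<N. \<beta> l * (\<Sum>i<N. \<Sum>j<N. \<Sum>j'<N.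
            vdot N (u i) (v j) * vdot N (u i) (v j') * (vdot N (v j) (r l) * vdot N (v j') (r l)) *
            ((c i)\<^sup>2 / ((a j + x * c i) * (a j' + x * c i)))))
      \<le> (\<Sum>k<N. \<Sum>l<N. (vdot N (s k) (r l))\<^sup>2 * \<tau> k * (\<tau> k / (\<beta> l + x * \<tau> k)))"
    (is "(\<Sum>k<N. \<tau> k * ?f k) - (\<Sum>l<N. \<beta> l * ?g l) \<le> ?R")
proof -
  define w where "w i j = vdot N (u i) (v j)" for i j
  define P where "P k i = vdot N (u i) (s k)" for k i
  define Q where "Q j l = vdot N (v j) (r l)" for j l
  define V where "V j k = vdot N (v j) (s k)" for j k
  define z where "z k l = vdot N (s k) (r l)" for k l
  \<comment> \<open>The entries, in the bases \<open>u\<close> and \<open>v\<close>, of the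
    maximiser \<open>Y\<close> for the pair \<open>(C, A)\<close>, that is, of the solution of
    \<open>Y A + x C Y = C\<close>; \<open>w\<close> holds the entries of the identity. Below,
    \<open>\<eta>\<close> is the same \<open>Y\<close> in the bases \<open>s\<close> and
    \<open>r\<close>, while \<open>Ys\<close> and \<open>Yr\<close> mix one old and one new
    basis.\<close>
  define y where "y i j = c i * w i j / (a j + x * c i)" for i j
  define Ys where "Ys k j = (\<Sum>i<N. y i j * P k i)" for k j
  define Yr where "Yr l i = (\<Sum>j<N. y i j * Q j l)" for l i
  define \<eta> where "\<eta> k l = (\<Sum>j<N. Ys k j * Q j l)" for k l
  have ac: "a j + x * c i > 0" for i j
    using pos(3)[of i] pos(4)[of j] x by (simp add: add_pos_nonneg)
  have \<eta>': "\<eta> k l = (\<Sum>i<N. Yr l i * P k i)" for k l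
    unfolding \<eta>_def Ys_def Yr_def sum_distrib_right
    by (subst sum.swap) (simp add: mult_ac)
  have V: "V j k = (\<Sum>i<N. w i j * P k i)" for j k
    unfolding V_def w_def P_def by (subst parseval[OF u]) (simp add: vdot_commute)
  have z: "z k l = (\<Sum>j<N. V j k * Q j l)" for k l
    unfolding V_def z_def Q_def by (subst parseval[OF v]) (simp add: vdot_commute)
  \<comment> \<open>Every term to be compared carries a weight in only one of the indices
    \<open>k\<close> and \<open>l\<close>; the other one can be moved to the basis in which the
    entries of \<open>Y\<close> are explicit.\<close>
  have 1: "(\<Sum>k<N. (\<eta> k l)\<^sup>2) = (\<Sum>i<N. (Yr l i)\<^sup>2)" for l
    unfolding \<eta>' power2_eq_square P_def by (rule coordinate_change[OF u s])
  have 2: "(\<Sum>l<N. (\<eta> k l)\<^sup>2) = (\<Sum>j<N. (Ys k j)\<^sup>2)" for k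
    unfolding \<eta>_def power2_eq_square Q_def by (rule coordinate_change[OF v r])
  have 3: "(\<Sum>l<N. \<eta> k l * z k l) = (\<Sum>j<N. Ys k j * V j k)" for k
    unfolding \<eta>_def z Q_def by (rule coordinate_change[OF v r])
  have g: "?g l = (\<Sum>i<N. (Yr l i)\<^sup>2)" for l
    unfolding Yr_def power2_eq_square sum_product
    by (intro sum.cong refl) (simp add: y_def w_def Q_def)
  have f: "?f k = (\<Sum>j<N. 2 * (Ys k j * V j k) - x * (Ys k j)\<^sup>2)" for k
  proof (intro sum.cong refl)
    fix j
    have YV: "Ys k j * V j k = (\<Sum>i<N. \<Sum>i'<N. P k i * P k i' * (y i j * w i' j))"
      unfolding Ys_def V sum_product by (simp add: mult_ac)
    have YV': "Ys k j * V j k = (\<Sum>i<N. \<Sum>i'<N. P k i * P k i' * (y i' j * w i j))"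
      unfolding YV by (subst sum.swap) (simp add: mult_ac)
    have YY: "x * (Ys k j)\<^sup>2 = (\<Sum>i<N. \<Sum>i'<N. P k i * P k i' * (x * y i j * y i' j))"
      unfolding Ys_def power2_eq_square sum_product by (simp add: sum_distrib_left mult_ac)
    have "2 * (Ys k j * V j k) - x * (Ys k j)\<^sup>2 = (\<Sum>i<N. \<Sum>i'<N. P k i * P k i' * (y i j * w i' j)
        + P k i * P k i' * (y i' j * w i j) - P k i * P k i' * (x * y i j * y i' j))"
      unfolding sum.distrib sum_subtractf YV[symmetric] YV'[symmetric] YY[symmetric] by simp
    also have "\<dots> = (\<Sum>i<N. \<Sum>i'<N. P k i * P k i' * (w i j * w i' j) *
            ((a j * (c i + c i') + x * c i * c i') / ((a j + x * c i) * (a j + x * c i'))))"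
    proof (intro sum.cong refl)
      fix i i'
      have *: "y i j * w i' j + y i' j * w i j - x * y i j * y i' j
        = w i j * w i' j * ((a j * (c i + c i') + x * c i * c i') / ((a j + x * c i) * (a j + x * c i')))"
        using ac[of j i] ac[of j i'] unfolding y_def
        by (simp add: divide_simps) (simp add: algebra_simps)
      have "P k i * P k i' * (y i j * w i' j)
        + P k i * P k i' * (y i' j * w i j) - P k i * P k i' * (x * y i j * y i' j)
        = P k i * P k i' * (y i j * w i' j + y i' j * w i j - x * y i j * y i' j)"
        by (simp add: algebra_simps)
      then show "P k i * P k i' * (y i j * w i' j)
        + P k i * P k i' * (y i' j * w i j) - P k i * P k i' * (x * y i j * y i' j)
        = P k i * P k i' * (w i j * w i' j) *
            ((a j * (c i + c i') + x * c i * c i') / ((a j + x * c i) * (a j + x * c i')))"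
        unfolding * by (simp add: mult.assoc)
    qed
    finally show "(\<Sum>i<N. \<Sum>i'<N.
            vdot N (u i) (s k) * vdot N (u i') (s k) * (vdot N (u i) (v j) * vdot N (u i') (v j)) *
            ((a j * (c i + c i') + x * c i * c i') / ((a j + x * c i) * (a j + x * c i'))))
      = 2 * (Ys k j * V j k) - x * (Ys k j)\<^sup>2"
      by (simp add: P_def w_def)
  qed
  have "(\<Sum>k<N. \<tau> k * ?f k) - (\<Sum>l<N. \<beta> l * ?g l)
      = (\<Sum>k<N. \<tau> k * (2 * (\<Sum>l<N. \<eta> k l * z k l) - x * (\<Sum>l<N. (\<eta> k l)\<^sup>2)))
        - (\<Sum>l<N. \<beta> l * (\<Sum>k<N. (\<eta> k l)\<^sup>2))"
    unfolding f g 1 2 3 by (simp add: sum_subtractf sum_distrib_left)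
  also have "(\<Sum>l<N. \<beta> l * (\<Sum>k<N. (\<eta> k l)\<^sup>2)) = (\<Sum>k<N. \<Sum>l<N. \<beta> l * (\<eta> k l)\<^sup>2)"
    unfolding sum_distrib_left by (rule sum.swap)
  also have "(\<Sum>k<N. \<tau> k * (2 * (\<Sum>l<N. \<eta> k l * z k l) - x * (\<Sum>l<N. (\<eta> k l)\<^sup>2))) - \<dots>
      = (\<Sum>k<N. \<Sum>l<N. \<tau> k * (2 * (\<eta> k l * z k l) - x * (\<eta> k l)\<^sup>2) - \<beta> l * (\<eta> k l)\<^sup>2)"
    by (simp add: sum_subtractf sum.distrib sum_distrib_left algebra_simps)
  also have "\<dots> \<le> (\<Sum>k<N. \<Sum>l<N. (z k l)\<^sup>2 * \<tau> k * (\<tau> k / (\<beta> l + x * \<tau> k)))"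
  proof (intro sum_mono)
    fix k l
    have b: "\<beta> l + x * \<tau> k > 0" using pos(1)[of k] pos(2)[of l] x by (simp add: add_pos_nonneg)
    \<comment> \<open>Completing the square in \<open>\<eta> k l\<close>: the bound holds for any
      value and is sharp at \<open>\<tau> k * z k l / (\<beta> l + x * \<tau> k)\<close>, which has
      the form of \<open>y\<close>.\<close>
    have "0 \<le> (z k l * \<tau> k - \<eta> k l * (\<beta> l + x * \<tau> k))\<^sup>2 / (\<beta> l + x * \<tau> k)"
      using b by simp
    also have "\<dots> = (z k l)\<^sup>2 * \<tau> k * (\<tau> k / (\<beta> l + x * \<tau> k))
        - (\<tau> k * (2 * (\<eta> k l * z k l) - x * (\<eta> k l)\<^sup>2) - \<beta> l * (\<eta> k l)\<^sup>2)"
      using b by (simp add: divide_simps) (simp add: algebra_simps power2_eq_square)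
    finally show "\<tau> k * (2 * (\<eta> k l * z k l) - x * (\<eta> k l)\<^sup>2) - \<beta> l * (\<eta> k l)\<^sup>2
      \<le> (z k l)\<^sup>2 * \<tau> k * (\<tau> k / (\<beta> l + x * \<tau> k))" by simp
  qed
  finally show ?thesis by (simp add: z_def)
qed


text \<open>This is the density inequality integrated over \<open>x \<ge> 0\<close>. The right-hand
  side is \<open>tr T (log T - log B)\<close>; the left-hand side is linear in \<open>(T, B)\<close>
  and agrees with it at \<open>(C, A)\<close>, hence it is a supporting hyperplane that witnesses
  joint convexity.\<close>

theorem entropy_minorant:
  assumes s: "orthonormal_family N N s" and r: "orthonormal_family N N r"
    and u: "orthonormal_family N N u" and v: "orthonormal_family N N v"
    and pos: "\<And>k. \<tau> k > 0" "\<And>k. \<beta> k > 0" "\<And>k. c k > 0" "\<And>k. a k > 0"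
  shows "(\<Sum>k<N. \<tau> k * ((\<Sum>i<N. (vdot N (u i) (s k))\<^sup>2 * (ln (c i) + 1))
            - (\<Sum>j<N. (vdot N (v j) (s k))\<^sup>2 * ln (a j))))
       - (\<Sum>l<N. \<beta> l * (\<Sum>i<N. \<Sum>j<N. \<Sum>j'<N.
            vdot N (u i) (v j) * vdot N (u i) (v j') * (vdot N (v j) (r l) * vdot N (v j') (r l)) *
            (c i * logdiv (a j) (a j'))))
      \<le> (\<Sum>k<N. \<Sum>l<N. (vdot N (s k) (r l))\<^sup>2 * \<tau> k * (ln (\<tau> k) - ln (\<beta> l)))"
proof -
  define w where "w i j = vdot N (u i) (v j)" for i j
  define P where "P k i = vdot N (u i) (s k)" for k i
  define Q where "Q j l = vdot N (v j) (r l)" for j l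
  define V where "V j k = vdot N (v j) (s k)" for j k
  define z where "z k l = vdot N (s k) (r l)" for k l
  have V: "V j k = (\<Sum>i<N. w i j * P k i)" for j k
    unfolding V_def w_def P_def by (subst parseval[OF u]) (simp add: vdot_commute)
  define F where "F j i i' = (SOME G. (\<forall>x\<ge>0. (G has_real_derivative
            (a j * (c i + c i') + x * c i * c i') / ((a j + x * c i) * (a j + x * c i'))) (at x)) \<and>
          ((\<lambda>x. G x - ln (1 + x)) \<longlongrightarrow> xlogx_slope (c i) (c i')) at_top \<and> G 0 = ln (a j))" for j i i'
  note F' = someI_ex[OF xlogx_slope_antiderivative[OF pos(3) pos(3) pos(4)], folded F_def]
  have F: "(F j i i' has_real_derivative
            (a j * (c i + c i') + x * c i * c i') / ((a j + x * c i) * (a j + x * c i'))) (at x)"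
    if "x \<ge> 0" for j i i' x using F' that by blast
  have F_lim: "((\<lambda>x. F j i i' x - ln (1 + x)) \<longlongrightarrow> xlogx_slope (c i) (c i')) at_top"
    and F_0: "F j i i' 0 = ln (a j)" for j i i'
    using F' by blast+
  define G where "G i j j' = (SOME G. (\<forall>x\<ge>0. (G has_real_derivative
            (c i)\<^sup>2 / ((a j + x * c i) * (a j' + x * c i))) (at x)) \<and>
          (G \<longlongrightarrow> 0) at_top \<and> G 0 = - (c i * logdiv (a j) (a j')))" for i j j'
  note G' = someI_ex[OF logdiv_antiderivative[OF pos(3) pos(4) pos(4)], folded G_def]
  have G: "(G i j j' has_real_derivative (c i)\<^sup>2 / ((a j + x * c i) * (a j' + x * c i))) (at x)"
    if "x \<ge> 0" for i j j' x using G' that by blast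
  have G_lim: "(G i j j' \<longlongrightarrow> 0) at_top" and G_0: "G i j j' 0 = - (c i * logdiv (a j) (a j'))" for i j j'
    using G' by blast+
  define \<Phi> where "\<Phi> x = (\<Sum>k<N. \<tau> k * (\<Sum>j<N. \<Sum>i<N. \<Sum>i'<N. P k i * P k i' * (w i j * w i' j) * F j i i' x))
    - (\<Sum>l<N. \<beta> l * (\<Sum>i<N. \<Sum>j<N. \<Sum>j'<N. w i j * w i j' * (Q j l * Q j' l) * G i j j' x))" for x
  \<comment> \<open>An antiderivative of the right density minus the left one. It is nondecreasing,
    so its value at 0 is at most its limit at infinity.\<close>
  define \<Psi> where "\<Psi> x = (\<Sum>k<N. \<Sum>l<N. (z k l)\<^sup>2 * \<tau> k * ln (\<beta> l + x * \<tau> k)) - \<Phi> x" for x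
  have mono: "\<Psi> 0 \<le> \<Psi> x" if "x \<ge> 0" for x
  proof (rule DERIV_nonneg_imp_nondecreasing[OF that])
    fix y :: real assume y: "0 \<le> y" "y \<le> x"
    let ?D = "(\<Sum>k<N. \<Sum>l<N. (z k l)\<^sup>2 * \<tau> k * (\<tau> k / (\<beta> l + y * \<tau> k)))
      - ((\<Sum>k<N. \<tau> k * (\<Sum>j<N. \<Sum>i<N. \<Sum>i'<N. P k i * P k i' * (w i j * w i' j) *
            ((a j * (c i + c i') + y * c i * c i') / ((a j + y * c i) * (a j + y * c i')))))
       - (\<Sum>l<N. \<beta> l * (\<Sum>i<N. \<Sum>j<N. \<Sum>j'<N. w i j * w i j' * (Q j l * Q j' l) *
            ((c i)\<^sup>2 / ((a j + y * c i) * (a j' + y * c i))))))"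
    have ln': "((\<lambda>x. ln (\<beta> l + x * \<tau> k)) has_real_derivative \<tau> k / (\<beta> l + y * \<tau> k)) (at y)" for k l
    proof -
      have "\<beta> l + y * \<tau> k > 0" using pos(1)[of k] pos(2)[of l] y by (simp add: add_pos_nonneg)
      then show ?thesis by (auto intro!: derivative_eq_intros)
    qed
    have "(\<Psi> has_real_derivative ?D) (at y)"
      unfolding \<Psi>_def \<Phi>_def by (intro DERIV_diff DERIV_sum DERIV_cmult F G y(1) ln')
    moreover have "?D \<ge> 0"
      using entropy_minorant_density[of s r u v \<tau> \<beta> c a y, OF s r u v pos y(1)]
      by (simp add: P_def Q_def w_def z_def)
    ultimately show "\<exists>d. (\<Psi> has_real_derivative d) (at y) \<and> 0 \<le> d" by blast
  qed
  have w_orth: "(\<Sum>j<N. w i j * w i' j) = (if i = i' then 1 else 0)" if "i < N" "i' < N" for i i'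
    using parseval[OF v, of "u i" "u i'"] u that by (simp add: w_def orthonormal_family_def)
  \<comment> \<open>Once the last factor no longer depends on \<open>j\<close>, orthonormality of
    the rows of \<open>w\<close> leaves only the terms with \<open>i = i'\<close>.\<close>
  have pull: "(\<Sum>j<N. \<Sum>i<N. \<Sum>i'<N. P k i * P k i' * (w i j * w i' j) * h i i')
      = (\<Sum>i<N. (P k i)\<^sup>2 * h i i)" for k h
  proof -
    have "(\<Sum>j<N. \<Sum>i<N. \<Sum>i'<N. P k i * P k i' * (w i j * w i' j) * h i i')
        = (\<Sum>i<N. \<Sum>j<N. \<Sum>i'<N. P k i * P k i' * h i i' * (w i j * w i' j))"
      by (subst sum.swap) (simp add: mult_ac)
    also have "\<dots> = (\<Sum>i<N. \<Sum>i'<N. \<Sum>j<N. P k i * P k i' * h i i' * (w i j * w i' j))"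
      by (intro sum.cong refl sum.swap)
    also have "\<dots> = (\<Sum>i<N. \<Sum>i'<N. P k i * P k i' * h i i' * (if i = i' then 1 else 0))"
      unfolding sum_distrib_left[symmetric] by (intro sum.cong refl) (simp add: w_orth)
    also have "\<dots> = (\<Sum>i<N. (P k i)\<^sup>2 * h i i)"
      by (intro sum.cong refl) (simp add: power2_eq_square if_distrib cong: if_cong)
    finally show ?thesis .
  qed
  have P1: "(\<Sum>i<N. (P k i)\<^sup>2) = 1" if "k < N" for k
    unfolding P_def by (rule sum_sq_coordinates[OF u s that])
  have z1: "(\<Sum>l<N. (z k l)\<^sup>2) = 1" if "k < N" for k
    using sum_sq_coordinates[OF r s that] by (simp add: z_def vdot_commute)
  \<comment> \<open>The single terms of \<open>\<Psi>\<close> with \<open>ln\<close> or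
    \<open>F\<close> grow like \<open>ln (1 + x)\<close>, with total weight the sum of the
    \<open>\<tau> k\<close> on either side. Subtracting \<open>ln (1 + x)\<close> in each of them
    therefore does not change the function, but makes every term converge.\<close>
  define \<Psi>' where "\<Psi>' x = (\<Sum>k<N. \<Sum>l<N. (z k l)\<^sup>2 * \<tau> k * (ln (\<beta> l + x * \<tau> k) - ln (1 + x)))
    - ((\<Sum>k<N. \<tau> k * (\<Sum>j<N. \<Sum>i<N. \<Sum>i'<N. P k i * P k i' * (w i j * w i' j) * (F j i i' x - ln (1 + x))))
    - (\<Sum>l<N. \<beta> l * (\<Sum>i<N. \<Sum>j<N. \<Sum>j'<N. w i j * w i j' * (Q j l * Q j' l) * G i j j' x)))" for x
  have "\<Psi>' x = \<Psi> x" for x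
  proof -
    have "(\<Sum>k<N. \<Sum>l<N. (z k l)\<^sup>2 * \<tau> k * ln (1 + x)) = (\<Sum>k<N. (\<Sum>l<N. (z k l)\<^sup>2) * (\<tau> k * ln (1 + x)))"
      by (simp only: sum_distrib_right mult.assoc)
    then have 1: "(\<Sum>k<N. \<Sum>l<N. (z k l)\<^sup>2 * \<tau> k * ln (1 + x)) = (\<Sum>k<N. \<tau> k * ln (1 + x))"
      using z1 by simp
    have "(\<Sum>j<N. \<Sum>i<N. \<Sum>i'<N. P k i * P k i' * (w i j * w i' j) * ln (1 + x)) = ln (1 + x)" if "k < N" for k
      unfolding pull using P1[OF that] by (simp flip: sum_distrib_right)
    then have 2: "(\<Sum>k<N. \<tau> k * (\<Sum>j<N. \<Sum>i<N. \<Sum>i'<N. P k i * P k i' * (w i j * w i' j) * ln (1 + x)))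
        = (\<Sum>k<N. \<tau> k * ln (1 + x))" by simp
    show ?thesis
      unfolding \<Psi>'_def \<Psi>_def \<Phi>_def right_diff_distrib sum_subtractf 1 2 by simp
  qed
  moreover have "(\<Psi>' \<longlongrightarrow> (\<Sum>k<N. \<Sum>l<N. (z k l)\<^sup>2 * \<tau> k * ln (\<tau> k))
    - ((\<Sum>k<N. \<tau> k * (\<Sum>j<N. \<Sum>i<N. \<Sum>i'<N. P k i * P k i' * (w i j * w i' j) * xlogx_slope (c i) (c i')))
    - (\<Sum>l<N. \<beta> l * (\<Sum>i<N. \<Sum>j<N. \<Sum>j'<N. w i j * w i j' * (Q j l * Q j' l) * 0)))) at_top"
  proof -
    have "((\<lambda>x. ln (\<beta> l + x * \<tau> k) - ln (1 + x)) \<longlongrightarrow> ln (\<tau> k)) at_top" for k l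
      using pos(1)[of k] pos(2)[of l] by real_asymp
    then show ?thesis
      unfolding \<Psi>'_def by (intro tendsto_diff tendsto_sum tendsto_mult tendsto_const F_lim G_lim)
  qed
  ultimately have "(\<Psi> \<longlongrightarrow> (\<Sum>k<N. \<Sum>l<N. (z k l)\<^sup>2 * \<tau> k * ln (\<tau> k))
    - (\<Sum>k<N. \<tau> k * (\<Sum>i<N. (P k i)\<^sup>2 * xlogx_slope (c i) (c i)))) at_top"
    unfolding pull by (simp add: \<Psi>'_def[abs_def])
  then have "\<Psi> 0 \<le> (\<Sum>k<N. \<Sum>l<N. (z k l)\<^sup>2 * \<tau> k * ln (\<tau> k))
    - (\<Sum>k<N. \<tau> k * (\<Sum>i<N. (P k i)\<^sup>2 * (ln (c i) + 1)))"
    unfolding xlogx_slope_def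
    by (intro tendsto_lowerbound[of \<Psi> _ at_top]) (auto intro!: mono eventually_at_top_linorderI[of 0])
  moreover have "\<Psi> 0 = (\<Sum>k<N. \<Sum>l<N. (z k l)\<^sup>2 * \<tau> k * ln (\<beta> l))
      - (\<Sum>k<N. \<tau> k * (\<Sum>j<N. (V j k)\<^sup>2 * ln (a j)))
      - (\<Sum>l<N. \<beta> l * (\<Sum>i<N. \<Sum>j<N. \<Sum>j'<N. w i j * w i j' * (Q j l * Q j' l) * (c i * logdiv (a j) (a j'))))"
  proof -
    \<comment> \<open>At 0 the value of \<open>F j i i'\<close> is \<open>ln (a j)\<close>, free of
      \<open>i\<close> and \<open>i'\<close>, so the double sum folds into a square.\<close>
    have "(\<Sum>i<N. \<Sum>i'<N. P k i * P k i' * (w i j * w i' j) * ln (a j)) = (V j k)\<^sup>2 * ln (a j)" for j k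
      unfolding V power2_eq_square sum_product by (simp add: sum_distrib_left mult_ac)
    then show ?thesis
      unfolding \<Psi>_def \<Phi>_def F_0 G_0 by (simp add: sum_negf)
  qed
  ultimately show ?thesis
    by (simp add: P_def Q_def w_def z_def V_def sum_subtractf right_diff_distrib)
qed

end

section \<open>Matrix exponential and Lieb's inequality\<close>

context
  fixes N :: nat
begin

definition mmul :: "(nat \<Rightarrow> nat \<Rightarrow> real) \<Rightarrow> (nat \<Rightarrow> nat \<Rightarrow> real) \<Rightarrow> nat \<Rightarrow> nat \<Rightarrow> real" where
  "mmul A B i j = (\<Sum>k<N. A i k * B k j)"

primrec mpow :: "(nat \<Rightarrow> nat \<Rightarrow> real) \<Rightarrow> nat \<Rightarrow> nat \<Rightarrow> nat \<Rightarrow> real" where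
  "mpow A 0 = (\<lambda>i j. if i = j then 1 else 0)"
| "mpow A (Suc m) = mmul A (mpow A m)"

text \<open>The power series is chosen because it makes the entries visibly measurable functions of
  the entries of \<open>A\<close>. Convergence is established by \<open>mexp_sums\<close> from a
  spectral decomposition.\<close>

definition mexp :: "(nat \<Rightarrow> nat \<Rightarrow> real) \<Rightarrow> nat \<Rightarrow> nat \<Rightarrow> real" where
  "mexp A i j = (\<Sum>m. mpow A m i j / fact m)"

definition mtrace :: "(nat \<Rightarrow> nat \<Rightarrow> real) \<Rightarrow> real" where
  "mtrace A = (\<Sum>i<N. A i i)"

section \<open>Functional calculus along a fixed eigenbasis\<close>

lemma spectral_decomp_one:
  assumes "orthonormal_family N N u"
  shows "spectral_decomp N (\<lambda>i j. if i = j then 1 else 0) u (\<lambda>_. 1)"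
  using assms orthonormal_complete[OF assms] by (simp add: spectral_decomp_def)

lemma spectral_decomp_mmul:
  assumes A: "spectral_decomp N A u a" and B: "spectral_decomp N B u b"
  shows "spectral_decomp N (mmul A B) u (\<lambda>k. a k * b k)"
proof -
  have u: "orthonormal_family N N u" using A by (simp add: spectral_decomp_def)
  have "mmul A B i j = (\<Sum>k<N. a k * b k * u k i * u k j)" if ij: "i < N" "j < N" for i j
  proof -
    have "mmul A B i j = (\<Sum>p<N. (\<Sum>k<N. a k * u k i * u k p) * (\<Sum>l<N. b l * u l p * u l j))"
      using A B ij unfolding mmul_def spectral_decomp_def by (intro sum.cong) auto
    also have "\<dots> = (\<Sum>p<N. \<Sum>k<N. \<Sum>l<N. (a k * u k i * b l * u l j) * (u k p * u l p))"
      by (simp add: sum_product mult_ac)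
    also have "\<dots> = (\<Sum>k<N. \<Sum>p<N. \<Sum>l<N. (a k * u k i * b l * u l j) * (u k p * u l p))"
      by (rule sum.swap)
    also have "\<dots> = (\<Sum>k<N. \<Sum>l<N. \<Sum>p<N. (a k * u k i * b l * u l j) * (u k p * u l p))"
      by (intro sum.cong refl sum.swap)
    also have "\<dots> = (\<Sum>k<N. \<Sum>l<N. (a k * u k i * b l * u l j) * vdot N (u k) (u l))"
      by (simp add: vdot_def sum_distrib_left)
    also have "\<dots> = (\<Sum>k<N. \<Sum>l<N. if l = k then a k * u k i * b l * u l j else 0)"
      using u by (intro sum.cong refl) (auto simp: orthonormal_family_def)
    also have "\<dots> = (\<Sum>k<N. a k * b k * u k i * u k j)"
      by (simp add: mult_ac)
    finally show ?thesis .
  qed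
  then show ?thesis using u by (simp add: spectral_decomp_def)
qed

lemma spectral_decomp_mpow:
  assumes "spectral_decomp N A u a"
  shows "spectral_decomp N (mpow A m) u (\<lambda>k. a k ^ m)"
proof (induction m)
  case 0
  show ?case using spectral_decomp_one assms by (simp add: spectral_decomp_def)
next
  case (Suc m)
  show ?case using spectral_decomp_mmul[OF assms Suc.IH] by simp
qed

lemma spectral_decomp_linear:
  assumes "spectral_decomp N A u a" "spectral_decomp N B u b"
  shows "spectral_decomp N (\<lambda>i j. p * A i j + q * B i j) u (\<lambda>k. p * a k + q * b k)"
  using assms by (simp add: spectral_decomp_def sum_distrib_left sum.distrib algebra_simps)

lemma mexp_sums:
  assumes A: "spectral_decomp N A u a" and ij: "i < N" "j < N"
  shows "(\<lambda>m. mpow A m i j / fact m) sums (\<Sum>k<N. exp (a k) * u k i * u k j)"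
proof -
  have "(\<lambda>m. \<Sum>k<N. (a k ^ m /\<^sub>R fact m) * u k i * u k j) sums (\<Sum>k<N. exp (a k) * u k i * u k j)"
    by (intro sums_sum sums_mult2 exp_converges)
  moreover have "(\<Sum>k<N. (a k ^ m /\<^sub>R fact m) * u k i * u k j) = mpow A m i j / fact m" for m
    using spectral_decomp_mpow[OF A, of m] ij
    by (simp add: spectral_decomp_def sum_divide_distrib divide_inverse mult_ac sum_distrib_left)
  ultimately show ?thesis by simp
qed

lemma spectral_decomp_mexp:
  assumes "spectral_decomp N A u a"
  shows "spectral_decomp N (mexp A) u (\<lambda>k. exp (a k))"
  using mexp_sums[OF assms] assms unfolding spectral_decomp_def mexp_def by (simp add: sums_iff)

lemma mtrace_spectral:
  assumes A: "spectral_decomp N A u a"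
  shows "mtrace A = (\<Sum>k<N. a k)"
proof -
  have "mtrace A = (\<Sum>i<N. \<Sum>k<N. a k * (u k i * u k i))"
    using A by (simp add: mtrace_def spectral_decomp_def mult.assoc)
  also have "\<dots> = (\<Sum>k<N. a k * vdot N (u k) (u k))"
    by (subst sum.swap) (simp add: vdot_def sum_distrib_left)
  also have "\<dots> = (\<Sum>k<N. a k)" using A by (simp add: spectral_decomp_def orthonormal_family_def)
  finally show ?thesis .
qed

lemma quadratic_form_spectral:
  assumes A: "spectral_decomp N A u a"
  shows "vdot N (mvec N A x) y = (\<Sum>k<N. a k * (vdot N (u k) x * vdot N (u k) y))"
proof -
  have "vdot N (mvec N A x) y = (\<Sum>i<N. \<Sum>j<N. \<Sum>k<N. a k * (u k j * x j * (u k i * y i)))"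
    using A by (simp add: vdot_def mvec_def spectral_decomp_def sum_distrib_left sum_distrib_right mult_ac)
  also have "\<dots> = (\<Sum>i<N. \<Sum>k<N. \<Sum>j<N. a k * (u k j * x j * (u k i * y i)))"
    by (intro sum.cong refl sum.swap)
  also have "\<dots> = (\<Sum>k<N. \<Sum>i<N. \<Sum>j<N. a k * (u k j * x j * (u k i * y i)))"
    by (rule sum.swap)
  also have "\<dots> = (\<Sum>k<N. a k * (vdot N (u k) x * vdot N (u k) y))"
  proof (intro sum.cong refl)
    fix k
    have "a k * (vdot N (u k) x * vdot N (u k) y) = a k * (vdot N (u k) y * vdot N (u k) x)" by simp
    also have "\<dots> = (\<Sum>i<N. \<Sum>j<N. a k * (u k j * x j * (u k i * y i)))"
      unfolding vdot_def sum_product by (simp add: sum_distrib_left mult_ac)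
    finally show "(\<Sum>i<N. \<Sum>j<N. a k * (u k j * x j * (u k i * y i)))
      = a k * (vdot N (u k) x * vdot N (u k) y)" ..
  qed
  finally show ?thesis .
qed

lemma eigenvalue_eq_quadratic_form:
  assumes A: "spectral_decomp N A u a" and "k < N"
  shows "a k = vdot N (mvec N A (u k)) (u k)"
proof -
  have "(\<Sum>l<N. a l * (vdot N (u l) (u k) * vdot N (u l) (u k))) = (\<Sum>l<N. if l = k then a l else 0)"
    using assms by (intro sum.cong refl) (auto simp: spectral_decomp_def orthonormal_family_def)
  then show ?thesis using assms by (simp add: quadratic_form_spectral[OF A])
qed

text \<open>
  This is the concavity of \<open>B \<mapsto> tr (exp (H - V + log B))\<close> in tangent form: the right-hand side is the
  derivative of this map at \<open>exp V\<close> in the direction \<open>B\<close>.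
\<close>

theorem lieb_trace_inequality:
  assumes H: "symmetric_mat N H" and V: "spectral_decomp N V v \<alpha>"
    and X: "spectral_decomp N X r x" and B: "spectral_decomp N B r \<beta>"
    and \<beta>: "\<And>l. l < N \<Longrightarrow> exp (x l) \<le> \<beta> l"
    and L: "\<And>i j. i < N \<Longrightarrow> j < N \<Longrightarrow> L i j = H i j - V i j + X i j"
  shows "mtrace (mexp L) \<le> (\<Sum>j<N. \<Sum>j'<N. logdiv (exp (\<alpha> j)) (exp (\<alpha> j')) *
      (vdot N (mvec N (mexp H) (v j)) (v j') * vdot N (mvec N B (v j)) (v j')))"
proof -
  obtain u h where H': "spectral_decomp N H u h" using spectral_theorem[OF H] by blast
  have "symmetric_mat N V" "symmetric_mat N X"
    using V X by (auto simp: spectral_decomp_def symmetric_mat_def mult_ac)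
  then have "symmetric_mat N L" using H L by (simp add: symmetric_mat_def)
  then obtain s t where L': "spectral_decomp N L s t" using spectral_theorem by blast
  have on: "orthonormal_family N N s" "orthonormal_family N N r" "orthonormal_family N N u" "orthonormal_family N N v"
    using H' V X L' by (simp_all add: spectral_decomp_def)
  \<comment> \<open>\<open>entropy_minorant\<close> wants positive weights at all indices, whereas
    nothing is known about \<open>\<beta>\<close> from \<open>N\<close> on.\<close>
  define \<beta>' where "\<beta>' l = (if l < N then \<beta> l else 1)" for l
  have \<beta>_pos: "\<beta>' l > 0" for l using \<beta>[of l] exp_gt_zero[of "x l"]
    by (auto simp: \<beta>'_def intro: less_le_trans simp del: exp_gt_zero)
  define \<Lambda> where "\<Lambda> = (\<Sum>l<N. \<beta>' l * (\<Sum>i<N. \<Sum>j<N. \<Sum>j'<N.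
            vdot N (u i) (v j) * vdot N (u i) (v j') * (vdot N (v j) (r l) * vdot N (v j') (r l)) *
            (exp (h i) * logdiv (exp (\<alpha> j)) (exp (\<alpha> j')))))"
  \<comment> \<open>The identity \<open>L = H - V + X\<close> tested on the eigenvectors of
    \<open>L\<close>.\<close>
  have tk: "t k = (\<Sum>i<N. h i * (vdot N (u i) (s k))\<^sup>2) - (\<Sum>j<N. \<alpha> j * (vdot N (v j) (s k))\<^sup>2)
      + (\<Sum>l<N. x l * (vdot N (s k) (r l))\<^sup>2)" if "k < N" for k
  proof -
    have "t k = vdot N (mvec N L (s k)) (s k)" by (rule eigenvalue_eq_quadratic_form[OF L' that])
    also have "\<dots> = vdot N (\<lambda>i. mvec N H (s k) i - mvec N V (s k) i + mvec N X (s k) i) (s k)"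
      unfolding vdot_def
      by (intro sum.cong refl)
        (simp add: mvec_def L left_diff_distrib distrib_right sum.distrib sum_subtractf)
    finally show ?thesis
      by (simp add: vdot_add_left vdot_diff_left quadratic_form_spectral[OF H']
          quadratic_form_spectral[OF V] quadratic_form_spectral[OF X] power2_eq_square vdot_commute[of N "s k"])
  qed
  \<comment> \<open>The minorant for \<open>T = exp L\<close> with tangent point
    \<open>(C, A) = (exp H, exp V)\<close>. By \<open>tk\<close> the forms of \<open>H\<close> and
    \<open>V\<close> cancel against the right-hand side, and the summand \<open>+ 1\<close> leaves
    exactly the trace of \<open>exp L\<close>, bounded by \<open>\<Lambda>\<close>.\<close>
  have "(\<Sum>k<N. exp (t k) * ((\<Sum>i<N. (vdot N (u i) (s k))\<^sup>2 * (h i + 1)) - (\<Sum>j<N. (vdot N (v j) (s k))\<^sup>2 * \<alpha> j))) - \<Lambda>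
      \<le> (\<Sum>k<N. \<Sum>l<N. (vdot N (s k) (r l))\<^sup>2 * exp (t k) * (t k - ln (\<beta>' l)))"
    using entropy_minorant[OF on, of "\<lambda>k. exp (t k)" \<beta>' "\<lambda>k. exp (h k)" "\<lambda>k. exp (\<alpha> k)"] \<beta>_pos
    by (simp add: \<Lambda>_def)
  \<comment> \<open>\<open>X\<close> and \<open>B\<close> share the eigenbasis \<open>r\<close>, so
    \<open>log B\<close> dominates \<open>X\<close> by scalar monotonicity of
    \<open>ln\<close>.\<close>
  also have "\<dots> \<le> (\<Sum>k<N. \<Sum>l<N. (vdot N (s k) (r l))\<^sup>2 * exp (t k) * (t k - x l))"
  proof (intro sum_mono mult_left_mono)
    fix l assume "l \<in> {..<N}"
    then have "exp (x l) \<le> \<beta>' l" using \<beta> by (simp add: \<beta>'_def)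
    then have "x l \<le> ln (\<beta>' l)" using \<beta>_pos[of l] by (simp add: ln_ge_iff)
    then show "t k - ln (\<beta>' l) \<le> t k - x l" for k by simp
  qed auto
  also have "\<dots> = (\<Sum>k<N. exp (t k) * ((\<Sum>l<N. (vdot N (s k) (r l))\<^sup>2) * t k - (\<Sum>l<N. x l * (vdot N (s k) (r l))\<^sup>2)))"
    by (intro sum.cong refl) (simp add: sum_distrib_left sum_distrib_right sum_subtractf algebra_simps)
  also have "\<dots> = (\<Sum>k<N. exp (t k) * ((\<Sum>i<N. h i * (vdot N (u i) (s k))\<^sup>2) - (\<Sum>j<N. \<alpha> j * (vdot N (v j) (s k))\<^sup>2)))"
  proof (intro sum.cong refl)
    fix k assume "k \<in> {..<N}"
    then have k: "k < N" by simp
    have "(\<Sum>l<N. (vdot N (s k) (r l))\<^sup>2) = 1"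
      using sum_sq_coordinates[OF on(2,1) k] by (simp add: vdot_commute)
    then show "exp (t k) * ((\<Sum>l<N. (vdot N (s k) (r l))\<^sup>2) * t k - (\<Sum>l<N. x l * (vdot N (s k) (r l))\<^sup>2))
      = exp (t k) * ((\<Sum>i<N. h i * (vdot N (u i) (s k))\<^sup>2) - (\<Sum>j<N. \<alpha> j * (vdot N (v j) (s k))\<^sup>2))"
      using tk[OF k] by simp
  qed
  finally have "(\<Sum>k<N. exp (t k) * (\<Sum>i<N. (vdot N (u i) (s k))\<^sup>2)) \<le> \<Lambda>"
    by (simp add: algebra_simps sum.distrib sum_subtractf)
  then have "(\<Sum>k<N. exp (t k)) \<le> \<Lambda>"
    using sum_sq_coordinates[OF on(3,1)] by simp
  moreover have "mtrace (mexp L) = (\<Sum>k<N. exp (t k))"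
    by (rule mtrace_spectral[OF spectral_decomp_mexp[OF L']])
  moreover have "\<Lambda> = (\<Sum>j<N. \<Sum>j'<N. logdiv (exp (\<alpha> j)) (exp (\<alpha> j')) *
      (vdot N (mvec N (mexp H) (v j)) (v j') * vdot N (mvec N B (v j)) (v j')))"
  proof -
    have "\<Lambda> = (\<Sum>l<N. \<Sum>i<N. \<Sum>j<N. \<Sum>j'<N. logdiv (exp (\<alpha> j)) (exp (\<alpha> j')) *
        ((exp (h i) * (vdot N (u i) (v j) * vdot N (u i) (v j'))) *
         (\<beta> l * (vdot N (r l) (v j) * vdot N (r l) (v j')))))"
      by (simp add: \<Lambda>_def \<beta>'_def sum_distrib_left vdot_commute[of N "v _" "r _"] mult_ac)
    also have "\<dots> = (\<Sum>j<N. \<Sum>j'<N. \<Sum>i<N. \<Sum>l<N. logdiv (exp (\<alpha> j)) (exp (\<alpha> j')) *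
        ((exp (h i) * (vdot N (u i) (v j) * vdot N (u i) (v j'))) *
         (\<beta> l * (vdot N (r l) (v j) * vdot N (r l) (v j')))))"
      (is "(\<Sum>l<N. \<Sum>i<N. \<Sum>j<N. \<Sum>j'<N. ?F l i j j') = _")
    proof -
      have "(\<Sum>l<N. \<Sum>i<N. \<Sum>j<N. \<Sum>j'<N. ?F l i j j') = (\<Sum>i<N. \<Sum>l<N. \<Sum>j<N. \<Sum>j'<N. ?F l i j j')"
        by (rule sum.swap)
      also have "\<dots> = (\<Sum>i<N. \<Sum>j<N. \<Sum>l<N. \<Sum>j'<N. ?F l i j j')"
        by (intro sum.cong refl sum.swap)
      also have "\<dots> = (\<Sum>j<N. \<Sum>i<N. \<Sum>l<N. \<Sum>j'<N. ?F l i j j')"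
        by (rule sum.swap)
      also have "\<dots> = (\<Sum>j<N. \<Sum>i<N. \<Sum>j'<N. \<Sum>l<N. ?F l i j j')"
        by (intro sum.cong refl sum.swap)
      also have "\<dots> = (\<Sum>j<N. \<Sum>j'<N. \<Sum>i<N. \<Sum>l<N. ?F l i j j')"
        by (intro sum.cong refl sum.swap)
      finally show ?thesis .
    qed
    also have "\<dots> = (\<Sum>j<N. \<Sum>j'<N. logdiv (exp (\<alpha> j)) (exp (\<alpha> j')) *
      (vdot N (mvec N (mexp H) (v j)) (v j') * vdot N (mvec N B (v j)) (v j')))"
      unfolding quadratic_form_spectral[OF spectral_decomp_mexp[OF H']] quadratic_form_spectral[OF B] sum_product
      by (simp only: sum_distrib_left)
    finally show ?thesis .
  qed
  ultimately show ?thesis by simp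
qed

end

section \<open>Random matrices\<close>

context
  fixes N :: nat
begin

text \<open>For symmetric \<open>A\<close> and \<open>b \<ge> 0\<close> this says that the operator
  norm is at most \<open>b\<close>. The quadratic form is used because compressions inherit it
  directly.\<close>

definition form_bounded :: "(nat \<Rightarrow> nat \<Rightarrow> real) \<Rightarrow> real \<Rightarrow> bool" where
  "form_bounded A b \<longleftrightarrow> (\<forall>y. \<bar>vdot N (mvec N A y) y\<bar> \<le> b * vdot N y y)"

lemma vdot_mvec_add:
  "vdot N (mvec N (\<lambda>i j. A i j + B i j) x) y = vdot N (mvec N A x) y + vdot N (mvec N B x) y"
  by (simp add: mvec_def[abs_def] vdot_def distrib_right sum.distrib)

lemma vdot_mvec_scale:
  "vdot N (mvec N (\<lambda>i j. c * A i j) x) y = c * vdot N (mvec N A x) y"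
  by (simp add: mvec_def[abs_def] vdot_def sum_distrib_left sum_distrib_right mult_ac)

lemma vdot_mvec_eq:
  "vdot N (mvec N A x) y = (\<Sum>i<N. \<Sum>j<N. A i j * (x j * y i))"
  by (simp add: mvec_def vdot_def sum_distrib_right sum_distrib_left mult_ac)

lemma symmetric_mat_sum_add:
  assumes "\<And>i. i \<in> I \<Longrightarrow> symmetric_mat N (A i)" "symmetric_mat N G"
  shows "symmetric_mat N (\<lambda>j k. (\<Sum>i\<in>I. A i j k) + G j k)"
  unfolding symmetric_mat_def
proof (intro allI impI)
  fix j k assume jk: "j < N" "k < N"
  then have "(\<Sum>i\<in>I. A i j k) = (\<Sum>i\<in>I. A i k j)"
    using assms(1) by (intro sum.cong) (auto simp: symmetric_mat_def)
  then show "(\<Sum>i\<in>I. A i j k) + G j k = (\<Sum>i\<in>I. A i k j) + G k j"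
    using assms(2) jk by (simp add: symmetric_mat_def)
qed

lemma vdot_mvec_sum:
  "vdot N (mvec N (\<lambda>i j. \<Sum>k\<in>I. A k i j) x) y = (\<Sum>k\<in>I. vdot N (mvec N (A k) x) y)"
proof -
  have "vdot N (mvec N (\<lambda>i j. \<Sum>k\<in>I. A k i j) x) y = (\<Sum>i<N. \<Sum>j<N. \<Sum>k\<in>I. A k i j * (x j * y i))"
    by (simp add: vdot_mvec_eq sum_distrib_right)
  also have "\<dots> = (\<Sum>i<N. \<Sum>k\<in>I. \<Sum>j<N. A k i j * (x j * y i))"
    by (intro sum.cong refl sum.swap)
  also have "\<dots> = (\<Sum>k\<in>I. vdot N (mvec N (A k) x) y)"
    unfolding vdot_mvec_eq by (rule sum.swap)
  finally show ?thesis .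
qed

lemma form_bounded_add:
  assumes "form_bounded A a" "form_bounded B b"
  shows "form_bounded (\<lambda>i j. A i j + B i j) (a + b)"
  unfolding form_bounded_def
proof
  fix y
  have "\<bar>vdot N (mvec N A y) y\<bar> \<le> a * vdot N y y" "\<bar>vdot N (mvec N B y) y\<bar> \<le> b * vdot N y y"
    using assms by (auto simp: form_bounded_def)
  then show "\<bar>vdot N (mvec N (\<lambda>i j. A i j + B i j) y) y\<bar> \<le> (a + b) * vdot N y y"
    by (simp add: vdot_mvec_add distrib_right)
qed

lemma form_bounded_sum:
  assumes "finite I" "\<And>k. k \<in> I \<Longrightarrow> form_bounded (A k) b"
  shows "form_bounded (\<lambda>i j. \<Sum>k\<in>I. A k i j) (real (card I) * b)"
  unfolding form_bounded_def vdot_mvec_sum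
proof
  fix y
  have "\<bar>\<Sum>k\<in>I. vdot N (mvec N (A k) y) y\<bar> \<le> (\<Sum>k\<in>I. b * vdot N y y)"
    using assms(2) by (intro order.trans[OF sum_abs sum_mono]) (auto simp: form_bounded_def)
  then show "\<bar>\<Sum>k\<in>I. vdot N (mvec N (A k) y) y\<bar> \<le> real (card I) * b * vdot N y y" by simp
qed

lemma eigenvalue_bounded:
  assumes "spectral_decomp N A u a" "form_bounded A b" "k < N"
  shows "\<bar>a k\<bar> \<le> b"
  using eigenvalue_eq_quadratic_form[OF assms(1,3)] assms
  by (auto simp: form_bounded_def spectral_decomp_def orthonormal_family_def dest: spec[of _ "u k"])

lemma spectral_form_bounded:
  assumes "spectral_decomp N A u a" "\<And>k. k < N \<Longrightarrow> \<bar>a k\<bar> \<le> b"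
  shows "form_bounded A b"
  unfolding form_bounded_def
proof
  fix y
  have u: "orthonormal_family N N u" using assms by (simp add: spectral_decomp_def)
  have "\<bar>vdot N (mvec N A y) y\<bar> \<le> (\<Sum>k<N. \<bar>a k * (vdot N (u k) y * vdot N (u k) y)\<bar>)"
    unfolding quadratic_form_spectral[OF assms(1)] by (rule sum_abs)
  also have "\<dots> \<le> (\<Sum>k<N. b * (vdot N (u k) y * vdot N (u k) y))"
    using assms(2) by (intro sum_mono) (auto simp: abs_mult intro!: mult_right_mono)
  also have "\<dots> = b * vdot N y y"
    using parseval[OF u, of y y] by (simp add: sum_distrib_left vdot_commute)
  finally show "\<bar>vdot N (mvec N A y) y\<bar> \<le> b * vdot N y y" .
qed

text \<open>Unit vectors have entries of modulus at most 1. The bound is crude in \<open>N\<close>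
  and serves integrability only.\<close>

lemma spectral_entry_bounded:
  assumes A: "spectral_decomp N A u a" and a: "\<And>k. k < N \<Longrightarrow> \<bar>a k\<bar> \<le> b" and ij: "i < N" "j < N"
  shows "\<bar>A i j\<bar> \<le> real N * b"
proof -
  have u: "orthonormal_family N N u" using A by (simp add: spectral_decomp_def)
  have u1: "\<bar>u k i\<bar> \<le> 1" if "k < N" "i < N" for k i
  proof -
    have "u k i * u k i \<le> vdot N (u k) (u k)"
      unfolding vdot_def using that by (intro member_le_sum) auto
    also have "\<dots> = 1" using u that by (simp add: orthonormal_family_def)
    finally show ?thesis by (simp add: abs_square_le_1 power2_eq_square flip: power2_eq_square)
  qed
  have "\<bar>A i j\<bar> \<le> (\<Sum>k<N. \<bar>a k * u k i * u k j\<bar>)"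
    using A ij by (simp add: spectral_decomp_def)
  also have "\<dots> \<le> (\<Sum>k<N. b)"
  proof (intro sum_mono)
    fix k assume "k \<in> {..<N}"
    then have k: "k < N" by simp
    have "\<bar>a k\<bar> * \<bar>u k i\<bar> * \<bar>u k j\<bar> \<le> b * 1 * 1"
      using a[OF k] u1[OF k] ij by (intro mult_mono) auto
    then show "\<bar>a k * u k i * u k j\<bar> \<le> b" by (simp add: abs_mult)
  qed
  finally show ?thesis by simp
qed

lemma mexp_entry_bounded:
  assumes A: "symmetric_mat N A" "form_bounded A b" and ij: "i < N" "j < N"
  shows "\<bar>mexp N A i j\<bar> \<le> real N * exp b"
proof -
  obtain u a where ua: "spectral_decomp N A u a" using spectral_theorem[OF A(1)] by blast
  have "\<bar>exp (a k)\<bar> \<le> exp b" if "k < N" for k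
    using eigenvalue_bounded[OF ua A(2) that] by auto
  from spectral_entry_bounded[OF spectral_decomp_mexp[OF ua] this ij] show ?thesis .
qed

lemma trace_basis_invariant:
  assumes v: "orthonormal_family N N v"
  shows "mtrace N A = (\<Sum>j<N. vdot N (mvec N A (v j)) (v j))"
proof -
  have "(\<Sum>j<N. vdot N (mvec N A (v j)) (v j)) = (\<Sum>i<N. \<Sum>j<N. \<Sum>k<N. A i j * (v k j * v k i))"
    unfolding vdot_mvec_eq by (subst sum.swap) (intro sum.cong refl sum.swap)
  also have "\<dots> = (\<Sum>i<N. \<Sum>j<N. A i j * (if j = i then 1 else 0))"
    unfolding sum_distrib_left[symmetric] using orthonormal_complete[OF v] by simp
  finally show ?thesis by (simp add: mtrace_def if_distrib cong: if_cong)
qed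

lemma mexp_cong:
  assumes "\<And>i j. i < N \<Longrightarrow> j < N \<Longrightarrow> A i j = B i j" "i < N" "j < N"
  shows "mexp N A i j = mexp N B i j"
proof -
  have "mpow N A m i j = mpow N B m i j" if "i < N" "j < N" for m i j
    using that by (induction m arbitrary: i j) (auto simp: mmul_def assms(1))
  then show ?thesis using assms(2,3) by (simp add: mexp_def)
qed

lemma mtrace_mexp_cong:
  assumes "\<And>i j. i < N \<Longrightarrow> j < N \<Longrightarrow> A i j = B i j"
  shows "mtrace N (mexp N A) = mtrace N (mexp N B)"
  unfolding mtrace_def using mexp_cong[OF assms] by simp

lemma measurable_mexp_entry:
  assumes F: "\<And>i j. i < N \<Longrightarrow> j < N \<Longrightarrow> (\<lambda>\<omega>. F \<omega> i j) \<in> borel_measurable M" and ij: "i < N" "j < N"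
  shows "(\<lambda>\<omega>. mexp N (F \<omega>) i j) \<in> borel_measurable M"
proof -
  have "(\<lambda>\<omega>. mpow N (F \<omega>) m i j) \<in> borel_measurable M" if "i < N" "j < N" for m i j
    using that
  proof (induction m arbitrary: i j)
    case (Suc m)
    then show ?case unfolding mpow.simps mmul_def by (intro borel_measurable_sum borel_measurable_times F) auto
  qed simp
  then show ?thesis unfolding mexp_def using ij by (intro borel_measurable_suminf borel_measurable_divide) auto
qed

lemma mmul_symmetric: "symmetric_mat N A \<Longrightarrow> symmetric_mat N (mmul N A A)"
  by (auto simp: symmetric_mat_def mmul_def mult.commute intro!: sum.cong)

lemma vdot_mmul_self:
  assumes "symmetric_mat N A"
  shows "vdot N (mvec N (mmul N A A) y) y = vdot N (mvec N A y) (mvec N A y)"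
proof -
  have "mvec N (mmul N A A) y = mvec N A (mvec N A y)"
    unfolding mvec_def mmul_def sum_distrib_left sum_distrib_right
    by (rule ext, subst sum.swap) (simp add: mult_ac)
  then show ?thesis by (simp add: mvec_symmetric[OF assms])
qed

end

section \<open>Measurability, integrability and the exchange of one summand\<close>

lemma measurable_matrix_entry [measurable (raw)]:
  "F \<in> borel_measurable M \<Longrightarrow> (\<lambda>\<omega>. (F \<omega> :: nat \<Rightarrow> nat \<Rightarrow> real) i j) \<in> borel_measurable M"
  by (rule measurable_compose[OF measurable_compose[OF _ measurable_product_coordinates] measurable_product_coordinates])

context prob_space
begin

lemma integrable_mexp_entry:
  assumes F: "\<And>i j. i < N \<Longrightarrow> j < N \<Longrightarrow> (\<lambda>\<omega>. F \<omega> i j) \<in> borel_measurable M"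
    and sym: "\<And>\<omega>. \<omega> \<in> space M \<Longrightarrow> symmetric_mat N (F \<omega>)"
    and bnd: "AE \<omega> in M. form_bounded N (F \<omega>) b" and ij: "i < N" "j < N"
  shows "integrable M (\<lambda>\<omega>. mexp N (F \<omega>) i j)"
proof (rule integrable_const_bound[where B="real N * exp b"])
  show "AE \<omega> in M. norm (mexp N (F \<omega>) i j) \<le> real N * exp b"
    using bnd AE_space by eventually_elim (auto intro!: mexp_entry_bounded sym ij)
qed (intro measurable_mexp_entry F ij)

text \<open>Exchanges the last summand for the deterministic matrix \<open>\<gamma> V\<close>. The
  Lieb bound is bilinear in \<open>exp H\<close> and \<open>B\<close>; these are independent, so
  expectations can be taken in both factors, and \<open>B\<close> averages to
  \<open>1 + \<gamma> V\<close>.\<close>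

lemma bounded_spectrum_mgf_step:
  fixes W :: "nat \<Rightarrow> 'a \<Rightarrow> nat \<Rightarrow> nat \<Rightarrow> real" and m N :: nat
  defines "V \<equiv> \<lambda>i j. expectation (\<lambda>\<omega>. mmul N (W (Suc m) \<omega>) (W (Suc m) \<omega>) i j)"
  assumes indep: "indep_vars (\<lambda>_. borel) W {1..Suc m}"
    and sym: "\<And>i \<omega>. i \<in> {1..Suc m} \<Longrightarrow> \<omega> \<in> space M \<Longrightarrow> symmetric_mat N (W i \<omega>)"
    and bnd: "\<And>i. i \<in> {1..Suc m} \<Longrightarrow> AE \<omega> in M. form_bounded N (W i \<omega>) b"
    and centered: "\<And>j k. j < N \<Longrightarrow> k < N \<Longrightarrow> expectation (\<lambda>\<omega>. W (Suc m) \<omega> j k) = 0"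
    and \<gamma>: "\<And>x. \<bar>x\<bar> \<le> b \<Longrightarrow> exp x \<le> 1 + x + \<gamma> * x\<^sup>2"
    and G: "symmetric_mat N G"
  shows "expectation (\<lambda>\<omega>. mtrace N (mexp N (\<lambda>j k. (\<Sum>i=1..Suc m. W i \<omega> j k) + G j k)))
    \<le> expectation (\<lambda>\<omega>. mtrace N (mexp N (\<lambda>j k. (\<Sum>i=1..m. W i \<omega> j k) + (G j k + \<gamma> * V j k))))"
proof -
  let ?W = "W (Suc m)"
  \<comment> \<open>The term \<open>\<gamma> V\<close> is already included, so that the matrix to be
    estimated is \<open>H - \<gamma> V + W (Suc m)\<close>.\<close>
  define H where "H \<omega> = (\<lambda>j k. (\<Sum>i=1..m. W i \<omega> j k) + (G j k + \<gamma> * V j k))" for \<omega>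
  \<comment> \<open>This is \<open>1 + W + \<gamma> W\<^sup>2\<close>; the factors
    \<open>1 *\<close> give it the shape of \<open>spectral_decomp_linear\<close>.\<close>
  define B where "B \<omega> = (\<lambda>j k. 1 * (1 * (if j = k then 1 else 0) + 1 * ?W \<omega> j k) + \<gamma> * mmul N (?W \<omega>) (?W \<omega>) j k)" for \<omega>
  have W_meas [measurable]: "random_variable borel (W i)" if "i \<in> {1..Suc m}" for i
    using indep that by (simp add: indep_vars_def)
  have W_meas' [measurable]: "random_variable borel ?W" by (rule W_meas) simp
  have V_sym: "symmetric_mat N V"
    unfolding symmetric_mat_def V_def
  proof (intro allI impI Bochner_Integration.integral_cong refl)
    fix i j \<omega> assume "i < N" "j < N" "\<omega> \<in> space M"
    then show "mmul N (?W \<omega>) (?W \<omega>) i j = mmul N (?W \<omega>) (?W \<omega>) j i"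
      using mmul_symmetric[OF sym[of "Suc m" \<omega>]] by (simp add: symmetric_mat_def)
  qed
  have "symmetric_mat N (\<lambda>j k. \<gamma> * V j k)" using V_sym by (simp add: symmetric_mat_def)
  then obtain v \<alpha> where v: "spectral_decomp N (\<lambda>j k. \<gamma> * V j k) v \<alpha>" using spectral_theorem by blast
  have on: "orthonormal_family N N v" using v by (simp add: spectral_decomp_def)
  have GV_sym: "symmetric_mat N (\<lambda>j k. G j k + \<gamma> * V j k)"
    using V_sym G by (simp add: symmetric_mat_def)
  obtain g where g: "form_bounded N (\<lambda>j k. G j k + \<gamma> * V j k) g"
  proof -
    obtain u a where ua: "spectral_decomp N (\<lambda>j k. G j k + \<gamma> * V j k) u a" using spectral_theorem[OF GV_sym] by blast
    have "\<bar>a k\<bar> \<le> (\<Sum>k<N. \<bar>a k\<bar>)" if "k < N" for k using that by (intro member_le_sum) auto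
    from spectral_form_bounded[OF ua this] show ?thesis using that by blast
  qed
  have H_sym: "symmetric_mat N (H \<omega>)" if "\<omega> \<in> space M" for \<omega>
    unfolding H_def by (intro symmetric_mat_sum_add GV_sym sym that) auto
  have H_meas: "(\<lambda>\<omega>. H \<omega> j k) \<in> borel_measurable M" for j k
    unfolding H_def by (intro borel_measurable_add borel_measurable_sum measurable_matrix_entry W_meas borel_measurable_const) auto
  have all_bnd: "AE \<omega> in M. \<forall>i\<in>{1..Suc m}. form_bounded N (W i \<omega>) b"
    using bnd by (intro AE_finite_allI) auto
  have H_bnd: "AE \<omega> in M. form_bounded N (H \<omega>) (real m * b + g)"
    using all_bnd
  proof eventually_elim
    case (elim \<omega>)
    then show ?case unfolding H_def using form_bounded_sum[of "{1..m}" N "\<lambda>i. W i \<omega>" b]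
      by (intro form_bounded_add g) auto
  qed
  \<comment> \<open>Entries of \<open>exp H\<close> and \<open>B\<close> in the eigenbasis of
    \<open>\<gamma> V\<close>, the one in which the Lieb bound is a weighted sum of
    products.\<close>
  define eC where "eC j k \<omega> = vdot N (mvec N (mexp N (H \<omega>)) (v j)) (v k)" for j k \<omega>
  define eB where "eB j k \<omega> = vdot N (mvec N (B \<omega>) (v j)) (v k)" for j k \<omega>
  have int_mexp_H: "integrable M (\<lambda>\<omega>. mexp N (H \<omega>) i j)" if "i < N" "j < N" for i j
    by (rule integrable_mexp_entry[OF H_meas H_sym H_bnd that])
  have int_C: "integrable M (eC j k)" for j k
    unfolding eC_def[abs_def] vdot_mvec_eq
    by (intro Bochner_Integration.integrable_sum integrable_mult_left int_mexp_H) auto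
  have int_W: "integrable M (\<lambda>\<omega>. ?W \<omega> i j)" and int_WW: "integrable M (\<lambda>\<omega>. mmul N (?W \<omega>) (?W \<omega>) i j)"
    if ij: "i < N" "j < N" for i j
  proof -
    have "AE \<omega> in M. norm (?W \<omega> i j) \<le> real N * b \<and> norm (mmul N (?W \<omega>) (?W \<omega>) i j) \<le> real N * (b * b)"
      using bnd[of "Suc m", simplified] AE_space
    proof eventually_elim
      case (elim \<omega>)
      obtain r x where r: "spectral_decomp N (?W \<omega>) r x" 
        using spectral_theorem[OF sym[of "Suc m" \<omega>]] elim by auto
      have x: "\<bar>x k\<bar> \<le> b" if "k < N" for k by (rule eigenvalue_bounded[OF r elim(1) that])
      then have "\<bar>x k * x k\<bar> \<le> b * b" if "k < N" for k
        unfolding abs_mult using that by (intro mult_mono) (auto intro: order_trans[OF abs_ge_zero])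
      then show ?case
        using spectral_entry_bounded[OF r x ij] spectral_entry_bounded[OF spectral_decomp_mmul[OF r r] _ ij] by simp
    qed
    then show "integrable M (\<lambda>\<omega>. ?W \<omega> i j)" "integrable M (\<lambda>\<omega>. mmul N (?W \<omega>) (?W \<omega>) i j)"
      unfolding mmul_def by (intro integrable_const_bound[where B="real N * b"] integrable_const_bound[where B="real N * (b * b)"]; auto)+
  qed
  have int_Bent: "integrable M (\<lambda>\<omega>. B \<omega> i j)" if "i < N" "j < N" for i j
    unfolding B_def using int_W[OF that] int_WW[OF that] by simp
  have int_B: "integrable M (eB j k)" for j k
    unfolding eB_def[abs_def] vdot_mvec_eq
    by (intro Bochner_Integration.integrable_sum integrable_mult_left int_Bent) auto
  \<comment> \<open>Centering removes the linear term, and \<open>v\<close> diagonalises the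
    remaining \<open>1 + \<gamma> V\<close>.\<close>
  have exp_B: "expectation (eB j k) = (if j = k then 1 + \<alpha> j else 0)" if jk: "j < N" "k < N" for j k
  proof -
    have d1: "spectral_decomp N (\<lambda>i j. 1 * (if i = j then 1 else 0) + 1 * (\<gamma> * V i j)) v (\<lambda>k. 1 * 1 + 1 * \<alpha> k)"
      by (rule spectral_decomp_linear[OF spectral_decomp_one[OF on] v])
    have "expectation (\<lambda>\<omega>. B \<omega> p q) = 1 * (if p = q then 1 else 0) + 1 * (\<gamma> * V p q)" if "p < N" "q < N" for p q
      unfolding B_def V_def using int_W[OF that] int_WW[OF that] centered[OF that] by (simp add: prob_space)
    then have "expectation (eB j k) = vdot N (mvec N (\<lambda>i j. 1 * (if i = j then 1 else 0) + 1 * (\<gamma> * V i j)) (v j)) (v k)"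
      unfolding eB_def vdot_mvec_eq
      by (subst Bochner_Integration.integral_sum, (intro Bochner_Integration.integrable_sum integrable_mult_left int_Bent; simp),
          intro sum.cong refl, subst Bochner_Integration.integral_sum, (intro integrable_mult_left int_Bent; simp), simp)
    also have "\<dots> = (\<Sum>l<N. if l = j then (if l = k then 1 + \<alpha> l else 0) else 0)"
      unfolding quadratic_form_spectral[OF d1] using on jk
      by (intro sum.cong refl) (auto simp: orthonormal_family_def)
    finally show ?thesis using jk by simp
  qed
  \<comment> \<open>\<open>eC\<close> is a function of the first \<open>m\<close> matrices,
    \<open>eB\<close> of the last one.\<close>
  have indep_CB: "indep_var borel (eC j k) borel (eB j k)" for j k
  proof -
    let ?F = "\<lambda>f::nat \<Rightarrow> nat \<Rightarrow> nat \<Rightarrow> real. \<lambda>p q. (\<Sum>i=1..m. f i p q) + (G p q + \<gamma> * V p q)"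
    let ?C = "\<lambda>f. vdot N (mvec N (mexp N (?F f)) (v j)) (v k)"
    let ?B = "\<lambda>f::nat \<Rightarrow> nat \<Rightarrow> nat \<Rightarrow> real. vdot N (mvec N (\<lambda>j k. 1 * (1 * (if j = k then 1 else 0) + 1 * f (Suc m) j k) + \<gamma> * mmul N (f (Suc m)) (f (Suc m)) j k) (v j)) (v k)"
    have "?C \<in> borel_measurable (PiM {1..m} (\<lambda>_. borel))"
      unfolding vdot_mvec_eq
      by (intro borel_measurable_sum borel_measurable_times borel_measurable_const measurable_mexp_entry
          borel_measurable_add measurable_matrix_entry measurable_component_singleton) auto
    moreover have "?B \<in> borel_measurable (PiM {Suc m} (\<lambda>_. borel))"
      unfolding vdot_mvec_eq mmul_def
      by (intro borel_measurable_sum borel_measurable_times borel_measurable_const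
          borel_measurable_add measurable_matrix_entry measurable_component_singleton) auto
    moreover have "indep_var (PiM {1..m} (\<lambda>_. borel)) (\<lambda>\<omega>. restrict (\<lambda>i. W i \<omega>) {1..m})
        (PiM {Suc m} (\<lambda>_. borel)) (\<lambda>\<omega>. restrict (\<lambda>i. W i \<omega>) {Suc m})"
      by (rule indep_var_restrict[OF indep]) auto
    ultimately have "indep_var borel (?C \<circ> (\<lambda>\<omega>. restrict (\<lambda>i. W i \<omega>) {1..m})) borel (?B \<circ> (\<lambda>\<omega>. restrict (\<lambda>i. W i \<omega>) {Suc m}))"
      by (intro indep_var_compose)
    moreover have "?C \<circ> (\<lambda>\<omega>. restrict (\<lambda>i. W i \<omega>) {1..m}) = eC j k"
      by (auto simp: fun_eq_iff eC_def H_def)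
    moreover have "?B \<circ> (\<lambda>\<omega>. restrict (\<lambda>i. W i \<omega>) {Suc m}) = eB j k"
      by (auto simp: fun_eq_iff eB_def B_def)
    ultimately show ?thesis by simp
  qed
  have int_CB: "integrable M (\<lambda>\<omega>. eC j k \<omega> * eB j k \<omega>)"
    and exp_CB: "expectation (\<lambda>\<omega>. eC j k \<omega> * eB j k \<omega>) = expectation (eC j k) * expectation (eB j k)" for j k
    by (rule indep_var_integrable[OF indep_CB int_C int_B] indep_var_lebesgue_integral[OF indep_CB int_C int_B])+
  have C_nonneg: "0 \<le> eC j j \<omega>" if \<omega>: "\<omega> \<in> space M" for j \<omega>
  proof -
    obtain u h where "spectral_decomp N (H \<omega>) u h" using spectral_theorem[OF H_sym[OF \<omega>]] by blast
    from quadratic_form_spectral[OF spectral_decomp_mexp[OF this]] show ?thesis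
      unfolding eC_def by (simp add: sum_nonneg)
  qed
  let ?R = "\<lambda>\<omega>. \<Sum>j<N. \<Sum>k<N. logdiv (exp (\<alpha> j)) (exp (\<alpha> k)) * (eC j k \<omega> * eB j k \<omega>)"
  have int_R: "integrable M ?R"
    by (intro Bochner_Integration.integrable_sum integrable_mult_right int_CB)
  have lieb: "AE \<omega> in M. mtrace N (mexp N (\<lambda>j k. (\<Sum>i=1..Suc m. W i \<omega> j k) + G j k)) \<le> ?R \<omega>"
    using bnd[of "Suc m", simplified] AE_space
  proof eventually_elim
    case (elim \<omega>)
    obtain r x where r: "spectral_decomp N (?W \<omega>) r x" 
        using spectral_theorem[OF sym[of "Suc m" \<omega>]] elim by auto
    have on_r: "orthonormal_family N N r" using r by (simp add: spectral_decomp_def)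
    have "spectral_decomp N (B \<omega>) r (\<lambda>k. 1 * (1 * 1 + 1 * x k) + \<gamma> * (x k * x k))"
      unfolding B_def
      by (intro spectral_decomp_linear spectral_decomp_one on_r r spectral_decomp_mmul)
    then show ?case
      unfolding eC_def eB_def
      using \<gamma>[OF eigenvalue_bounded[OF r elim(1)]]
      by (intro lieb_trace_inequality[OF H_sym v r]) (auto simp: H_def power2_eq_square elim)
  qed
  \<comment> \<open>The Bochner integral of a nonintegrable function is 0; in that case
    nonnegativity of \<open>?R\<close> settles the inequality.\<close>
  have "expectation (\<lambda>\<omega>. mtrace N (mexp N (\<lambda>j k. (\<Sum>i=1..Suc m. W i \<omega> j k) + G j k))) \<le> expectation ?R"
  proof (cases "integrable M (\<lambda>\<omega>. mtrace N (mexp N (\<lambda>j k. (\<Sum>i=1..Suc m. W i \<omega> j k) + G j k)))")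
    case True
    then show ?thesis by (intro integral_mono_AE int_R lieb)
  next
    case False
    have "AE \<omega> in M. 0 \<le> ?R \<omega>"
      using lieb AE_space
    proof eventually_elim
      case (elim \<omega>)
      have "symmetric_mat N (\<lambda>j k. (\<Sum>i=1..Suc m. W i \<omega> j k) + G j k)"
        by (intro symmetric_mat_sum_add G sym elim(2))
      then obtain s t where "spectral_decomp N (\<lambda>j k. (\<Sum>i=1..Suc m. W i \<omega> j k) + G j k) s t"
        using spectral_theorem by blast
      from mtrace_spectral[OF spectral_decomp_mexp[OF this]] elim(1) show ?case
        by (smt (verit) exp_ge_zero sum_nonneg)
    qed
    then show ?thesis using False by (simp add: not_integrable_integral_eq integral_nonneg_AE)
  qed
  also have "expectation ?R = (\<Sum>j<N. \<Sum>k<N. logdiv (exp (\<alpha> j)) (exp (\<alpha> k)) * (expectation (eC j k) * expectation (eB j k)))"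
    by (subst Bochner_Integration.integral_sum, (intro Bochner_Integration.integrable_sum integrable_mult_right int_CB),
        intro sum.cong refl, subst Bochner_Integration.integral_sum, (intro integrable_mult_right int_CB), simp add: exp_CB)
  \<comment> \<open>Off the diagonal the expectation of \<open>eB\<close> vanishes; on it
    \<open>logdiv\<close> is the derivative of \<open>ln\<close> at
    \<open>exp (\<alpha> j)\<close>.\<close>
  also have "\<dots> = (\<Sum>j<N. \<Sum>k<N. if k = j then exp (- \<alpha> j) * (1 + \<alpha> j) * expectation (eC j j) else 0)"
    by (intro sum.cong refl) (auto simp: exp_B logdiv_def exp_minus field_simps)
  also have "\<dots> = (\<Sum>j<N. exp (- \<alpha> j) * (1 + \<alpha> j) * expectation (eC j j))" by simp
  also have "\<dots> \<le> (\<Sum>j<N. 1 * expectation (eC j j))"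
  proof (intro sum_mono mult_right_mono)
    fix j
    have "exp (- \<alpha> j) * (1 + \<alpha> j) \<le> exp (- \<alpha> j) * exp (\<alpha> j)"
      using exp_ge_add_one_self by (intro mult_left_mono) auto
    then show "exp (- \<alpha> j) * (1 + \<alpha> j) \<le> 1" by (simp flip: exp_add)
    show "0 \<le> expectation (eC j j)" using C_nonneg by (intro integral_nonneg_AE) auto
  qed
  also have "\<dots> = expectation (\<lambda>\<omega>. \<Sum>j<N. eC j j \<omega>)"
    using int_C by (subst Bochner_Integration.integral_sum) auto
  also have "\<dots> = expectation (\<lambda>\<omega>. mtrace N (mexp N (H \<omega>)))"
    by (simp add: eC_def trace_basis_invariant[OF on])
  finally show ?thesis by (simp add: H_def)
qed

end

text \<open>From the quadratic term on, the exponential series is dominated by a geometric series of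
  ratio \<open>b / 3\<close>, because \<open>fact (n + 2) \<ge> 2 * 3 ^ n\<close>. This is the
  origin of the 3 in \<open>t * U / 3\<close>.\<close>

lemma exp_bernstein_bound:
  fixes x b :: real
  assumes x: "\<bar>x\<bar> \<le> b" and b: "b < 3"
  shows "exp x \<le> 1 + x + 1 / (2 * (1 - b / 3)) * x\<^sup>2"
proof -
  have fact_ge: "2 * 3 ^ n \<le> (fact (n + 2) :: real)" for n
  proof (induction n)
    case (Suc n)
    have "2 * 3 ^ Suc n = 3 * (2 * 3 ^ n :: real)" by simp
    also have "\<dots> \<le> (real n + 3) * fact (n + 2)"
      using Suc.IH by (intro mult_mono) auto
    finally show ?case by (simp add: algebra_simps)
  qed (simp add: fact_numeral)
  have s: "(\<lambda>n. x ^ n /\<^sub>R fact n) sums exp x" by (rule exp_converges)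
  have "(\<lambda>n. x ^ (n + 2) /\<^sub>R fact (n + 2)) sums (exp x - (1 + x))"
    using sums_split_initial_segment[OF s, of 2] by (simp add: numeral_2_eq_2)
  moreover have "(\<lambda>n. x\<^sup>2 / 2 * (b / 3) ^ n) sums (x\<^sup>2 / 2 * (1 / (1 - b / 3)))"
    using x b by (intro sums_mult geometric_sums) auto
  moreover have "x ^ (n + 2) /\<^sub>R fact (n + 2) \<le> x\<^sup>2 / 2 * (b / 3) ^ n" for n
  proof -
    have "x ^ (n + 2) /\<^sub>R fact (n + 2) \<le> \<bar>x ^ (n + 2)\<bar> / fact (n + 2)"
      by (simp add: divide_inverse mult.commute mult_right_mono)
    also have "\<dots> = x\<^sup>2 * (\<bar>x\<bar> ^ n / fact (n + 2))"
      by (simp add: power_add abs_mult power_abs power2_eq_square)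
    also have "\<dots> \<le> x\<^sup>2 * (b ^ n / (2 * 3 ^ n))"
      using fact_ge[of n] x by (intro mult_left_mono frac_le power_mono) auto
    finally show ?thesis by (simp add: power_divide)
  qed
  ultimately have "exp x - (1 + x) \<le> x\<^sup>2 / 2 * (1 / (1 - b / 3))" by (rule sums_le[rotated])
  then show ?thesis by simp
qed

section \<open>Traces of \<open>exp\<close> and of \<open>2 cosh - 2\<close>\<close>

context
  fixes N :: nat
begin

text \<open>On \<open>[0, \<gamma> v]\<close> the convex function \<open>exp\<close> lies below its
  chord. As \<open>exp - 1\<close> vanishes at 0, the chord is proportional to the eigenvalue, and
  the dimension is replaced by trace over norm.\<close>

lemma mtrace_mexp_le:
  assumes A: "symmetric_mat N A" and \<gamma>: "\<gamma> \<ge> 0" and v: "v > 0"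
    and quad: "\<And>y. 0 \<le> vdot N (mvec N A y) y" "form_bounded N A v"
  shows "mtrace N (mexp N (\<lambda>i j. \<gamma> * A i j)) - real N \<le> mtrace N A * ((exp (\<gamma> * v) - 1) / v)"
proof -
  obtain u a where u: "spectral_decomp N A u a" using spectral_theorem[OF A] by blast
  have "spectral_decomp N (\<lambda>i j. \<gamma> * A i j) u (\<lambda>k. \<gamma> * a k)"
    using u by (simp add: spectral_decomp_def sum_distrib_left mult_ac)
  from mtrace_spectral[OF spectral_decomp_mexp[OF this]]
  have "mtrace N (mexp N (\<lambda>i j. \<gamma> * A i j)) - real N = (\<Sum>k<N. exp (\<gamma> * a k) - 1)"
    by (simp add: sum_subtractf)
  also have "\<dots> \<le> (\<Sum>k<N. a k * ((exp (\<gamma> * v) - 1) / v))"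
  proof (rule sum_mono)
    fix k assume "k \<in> {..<N}"
    then have k: "k < N" by simp
    have a: "0 \<le> a k" "a k \<le> v"
      using eigenvalue_eq_quadratic_form[OF u k] quad(1) eigenvalue_bounded[OF u quad(2) k] by auto
    have "convex_on UNIV (exp :: real \<Rightarrow> real)"
      by (rule exp_convex)
    from convex_onD[OF this, of "a k / v" 0 "\<gamma> * v"]
    have "exp (a k / v * (\<gamma> * v)) \<le> (1 - a k / v) + a k / v * exp (\<gamma> * v)"
      using a v by simp
    moreover have "a k / v * (\<gamma> * v) = \<gamma> * a k" using v by simp
    moreover have "a k * ((exp (\<gamma> * v) - 1) / v) = a k / v * exp (\<gamma> * v) - a k / v"
      by (simp add: diff_divide_distrib right_diff_distrib)
    ultimately show "exp (\<gamma> * a k) - 1 \<le> a k * ((exp (\<gamma> * v) - 1) / v)" by simp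
  qed
  also have "\<dots> = mtrace N A * ((exp (\<gamma> * v) - 1) / v)"
    by (simp only: mtrace_spectral[OF u] sum_distrib_right)
  finally show ?thesis .
qed

lemma mtrace_cosh:
  assumes "spectral_decomp N A u a"
  shows "mtrace N (mexp N A) + mtrace N (mexp N (\<lambda>i j. - A i j)) - 2 * real N
    = (\<Sum>k<N. 2 * cosh (a k) - 2)"
proof -
  have "spectral_decomp N (\<lambda>i j. - A i j) u (\<lambda>k. - a k)"
    using assms by (simp add: spectral_decomp_def sum_negf)
  from mtrace_spectral[OF spectral_decomp_mexp[OF this]] mtrace_spectral[OF spectral_decomp_mexp[OF assms]]
  show ?thesis by (simp add: cosh_def sum_subtractf add_divide_distrib sum.distrib)
qed

text \<open>Failure of the bound gives one eigenvalue of modulus above \<open>s\<close>. Its term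
  alone is large enough, and the other terms are nonnegative.\<close>

lemma mtrace_cosh_ge:
  assumes A: "symmetric_mat N A" and s: "s \<ge> 0" "\<not> form_bounded N A s"
  shows "2 * cosh s - 2 \<le> mtrace N (mexp N A) + mtrace N (mexp N (\<lambda>i j. - A i j)) - 2 * real N"
proof -
  obtain u a where u: "spectral_decomp N A u a" using spectral_theorem[OF A] by blast
  obtain k where k: "k < N" "\<bar>a k\<bar> > s"
    using spectral_form_bounded[OF u, of s] s(2) by force
  have "cosh s \<le> cosh \<bar>a k\<bar>" using k(2) s(1) by (subst cosh_real_nonneg_le_iff) auto
  then have "2 * cosh s - 2 \<le> 2 * cosh (a k) - 2" by (simp add: abs_real_def split: if_splits)
  also have "\<dots> \<le> (\<Sum>k<N. 2 * cosh (a k) - 2)"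
    using k(1) cosh_real_ge_1 by (intro member_le_sum) auto
  finally show ?thesis by (simp add: mtrace_cosh[OF u])
qed

lemma mtrace_cosh_nonneg:
  assumes "symmetric_mat N A"
  shows "0 \<le> mtrace N (mexp N A) + mtrace N (mexp N (\<lambda>i j. - A i j)) - 2 * real N"
proof -
  obtain u a where "spectral_decomp N A u a" using spectral_theorem[OF assms] by blast
  from mtrace_cosh[OF this] show ?thesis using cosh_real_ge_1 by (simp add: sum_nonneg)
qed

end

section \<open>Exponential moments and tails of sums of random matrices\<close>

context prob_space
begin

definition matrix_variance :: "nat \<Rightarrow> ('a \<Rightarrow> nat \<Rightarrow> nat \<Rightarrow> real) \<Rightarrow> nat \<Rightarrow> nat \<Rightarrow> real" where
  "matrix_variance N W i j = expectation (\<lambda>\<omega>. mmul N (W \<omega>) (W \<omega>) i j)"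

lemma matrix_variance_symmetric:
  assumes "\<And>\<omega>. \<omega> \<in> space M \<Longrightarrow> symmetric_mat N (W \<omega>)"
  shows "symmetric_mat N (matrix_variance N W)"
  unfolding symmetric_mat_def matrix_variance_def
proof (intro allI impI Bochner_Integration.integral_cong refl)
  fix i j \<omega> assume "i < N" "j < N" "\<omega> \<in> space M"
  then show "mmul N (W \<omega>) (W \<omega>) i j = mmul N (W \<omega>) (W \<omega>) j i"
    using mmul_symmetric[OF assms] by (simp add: symmetric_mat_def)
qed

text \<open>Summands are removed from the last to the first. The arbitrary \<open>G\<close> absorbs
  the variances collected so far, which is what the induction needs.\<close>

theorem trace_mgf_bound:
  fixes W :: "nat \<Rightarrow> 'a \<Rightarrow> nat \<Rightarrow> nat \<Rightarrow> real"
  assumes indep: "indep_vars (\<lambda>_. borel) W {1..n}"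
    and sym: "\<And>i \<omega>. i \<in> {1..n} \<Longrightarrow> \<omega> \<in> space M \<Longrightarrow> symmetric_mat N (W i \<omega>)"
    and bnd: "\<And>i. i \<in> {1..n} \<Longrightarrow> AE \<omega> in M. form_bounded N (W i \<omega>) b"
    and centered: "\<And>i j k. i \<in> {1..n} \<Longrightarrow> j < N \<Longrightarrow> k < N \<Longrightarrow> expectation (\<lambda>\<omega>. W i \<omega> j k) = 0"
    and \<gamma>: "\<And>x. \<bar>x\<bar> \<le> b \<Longrightarrow> exp x \<le> 1 + x + \<gamma> * x\<^sup>2"
    and G: "symmetric_mat N G"
  shows "expectation (\<lambda>\<omega>. mtrace N (mexp N (\<lambda>j k. (\<Sum>i=1..n. W i \<omega> j k) + G j k)))
    \<le> mtrace N (mexp N (\<lambda>j k. \<gamma> * (\<Sum>i=1..n. matrix_variance N (W i) j k) + G j k))"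
  using indep sym bnd centered G
proof (induction n arbitrary: G)
  case 0
  then show ?case by (simp add: prob_space)
next
  case (Suc m)
  let ?V = "matrix_variance N (W (Suc m))"
  have "symmetric_mat N ?V" by (intro matrix_variance_symmetric Suc.prems) auto
  then have G': "symmetric_mat N (\<lambda>j k. G j k + \<gamma> * ?V j k)"
    using Suc.prems(5) by (simp add: symmetric_mat_def)
  have "expectation (\<lambda>\<omega>. mtrace N (mexp N (\<lambda>j k. (\<Sum>i=1..Suc m. W i \<omega> j k) + G j k)))
    \<le> expectation (\<lambda>\<omega>. mtrace N (mexp N (\<lambda>j k. (\<Sum>i=1..m. W i \<omega> j k) + (G j k + \<gamma> * ?V j k))))"
    unfolding matrix_variance_def
    by (intro bounded_spectrum_mgf_step[where b=b] Suc.prems \<gamma>) auto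
  also have "\<dots> \<le> mtrace N (mexp N (\<lambda>j k. \<gamma> * (\<Sum>i=1..m. matrix_variance N (W i) j k) + (G j k + \<gamma> * ?V j k)))"
    by (intro Suc.IH Suc.prems G' indep_vars_subset[OF Suc.prems(1)]) auto
  also have "\<dots> = mtrace N (mexp N (\<lambda>j k. \<gamma> * (\<Sum>i=1..Suc m. matrix_variance N (W i) j k) + G j k))"
    by (intro mtrace_mexp_cong) (simp add: algebra_simps)
  finally show ?case .
qed

text \<open>Markov's inequality for the nonnegative \<open>Z\<close>. The moment bound is used for
  the \<open>W i\<close> and for their negatives, which have the same variances; hence the factor
  2.\<close>

theorem trace_cosh_tail:
  fixes W :: "nat \<Rightarrow> 'a \<Rightarrow> nat \<Rightarrow> nat \<Rightarrow> real" and n N :: nat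
  defines "S \<equiv> \<lambda>\<omega> j k. \<Sum>i=1..n. W i \<omega> j k"
  defines "Z \<equiv> \<lambda>\<omega>. mtrace N (mexp N (S \<omega>)) + mtrace N (mexp N (\<lambda>j k. - S \<omega> j k)) - 2 * real N"
  assumes indep: "indep_vars (\<lambda>_. borel) W {1..n}"
    and sym: "\<And>i \<omega>. i \<in> {1..n} \<Longrightarrow> \<omega> \<in> space M \<Longrightarrow> symmetric_mat N (W i \<omega>)"
    and bnd: "\<And>i. i \<in> {1..n} \<Longrightarrow> AE \<omega> in M. form_bounded N (W i \<omega>) b"
    and centered: "\<And>i j k. i \<in> {1..n} \<Longrightarrow> j < N \<Longrightarrow> k < N \<Longrightarrow> expectation (\<lambda>\<omega>. W i \<omega> j k) = 0"
    and \<gamma>: "\<And>x. \<bar>x\<bar> \<le> b \<Longrightarrow> exp x \<le> 1 + x + \<gamma> * x\<^sup>2" "\<gamma> \<ge> 0"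
    and v: "v > 0"
    and quad: "\<And>y. 0 \<le> vdot N (mvec N (\<lambda>j k. \<Sum>i=1..n. matrix_variance N (W i) j k) y) y"
      "form_bounded N (\<lambda>j k. \<Sum>i=1..n. matrix_variance N (W i) j k) v"
    and s: "s > 0"
  shows "Z \<in> borel_measurable M"
    and "prob {\<omega> \<in> space M. 2 * cosh s - 2 \<le> Z \<omega>}
      \<le> 2 * (mtrace N (\<lambda>j k. \<Sum>i=1..n. matrix_variance N (W i) j k) * ((exp (\<gamma> * v) - 1) / v)) / (2 * cosh s - 2)"
proof -
  let ?V = "\<lambda>j k. \<Sum>i=1..n. matrix_variance N (W i) j k"
  let ?W' = "\<lambda>i \<omega> j k. - W i \<omega> j k"
  have zero: "symmetric_mat N (\<lambda>_ _. 0)" by (simp add: symmetric_mat_def)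
  have V_sym: "symmetric_mat N ?V"
    using symmetric_mat_sum_add[of "{1..n}" N "\<lambda>i. matrix_variance N (W i)", OF _ zero]
      matrix_variance_symmetric[OF sym] by simp
  have W_meas: "random_variable borel (W i)" if "i \<in> {1..n}" for i
    using indep that by (simp add: indep_vars_def)
  have S_meas: "(\<lambda>\<omega>. S \<omega> j k) \<in> borel_measurable M" for j k
    unfolding S_def by (intro borel_measurable_sum measurable_matrix_entry W_meas)
  have S_sym: "symmetric_mat N (S \<omega>)" if "\<omega> \<in> space M" for \<omega>
    unfolding S_def using symmetric_mat_sum_add[of "{1..n}" N "\<lambda>i. W i \<omega>", OF sym zero] that by simp
  have S_bnd: "AE \<omega> in M. form_bounded N (S \<omega>) (real n * b)"
  proof -
    have "AE \<omega> in M. \<forall>i\<in>{1..n}. form_bounded N (W i \<omega>) b" using bnd by (intro AE_finite_allI) auto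
    then show ?thesis
    proof eventually_elim
      case (elim \<omega>)
      then show ?case unfolding S_def using form_bounded_sum[of "{1..n}" N "\<lambda>i. W i \<omega>" b] by simp
    qed
  qed
  have neg_sym: "symmetric_mat N (\<lambda>j k. - A j k)" if "symmetric_mat N A" for A
    using that by (simp add: symmetric_mat_def)
  have neg_bnd: "form_bounded N (\<lambda>j k. - A j k) c" if "form_bounded N A c" for A c
    using that vdot_mvec_scale[of N "-1" A] by (simp add: form_bounded_def)
  show Z_meas: "Z \<in> borel_measurable M"
    unfolding Z_def mtrace_def
    using S_meas borel_measurable_uminus[OF S_meas]
    by (intro borel_measurable_add borel_measurable_diff borel_measurable_sum measurable_mexp_entry
        borel_measurable_const) simp_all
  have int1: "integrable M (\<lambda>\<omega>. mtrace N (mexp N (S \<omega>)))"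
    unfolding mtrace_def
    by (intro Bochner_Integration.integrable_sum integrable_mexp_entry[OF S_meas S_sym S_bnd]) auto
  have int2: "integrable M (\<lambda>\<omega>. mtrace N (mexp N (\<lambda>j k. - S \<omega> j k)))"
    unfolding mtrace_def
  proof (intro Bochner_Integration.integrable_sum integrable_mexp_entry[where b="real n * b"])
    show "AE \<omega> in M. form_bounded N (\<lambda>j k. - S \<omega> j k) (real n * b)"
      using S_bnd by eventually_elim (rule neg_bnd)
  qed (use borel_measurable_uminus[OF S_meas] neg_sym[OF S_sym] in simp_all)
  have E1: "expectation (\<lambda>\<omega>. mtrace N (mexp N (S \<omega>))) \<le> mtrace N (mexp N (\<lambda>j k. \<gamma> * ?V j k))"
    using trace_mgf_bound[OF indep sym bnd centered \<gamma>(1) zero] by (simp add: S_def)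
  have indep': "indep_vars (\<lambda>_. borel) ?W' {1..n}"
  proof -
    have "(\<lambda>A. (A :: nat \<Rightarrow> nat \<Rightarrow> real) j k) \<in> borel_measurable borel" for j k
      by (rule measurable_matrix_entry[of "\<lambda>A. A"]) simp
    from borel_measurable_uminus[OF this]
    have "(\<lambda>A::nat \<Rightarrow> nat \<Rightarrow> real. \<lambda>j k. - A j k) \<in> borel_measurable borel"
      by (rule measurable_coordinatewise_then_product[OF measurable_coordinatewise_then_product])
    then show ?thesis using indep_vars_compose2[OF indep, of "\<lambda>_ A j k. - A j k" "\<lambda>_. borel"] by simp
  qed
  have var': "matrix_variance N (?W' i) = matrix_variance N (W i)" for i
    by (simp add: matrix_variance_def[abs_def] mmul_def)
  have "expectation (\<lambda>\<omega>. mtrace N (mexp N (\<lambda>j k. (\<Sum>i=1..n. ?W' i \<omega> j k) + 0)))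
    \<le> mtrace N (mexp N (\<lambda>j k. \<gamma> * (\<Sum>i=1..n. matrix_variance N (?W' i) j k) + 0))"
  proof (intro trace_mgf_bound[where b=b] indep' neg_sym sym \<gamma>(1) zero)
    fix i assume "i \<in> {1..n}"
    from bnd[OF this] show "AE \<omega> in M. form_bounded N (?W' i \<omega>) b"
      by eventually_elim (rule neg_bnd)
  qed (simp_all add: centered)
  then have E2: "expectation (\<lambda>\<omega>. mtrace N (mexp N (\<lambda>j k. - S \<omega> j k))) \<le> mtrace N (mexp N (\<lambda>j k. \<gamma> * ?V j k))"
    by (simp add: S_def var' sum_negf)
  have int_Z: "integrable M Z" unfolding Z_def using int1 int2 by simp
  have "expectation Z \<le> 2 * (mtrace N (mexp N (\<lambda>j k. \<gamma> * ?V j k)) - real N)"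
    unfolding Z_def using int1 int2 E1 E2 by (simp add: prob_space)
  also have "\<dots> \<le> 2 * (mtrace N ?V * ((exp (\<gamma> * v) - 1) / v))"
    using mtrace_mexp_le[OF V_sym \<gamma>(2) v quad] by simp
  finally have EZ: "expectation Z \<le> 2 * (mtrace N ?V * ((exp (\<gamma> * v) - 1) / v))" .
  have c: "2 * cosh s - 2 > 0"
    using s cosh_real_nonneg_less_iff[of 0 s] by simp
  have "prob {\<omega> \<in> space M. 2 * cosh s - 2 \<le> Z \<omega>} \<le> expectation Z / (2 * cosh s - 2)"
    using c int_Z mtrace_cosh_nonneg[OF S_sym]
    by (intro integral_Markov_inequality_measure[where A="space M"]) (auto simp: Z_def)
  also have "\<dots> \<le> 2 * (mtrace N ?V * ((exp (\<gamma> * v) - 1) / v)) / (2 * cosh s - 2)"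
    using EZ c by (intro divide_right_mono) auto
  finally show "prob {\<omega> \<in> space M. 2 * cosh s - 2 \<le> Z \<omega>}
      \<le> 2 * (mtrace N ?V * ((exp (\<gamma> * v) - 1) / v)) / (2 * cosh s - 2)" .
qed

end

section \<open>Compression of operators\<close>

context hilbert_space_over
begin

definition rip :: "'h \<Rightarrow> 'h \<Rightarrow> real" where
  "rip x y = Re (ip x y)"

lemma rip_commute: "rip x y = rip y x"
  unfolding rip_def by (subst ip_commute) simp

lemma rip_add_left: "rip (x + y) z = rip x z + rip y z"
  by (simp add: rip_def ip_add_left)

lemma ip_scaleR_left: "ip (r *\<^sub>R x) y = complex_of_real r * ip x y"
proof -
  have "complex_of_real r \<in> K" using scalar_field by auto
  then show ?thesis using ip_smul_left[of "complex_of_real r" x y] by (simp add: smul_of_real)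
qed

lemma rip_scaleR_left: "rip (r *\<^sub>R x) y = r * rip x y"
  by (simp add: rip_def ip_scaleR_left)

lemma rip_add_right: "rip z (x + y) = rip z x + rip z y"
  by (simp add: rip_commute[of z] rip_add_left)

lemma rip_scaleR_right: "rip y (r *\<^sub>R x) = r * rip y x"
  by (simp add: rip_commute[of y] rip_scaleR_left)

lemma rip_self: "rip x x = (norm x)\<^sup>2"
  by (simp add: rip_def ip_self flip: of_real_power)

lemma rip_diff_left: "rip (x - y) z = rip x z - rip y z"
  using rip_add_left[of x "(-1) *\<^sub>R y" z] rip_scaleR_left[of "-1" y z] by simp

lemma rip_diff_right: "rip z (x - y) = rip z x - rip z y"
  by (simp add: rip_commute[of z] rip_diff_left)

lemma rip_cauchy_schwarz: "\<bar>rip x y\<bar> \<le> norm x * norm y"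
proof (cases "y = 0")
  case True
  then show ?thesis using rip_scaleR_right[of x 0 y] by simp
next
  case False
  let ?z = "(norm y)\<^sup>2 *\<^sub>R x - rip x y *\<^sub>R y"
  have "0 \<le> rip ?z ?z" by (simp add: rip_self)
  also have "rip ?z ?z = (norm y)\<^sup>2 * ((norm x)\<^sup>2 * (norm y)\<^sup>2 - (rip x y)\<^sup>2)"
    by (simp add: rip_diff_left rip_diff_right rip_scaleR_left rip_scaleR_right rip_commute[of y x]
        rip_self[of x] rip_self[of y] algebra_simps power2_eq_square)
  finally have "(rip x y)\<^sup>2 \<le> (norm x * norm y)\<^sup>2"
    using False by (simp add: zero_le_mult_iff power_mult_distrib)
  then show ?thesis by (metis abs_ge_zero abs_le_square_iff abs_of_nonneg mult_nonneg_nonneg norm_ge_zero)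
qed

lemma bounded_linear_rip_left: "bounded_linear (\<lambda>x. rip x y)"
  by (rule bounded_linear_intro[of _ "norm y"])
     (auto simp: rip_add_left rip_scaleR_left rip_cauchy_schwarz)

lemma rip_sum_left: "rip (\<Sum>i\<in>I. f i) y = (\<Sum>i\<in>I. rip (f i) y)"
  using linear_sum[OF bounded_linear.linear[OF bounded_linear_rip_left]] by simp

lemma rip_sum_right: "rip y (\<Sum>i\<in>I. f i) = (\<Sum>i\<in>I. rip y (f i))"
  by (simp add: rip_commute[of y] rip_sum_left)

lemma norm_smul_ii: "K = UNIV \<Longrightarrow> norm (smul \<i> x) = norm x"
proof -
  assume K: "K = UNIV"
  have "ip (smul \<i> x) (smul \<i> x) = ip x x"
    using ip_smul_left[of \<i> x "smul \<i> x"] ip_commute[of x "smul \<i> x"] ip_smul_left[of \<i> x x] K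
    by (simp add: ip_self flip: of_real_power)
  then have "(norm (smul \<i> x))\<^sup>2 = (norm x)\<^sup>2"
    unfolding ip_self of_real_eq_iff .
  then show ?thesis by simp
qed

text \<open>Recovers the complex inner product from its real part, so that bounds for
  \<open>rip\<close> carry over to \<open>ip\<close>.\<close>

lemma Im_ip: "Im (ip x y) = (if K = UNIV then - rip (smul \<i> x) y else 0)"
  using scalar_field ip_in_K[of x y] ip_smul_left[of \<i> x y]
  by (auto simp: rip_def complex_is_Real_iff)

lemma bounded_linear_ip_left: "bounded_linear (\<lambda>x. ip x y)"
proof (rule bounded_linear_intro[of _ "2 * norm y"])
  fix x
  have "\<bar>Re (ip x y)\<bar> \<le> norm x * norm y" using rip_cauchy_schwarz[of x y] by (simp add: rip_def)
  moreover have "\<bar>Im (ip x y)\<bar> \<le> norm x * norm y"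
    using rip_cauchy_schwarz[of "smul \<i> x" y] norm_smul_ii[of x] by (auto simp: Im_ip)
  ultimately show "norm (ip x y) \<le> norm x * (2 * norm y)"
    using cmod_le[of "ip x y"] by simp
qed (simp_all add: ip_add_left ip_scaleR_left scaleR_conv_of_real)

text \<open>With \<open>u\<close> and \<open>w\<close> the directions of \<open>x\<close> and
  \<open>S x\<close>, polarisation expresses the form at \<open>(u, w)\<close> by its values at
  \<open>u + w\<close> and \<open>u - w\<close>, and the parallelogram law adds up their
  bounds.\<close>

lemma self_adjoint_norm_le:
  assumes S: "self_adjoint ip S" and t: "t \<ge> 0"
    and le: "\<And>x. \<bar>rip (blinfun_apply S x) x\<bar> \<le> t * (norm x)\<^sup>2"
  shows "norm S \<le> t"
proof (rule norm_blinfun_bound[OF t])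
  fix x
  show "norm (blinfun_apply S x) \<le> t * norm x"
  proof (cases "blinfun_apply S x = 0")
    case True
    then show ?thesis using t by simp
  next
    case False
    then have x0: "x \<noteq> 0" by (auto simp: blinfun.zero_right)
    define u where "u = (1 / norm x) *\<^sub>R x"
    define w where "w = (1 / norm (blinfun_apply S x)) *\<^sub>R blinfun_apply S x"
    have uw: "norm u = 1" "norm w = 1" using False x0 by (simp_all add: u_def w_def)
    have sym: "rip (blinfun_apply S w) u = rip (blinfun_apply S u) w"
      using S rip_commute[of "blinfun_apply S u" w] by (simp add: self_adjoint_def rip_def)
    have "4 * rip (blinfun_apply S u) w
        = rip (blinfun_apply S (u + w)) (u + w) - rip (blinfun_apply S (u - w)) (u - w)"
      by (simp add: blinfun.add_right blinfun.diff_right rip_add_left rip_add_right rip_diff_left rip_diff_right sym)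
    also have "\<dots> \<le> t * (norm (u + w))\<^sup>2 + t * (norm (u - w))\<^sup>2"
      using le[of "u + w"] le[of "u - w"] by linarith
    also have "\<dots> = t * (2 * (norm u)\<^sup>2 + 2 * (norm w)\<^sup>2)"
      unfolding rip_self[symmetric] by (simp add: rip_add_left rip_add_right rip_diff_left rip_diff_right algebra_simps)
    finally have "rip (blinfun_apply S u) w \<le> t" by (simp add: uw)
    moreover have "rip (blinfun_apply S u) w = norm (blinfun_apply S x) / norm x"
      using False x0 by (simp add: u_def w_def blinfun.scaleR_right rip_scaleR_left rip_scaleR_right rip_self
          power2_eq_square)
    ultimately show ?thesis using x0 by (simp add: field_simps)
  qed
qed

text \<open>
  Zero vectors are admitted, so that finite bases and gaps in an enumeration need no separate treatment.
\<close>

definition total_orthogonal :: "(nat \<Rightarrow> 'h) \<Rightarrow> bool" where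
  "total_orthogonal e \<longleftrightarrow> (\<forall>n m. n \<noteq> m \<longrightarrow> rip (e n) (e m) = 0) \<and> (\<forall>n. e n = 0 \<or> norm (e n) = 1) \<and>
     (\<forall>x. (\<forall>n. rip x (e n) = 0) \<longrightarrow> x = 0)"

section \<open>Fourier expansion in a total orthogonal sequence\<close>

lemma orthogonal_sum_norm:
  assumes "total_orthogonal e" "finite I"
  shows "(norm (\<Sum>n\<in>I. y n *\<^sub>R e n))\<^sup>2 = (\<Sum>n\<in>I. (y n)\<^sup>2 * (norm (e n))\<^sup>2)"
proof -
  have "(norm (\<Sum>n\<in>I. y n *\<^sub>R e n))\<^sup>2 = (\<Sum>n\<in>I. \<Sum>m\<in>I. y n * (y m * rip (e m) (e n)))"
    unfolding rip_self[symmetric]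
    by (simp add: rip_sum_left rip_sum_right rip_scaleR_left rip_scaleR_right sum_distrib_left)
  also have "\<dots> = (\<Sum>n\<in>I. \<Sum>m\<in>I. if m = n then y n * (y n * (norm (e n))\<^sup>2) else 0)"
    using assms(1) by (intro sum.cong refl) (auto simp: total_orthogonal_def rip_self)
  finally show ?thesis using assms(2) by (simp add: power2_eq_square mult_ac)
qed

lemma orthogonal_sum_norm_le:
  assumes "total_orthogonal e" "finite I"
  shows "(norm (\<Sum>n\<in>I. y n *\<^sub>R e n))\<^sup>2 \<le> (\<Sum>n\<in>I. (y n)\<^sup>2)"
  unfolding orthogonal_sum_norm[OF assms]
proof (rule sum_mono)
  fix n
  have "(norm (e n))\<^sup>2 \<le> 1" using assms(1) unfolding total_orthogonal_def by (cases "e n = 0") auto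
  then show "(y n)\<^sup>2 * (norm (e n))\<^sup>2 \<le> (y n)\<^sup>2" by (intro mult_left_le) auto
qed

text \<open>Absorbs the zero vectors: where the squared norm is not 1, the coefficient is 0.\<close>

lemma fourier_coefficient:
  assumes "total_orthogonal e"
  shows "rip x (e n) * (norm (e n))\<^sup>2 = rip x (e n)"
proof (cases "e n = 0")
  case True
  then show ?thesis using rip_scaleR_right[of x 0 "e n"] by simp
qed (use assms in \<open>auto simp: total_orthogonal_def\<close>)

lemma fourier_sum_norm:
  assumes "total_orthogonal e" "finite I"
  shows "(norm (\<Sum>n\<in>I. rip x (e n) *\<^sub>R e n))\<^sup>2 = (\<Sum>n\<in>I. (rip x (e n))\<^sup>2)"
  unfolding orthogonal_sum_norm[OF assms]
  by (intro sum.cong refl) (simp add: power2_eq_square mult.assoc fourier_coefficient[OF assms(1), unfolded power2_eq_square])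

lemma bessel:
  assumes "total_orthogonal e" "finite I"
  shows "(\<Sum>n\<in>I. (rip x (e n))\<^sup>2) \<le> (norm x)\<^sup>2"
proof -
  let ?p = "\<Sum>n\<in>I. rip x (e n) *\<^sub>R e n"
  have "rip x ?p = (\<Sum>n\<in>I. (rip x (e n))\<^sup>2)"
    by (simp add: rip_sum_right rip_scaleR_right power2_eq_square)
  then have "(norm (x - ?p))\<^sup>2 = (norm x)\<^sup>2 - (\<Sum>n\<in>I. (rip x (e n))\<^sup>2)"
    using fourier_sum_norm[OF assms, of x]
    by (simp add: rip_self[symmetric] rip_diff_left rip_diff_right rip_commute[of ?p x])
  then show ?thesis using zero_le_power2[of "norm (x - ?p)"] by linarith
qed

lemma fourier_expansion:
  assumes e: "total_orthogonal e"
  shows "(\<lambda>n. rip x (e n) *\<^sub>R e n) sums x"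
proof -
  have s: "summable (\<lambda>n. (rip x (e n))\<^sup>2)"
    using bessel[OF e] by (intro summableI_nonneg_bounded[of _ "(norm x)\<^sup>2"]) auto
  have "summable (\<lambda>n. rip x (e n) *\<^sub>R e n)"
    unfolding summable_Cauchy
  proof (intro allI impI)
    fix \<epsilon> :: real assume \<epsilon>: "0 < \<epsilon>"
    then obtain N0 where N0: "\<And>m n. m \<ge> N0 \<Longrightarrow> norm (\<Sum>k=m..<n. (rip x (e k))\<^sup>2) < \<epsilon>\<^sup>2"
      using s unfolding summable_Cauchy by (meson zero_less_power)
    have "norm (\<Sum>k=m..<n. rip x (e k) *\<^sub>R e k) < \<epsilon>" if "m \<ge> N0" for m n
    proof -
      have "(norm (\<Sum>k=m..<n. rip x (e k) *\<^sub>R e k))\<^sup>2 < \<epsilon>\<^sup>2"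
        using N0[OF that, of n] by (simp add: fourier_sum_norm[OF e])
      then show ?thesis using \<epsilon> power_less_imp_less_base by fastforce
    qed
    then show "\<exists>N. \<forall>m\<ge>N. \<forall>n. norm (\<Sum>k=m..<n. rip x (e k) *\<^sub>R e k) < \<epsilon>" by blast
  qed
  then obtain y where y: "(\<lambda>n. rip x (e n) *\<^sub>R e n) sums y" by (auto simp: summable_def)
  have "rip (x - y) (e m) = 0" for m
  proof -
    have "(\<lambda>n. rip (rip x (e n) *\<^sub>R e n) (e m)) sums rip y (e m)"
      by (rule bounded_linear.sums[OF bounded_linear_rip_left y])
    moreover have "(\<lambda>n. rip (rip x (e n) *\<^sub>R e n) (e m)) = (\<lambda>n. if n = m then rip x (e m) else 0)"
      using e by (auto simp: rip_scaleR_left total_orthogonal_def rip_self fourier_coefficient[OF e])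
    ultimately have "rip y (e m) = rip x (e m)"
      using sums_unique2[OF _ sums_single[of m "\<lambda>_. rip x (e m)"]] by auto
    then show ?thesis by (simp add: rip_diff_left)
  qed
  then have "x = y" using e unfolding total_orthogonal_def by (metis eq_iff_diff_eq_0)
  with y show ?thesis by simp
qed

section \<open>Matrices of compressed operators\<close>

definition compress :: "(nat \<Rightarrow> 'h) \<Rightarrow> ('h \<Rightarrow>\<^sub>L 'h) \<Rightarrow> nat \<Rightarrow> nat \<Rightarrow> real" where
  "compress e A i j = rip (blinfun_apply A (e j)) (e i)"

lemma mvec_compress:
  "mvec N (compress e A) y i = rip (blinfun_apply A (\<Sum>j<N. y j *\<^sub>R e j)) (e i)"
  by (simp add: mvec_def compress_def blinfun.sum_right blinfun.scaleR_right rip_sum_left rip_scaleR_left mult.commute)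

lemma compress_form:
  "vdot N (mvec N (compress e A) y) z
    = rip (blinfun_apply A (\<Sum>j<N. y j *\<^sub>R e j)) (\<Sum>i<N. z i *\<^sub>R e i)"
  by (simp add: vdot_def mvec_compress rip_sum_right rip_scaleR_right mult.commute)

lemma compress_symmetric: "self_adjoint ip A \<Longrightarrow> symmetric_mat N (compress e A)"
  unfolding symmetric_mat_def compress_def self_adjoint_def rip_def
  by (metis rip_commute rip_def)

lemma compress_form_bounded:
  assumes e: "total_orthogonal e" and A: "norm A \<le> b"
  shows "form_bounded N (compress e A) b"
  unfolding form_bounded_def
proof
  fix y
  let ?p = "\<Sum>j<N. y j *\<^sub>R e j"
  have "\<bar>rip (blinfun_apply A ?p) ?p\<bar> \<le> norm (blinfun_apply A ?p) * norm ?p"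
    by (rule rip_cauchy_schwarz)
  also have "\<dots> \<le> (b * norm ?p) * norm ?p"
    by (intro mult_right_mono order_trans[OF norm_blinfun] A) auto
  also have "\<dots> = b * (norm ?p)\<^sup>2" by (simp add: power2_eq_square)
  \<comment> \<open>Only an inequality between the norms, since coordinates at zero vectors of
    \<open>e\<close> count on the right.\<close>
  also have "\<dots> \<le> b * vdot N y y"
    using orthogonal_sum_norm_le[OF e, of "{..<N}" y] A norm_ge_zero[of A]
    by (intro mult_left_mono) (auto simp: vdot_def power2_eq_square simp del: norm_ge_zero)
  finally show "\<bar>vdot N (mvec N (compress e A) y) y\<bar> \<le> b * vdot N y y"
    by (simp add: compress_form)
qed

text \<open>Some \<open>x\<close> violates the form bound strictly. Its Fourier partial sums
  converge to it, so by continuity they violate the bound from some index on, not merely infinitely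
  often.\<close>

lemma eventually_compress_not_form_bounded:
  assumes e: "total_orthogonal e" and S: "self_adjoint ip S" and t: "0 \<le> t" "t < norm S"
  shows "\<forall>\<^sub>F N in sequentially. \<not> form_bounded N (compress e S) t"
proof -
  obtain x where x: "t * (norm x)\<^sup>2 < \<bar>rip (blinfun_apply S x) x\<bar>"
    using self_adjoint_norm_le[OF S t(1)] t(2) by (meson not_le)
  define p where "p N = (\<Sum>n<N. rip x (e n) *\<^sub>R e n)" for N
  have p: "p \<longlonglongrightarrow> x" using fourier_expansion[OF e, of x] by (simp add: sums_def p_def[abs_def])
  have "(\<lambda>N. t * (norm (p N))\<^sup>2) \<longlonglongrightarrow> t * (norm x)\<^sup>2" by (intro tendsto_intros p)
  moreover have "(\<lambda>N. rip (blinfun_apply S (p N)) (p N)) \<longlonglongrightarrow> rip (blinfun_apply S x) x"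
  proof -
    have "(\<lambda>N. rip (blinfun_apply S (p N)) x + rip (blinfun_apply S (p N)) (p N - x)) \<longlonglongrightarrow> rip (blinfun_apply S x) x + 0"
    proof (intro tendsto_add bounded_linear.tendsto[OF bounded_linear_rip_left] blinfun.tendsto tendsto_const p)
      have "(\<lambda>N. norm (blinfun_apply S (p N)) * norm (p N - x)) \<longlonglongrightarrow> norm (blinfun_apply S x) * norm (x - x)"
        by (intro tendsto_intros p)
      then show "(\<lambda>N. rip (blinfun_apply S (p N)) (p N - x)) \<longlonglongrightarrow> 0"
        by (intro Lim_null_comparison[where f="\<lambda>N. rip (blinfun_apply S (p N)) (p N - x)"])
           (auto intro!: always_eventually rip_cauchy_schwarz)
    qed
    then show ?thesis by (simp add: rip_diff_right)
  qed
  ultimately have "(\<lambda>N. \<bar>rip (blinfun_apply S (p N)) (p N)\<bar> - t * (norm (p N))\<^sup>2)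
      \<longlonglongrightarrow> \<bar>rip (blinfun_apply S x) x\<bar> - t * (norm x)\<^sup>2"
    by (intro tendsto_diff tendsto_rabs)
  then have "\<forall>\<^sub>F N in sequentially. 0 < \<bar>rip (blinfun_apply S (p N)) (p N)\<bar> - t * (norm (p N))\<^sup>2"
    using x by (intro order_tendstoD) auto
  then show ?thesis
  proof eventually_elim
    case (elim N)
    have "vdot N (\<lambda>n. rip x (e n)) (\<lambda>n. rip x (e n)) = (norm (p N))\<^sup>2"
      using fourier_sum_norm[OF e, of "{..<N}" x] by (simp add: vdot_def p_def power2_eq_square)
    then show ?case
      using elim compress_form[of N e S "\<lambda>n. rip x (e n)" "\<lambda>n. rip x (e n)"]
      by (auto simp: form_bounded_def p_def intro!: exI[of _ "\<lambda>n. rip x (e n)"])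
  qed
qed

end

section \<open>Separable spaces: from orthonormal bases to real orthogonal sequences\<close>

locale separable_hilbert_space = hilbert_space_over K smul ip
  for K :: "complex set" and smul :: "complex \<Rightarrow> 'h \<Rightarrow> 'h::{banach, second_countable_topology}" and ip
begin

text \<open>Balls of radius 1/2 around the basis vectors are pairwise disjoint open sets, of which a
  second countable space has only countably many.\<close>

lemma orthonormal_basis_countable:
  assumes B: "orthonormal_basis ip B"
  shows "countable B"
proof -
  have dist: "dist b c \<ge> 1" if "b \<in> B" "c \<in> B" "b \<noteq> c" for b c
  proof -
    have "rip b b = 1" "rip c c = 1" "rip b c = 0"
      using B that by (auto simp: orthonormal_basis_def rip_def)
    then have "(norm (b - c))\<^sup>2 = 2"
      by (simp add: rip_self[symmetric] rip_diff_left rip_diff_right rip_commute[of c b])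
    then show ?thesis
      unfolding dist_norm by (smt (verit) norm_ge_zero power2_le_iff_abs_le power_one)
  qed
  let ?F = "(\<lambda>b. ball b (1/2)) ` B"
  have "disjnt (ball b (1/2)) (ball c (1/2))" if "b \<in> B" "c \<in> B" "b \<noteq> c" for b c
    unfolding disjnt_iff
  proof safe
    fix z assume "z \<in> ball b (1/2)" "z \<in> ball c (1/2)"
    then have "dist b z + dist z c < 1" by (simp add: dist_commute)
    then show False using dist[OF that] dist_triangle[of b c z] by simp
  qed
  then have "pairwise disjnt ?F" by (auto simp: pairwise_def)
  then have "countable ?F" by (intro countable_disjoint_open_subsets) auto
  moreover have "inj_on (\<lambda>b. ball b (1/2)) B"
  proof (rule inj_onI)
    fix b c assume bc: "b \<in> B" "c \<in> B" "ball b (1/2) = ball c (1/2)"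
    then have "dist c b < 1 / 2" using centre_in_ball[of b "1/2"] by auto
    then show "b = c" using dist[OF bc(1,2)] by (auto simp: dist_commute)
  qed
  ultimately show ?thesis by (rule countable_image_inj_on)
qed

text \<open>
  Over the complex numbers the real orthonormal family underlying \<open>B\<close> is \<open>B \<union> \<i> B\<close>, hence the factor 2.
\<close>

lemma total_orthogonal_sequence:
  assumes B: "orthonormal_basis ip B"
  shows "\<exists>e. total_orthogonal e \<and>
    (\<forall>q::'h \<Rightarrow> real. (\<forall>x. 0 \<le> q x) \<longrightarrow> q 0 = 0 \<longrightarrow> (K = UNIV \<longrightarrow> (\<forall>x. q (smul \<i> x) = q x)) \<longrightarrow>
      (\<forall>N. ennreal (\<Sum>a<N. q (e a)) \<le> 2 * (\<Sum>\<^sub>\<infinity>b\<in>B. ennreal (q b))))"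
proof -
  define f where "f = to_nat_on B"
  have inj: "inj_on f B" unfolding f_def by (rule inj_on_to_nat_on[OF orthonormal_basis_countable[OF B]])
  define b where "b n = (if n \<in> f ` B then inv_into B f n else 0)" for n
  \<comment> \<open>Even positions carry the basis vector, odd ones its multiple by
    \<open>\<i>\<close>, or 0 in the real case.\<close>
  define e where "e a = (if even a then b (a div 2) else if K = UNIV then smul \<i> (b (a div 2)) else 0)" for a
  have b_in: "b n \<in> B" if "n \<in> f ` B" for n using that by (auto simp: b_def inv_into_into)
  have b_f: "b (f x) = x" if "x \<in> B" for x using that inj by (simp add: b_def)
  have ip0: "ip x 0 = 0" "ip 0 x = 0" for x
    using ip_scaleR_left[of 0 0 x] ip_commute[of x 0] by auto
  have b_orth: "ip (b n) (b m) = 0" if "n \<noteq> m" for n m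
  proof (cases "n \<in> f ` B \<and> m \<in> f ` B")
    case True
    then have "b n \<noteq> b m" using that by (metis b_f imageE)
    then show ?thesis using B True b_in by (auto simp: orthonormal_basis_def)
  qed (auto simp: b_def ip0)
  have b_norm: "b n = 0 \<or> norm (b n) = 1" for n
  proof (cases "n \<in> f ` B")
    case True
    then have "ip (b n) (b n) = 1" using B b_in by (auto simp: orthonormal_basis_def)
    then have "(norm (b n))\<^sup>2 = 1" unfolding ip_self by (metis of_real_eq_1_iff)
    then show ?thesis using norm_ge_zero[of "b n"] by (auto simp: power2_eq_1_iff)
  qed (simp add: b_def)
  have ipi: "ip (smul \<i> x) y = \<i> * ip x y" "ip x (smul \<i> y) = - \<i> * ip x y" if "K = UNIV" for x y
    using ip_smul_left[of \<i>] ip_commute[of x "smul \<i> y"] ip_commute[of x y] that by auto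
  have e_orth: "rip (e n) (e m) = 0" if "n \<noteq> m" for n m
  proof (cases "n div 2 = m div 2")
    case True
    then have "even n \<noteq> even m" using that by (metis bit_eq_rec)
    \<comment> \<open>The inner product of \<open>b\<close> with its multiple by \<open>\<i>\<close>
      is purely imaginary.\<close>
    then show ?thesis using True by (auto simp: e_def rip_def ipi ip_self ip0)
  next
    case False
    then show ?thesis by (auto simp: e_def rip_def ipi ip0 b_orth)
  qed
  have "total_orthogonal e"
    unfolding total_orthogonal_def
  proof (intro conjI allI impI)
    show "rip (e n) (e m) = 0" if "n \<noteq> m" for n m by (rule e_orth[OF that])
    have "smul \<i> 0 = 0" if "K = UNIV" using norm_smul_ii[OF that, of 0] by simp
    then show "e n = 0 \<or> norm (e n) = 1" for n
      using b_norm[of "n div 2"] norm_smul_ii[of "b (n div 2)"] by (auto simp: e_def)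
    fix x assume x: "\<forall>n. rip x (e n) = 0"
    have "ip x c = 0" if c: "c \<in> B" for c
    proof (rule complex_eqI)
      show "Re (ip x c) = Re 0"
        using x[rule_format, of "2 * f c"] b_f[OF c] by (simp add: e_def rip_def)
      show "Im (ip x c) = Im 0"
        using x[rule_format, of "2 * f c + 1"] b_f[OF c] scalar_field ip_in_K[of x c]
        by (auto simp: e_def rip_def ipi complex_is_Real_iff)
    qed
    then show "x = 0" using B by (simp add: orthonormal_basis_def)
  qed
  moreover have "ennreal (\<Sum>a<N. q (e a)) \<le> 2 * (\<Sum>\<^sub>\<infinity>b\<in>B. ennreal (q b))"
    if q: "\<forall>x. 0 \<le> q x" "q 0 = 0" "K = UNIV \<longrightarrow> (\<forall>x. q (smul \<i> x) = q x)" for q :: "'h \<Rightarrow> real" and N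
  proof -
    let ?F = "{c \<in> B. f c < N}"
    have fin: "finite ?F"
      by (rule finite_imageD[of f]) (auto intro: finite_subset[of _ "{..<N}"] inj_on_subset[OF inj])
    \<comment> \<open>Passing to \<open>2 * N\<close> completes the pairs, so that each basis vector
      accounts for at most twice its value of \<open>q\<close>.\<close>
    have "(\<Sum>a<N. q (e a)) \<le> (\<Sum>a<2 * N. q (e a))"
      using q(1) by (intro sum_mono2) auto
    also have "\<dots> = (\<Sum>n<N. q (e (2 * n)) + q (e (2 * n + 1)))"
      by (induction N) auto
    also have "\<dots> \<le> (\<Sum>n<N. 2 * q (b n))"
      using q by (intro sum_mono) (auto simp: e_def)
    also have "\<dots> = 2 * (\<Sum>n<N. q (b n))" by (simp add: sum_distrib_left)
    also have "(\<Sum>n<N. q (b n)) = (\<Sum>n\<in>f ` ?F. q (b n))"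
      using q(2) by (intro sum.mono_neutral_right) (auto simp: b_def)
    also have "\<dots> = (\<Sum>c\<in>?F. q c)"
      by (subst sum.reindex) (auto intro: inj_on_subset[OF inj] simp: b_f)
    finally have "ennreal (\<Sum>a<N. q (e a)) \<le> ennreal (2 * (\<Sum>c\<in>?F. q c))" by (rule ennreal_leI)
    also have "\<dots> = 2 * (\<Sum>c\<in>?F. ennreal (q c))"
      using q(1) by (simp add: ennreal_mult sum_nonneg)
    also have "\<dots> \<le> 2 * (\<Sum>\<^sub>\<infinity>c\<in>B. ennreal (q c))"
    proof (intro mult_left_mono)
      show "(\<Sum>c\<in>?F. ennreal (q c)) \<le> (\<Sum>\<^sub>\<infinity>c\<in>B. ennreal (q c))"
        by (subst nonneg_infsum_complete, simp, rule SUP_upper) (use fin in auto)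
    qed auto
    finally show ?thesis .
  qed
  ultimately show ?thesis by blast
qed

end

section \<open>Expectations of random operators and the tail of their sum\<close>

context separable_hilbert_space
begin

text \<open>The expectation is built pointwise, from Bochner integrals of
  \<open>Y \<omega> z\<close> in the separable space \<open>'h\<close>; the operator space is in
  general not separable in its norm.\<close>

lemma op_expectation_exists:
  fixes Y :: "'w \<Rightarrow> 'h \<Rightarrow>\<^sub>L 'h"
  assumes "prob_space M"
    and meas: "\<And>z. (\<lambda>\<omega>. blinfun_apply (Y \<omega>) z) \<in> borel_measurable M"
    and bnd: "AE \<omega> in M. norm (Y \<omega>) \<le> c"
  shows "is_op_expectation M ip Y (op_expectation M ip Y)"
proof -
  interpret prob_space M by fact
  have le: "AE \<omega> in M. norm (blinfun_apply (Y \<omega>) z) \<le> c * norm z" for z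
    using bnd by eventually_elim (meson mult_right_mono norm_blinfun norm_ge_zero order_trans)
  have int: "integrable M (\<lambda>\<omega>. blinfun_apply (Y \<omega>) z)" for z
    by (rule integrable_const_bound[OF le meas])
  define A where "A z = (\<integral>\<omega>. blinfun_apply (Y \<omega>) z \<partial>M)" for z
  have "bounded_linear A"
  proof (rule bounded_linear_intro[of _ c])
    fix x y r
    show "A (x + y) = A x + A y"
      using int by (simp add: A_def blinfun.add_right)
    show "A (r *\<^sub>R x) = r *\<^sub>R A x"
      by (simp add: A_def blinfun.scaleR_right)
    have "norm (A x) \<le> (\<integral>\<omega>. norm (blinfun_apply (Y \<omega>) x) \<partial>M)"
      unfolding A_def by (rule integral_norm_bound)
    also have "\<dots> \<le> c * norm x"
      by (intro integral_le_const integrable_norm int le)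
    finally show "norm (A x) \<le> norm x * c" by (simp add: mult.commute)
  qed
  then have "blinfun_apply (Blinfun A) z = (\<integral>\<omega>. blinfun_apply (Y \<omega>) z \<partial>M)" for z
    by (simp add: bounded_linear_Blinfun_apply A_def)
  then have "is_op_expectation M ip Y (Blinfun A)"
    unfolding is_op_expectation_def
    by (auto intro!: integrable_bounded_linear[OF bounded_linear_ip_left]
        integral_bounded_linear[OF bounded_linear_ip_left, symmetric] int)
  then show ?thesis using op_expectation_eqI by metis
qed

lemma is_op_expectation_rip:
  assumes "is_op_expectation M ip Y A"
  shows "integrable M (\<lambda>\<omega>. rip (blinfun_apply (Y \<omega>) x) y)"
    and "rip (blinfun_apply A x) y = (\<integral>\<omega>. rip (blinfun_apply (Y \<omega>) x) y \<partial>M)"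
  using assms by (auto simp: is_op_expectation_def rip_def)

lemma continuous_on_compress: "continuous_on UNIV (\<lambda>A. compress e A i j)"
  unfolding compress_def
  by (intro linear_continuous_on bounded_linear_compose[OF bounded_linear_rip_left blinfun.bounded_linear_left])

lemma measurable_blinfun_apply_fixed:
  assumes "Y \<in> borel_measurable M"
  shows "(\<lambda>\<omega>. blinfun_apply (Y \<omega>) (z::'h)) \<in> borel_measurable M"
  by (rule borel_measurable_continuous_on[OF _ assms])
    (intro linear_continuous_on blinfun.bounded_linear_left)

text \<open>Treated as a continuous function of the single map \<open>Y\<close>: joint measurability
  of two operator-valued maps would call for second countability of the operator space.\<close>

lemma measurable_blinfun_square:
  assumes "Y \<in> borel_measurable M"
  shows "(\<lambda>\<omega>. blinfun_apply (Y \<omega> o\<^sub>L Y \<omega>) (z::'h)) \<in> borel_measurable M"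
  by (rule borel_measurable_continuous_on[OF _ assms, of "\<lambda>A. blinfun_apply (A o\<^sub>L A) z"])
    (intro continuous_intros)

lemma op_expectation_square:
  fixes Y :: "'w \<Rightarrow> 'h \<Rightarrow>\<^sub>L 'h"
  assumes prob: "prob_space M" and meas: "Y \<in> borel_measurable M"
    and sa: "\<And>\<omega>. \<omega> \<in> space M \<Longrightarrow> self_adjoint ip (Y \<omega>)"
    and bnd: "AE \<omega> in M. norm (Y \<omega>) \<le> U"
  shows "integrable M (\<lambda>\<omega>. (norm (blinfun_apply (Y \<omega>) x))\<^sup>2)"
    and "rip (blinfun_apply (op_expectation M ip (\<lambda>\<omega>. Y \<omega> o\<^sub>L Y \<omega>)) x) x
      = (\<integral>\<omega>. (norm (blinfun_apply (Y \<omega>) x))\<^sup>2 \<partial>M)"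
proof -
  have "AE \<omega> in M. norm (Y \<omega> o\<^sub>L Y \<omega>) \<le> U * U"
    using bnd
  proof eventually_elim
    case (elim \<omega>)
    have "norm (Y \<omega> o\<^sub>L Y \<omega>) \<le> norm (Y \<omega>) * norm (Y \<omega>)" by (rule norm_blinfun_compose)
    also have "\<dots> \<le> U * U" using elim order_trans[OF norm_ge_zero elim] by (intro mult_mono) auto
    finally show ?case .
  qed
  note E = op_expectation_exists[OF prob measurable_blinfun_square[OF meas] this]
  have sq: "rip (blinfun_apply (Y \<omega> o\<^sub>L Y \<omega>) x) x = (norm (blinfun_apply (Y \<omega>) x))\<^sup>2"
    if "\<omega> \<in> space M" for \<omega>
  proof -
    have "rip (blinfun_apply (Y \<omega> o\<^sub>L Y \<omega>) x) x = rip (blinfun_apply (Y \<omega>) x) (blinfun_apply (Y \<omega>) x)"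
      using sa[OF that] unfolding self_adjoint_def rip_def blinfun_apply_blinfun_compose by metis
    then show ?thesis by (simp add: rip_self)
  qed
  show "integrable M (\<lambda>\<omega>. (norm (blinfun_apply (Y \<omega>) x))\<^sup>2)"
    using is_op_expectation_rip(1)[OF E, of x x] sq
    by (subst Bochner_Integration.integrable_cong[OF refl]) auto
  show "rip (blinfun_apply (op_expectation M ip (\<lambda>\<omega>. Y \<omega> o\<^sub>L Y \<omega>)) x) x
      = (\<integral>\<omega>. (norm (blinfun_apply (Y \<omega>) x))\<^sup>2 \<partial>M)"
    unfolding is_op_expectation_rip(2)[OF E] using sq by (intro Bochner_Integration.integral_cong) auto
qed

text \<open>As a sum of second moments the variance is visibly nonnegative, can be compared with the
  variances of the compressions, and inherits the invariance of norms under multiplication by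
  \<open>\<i>\<close>.\<close>

lemma variance_form:
  fixes X :: "nat \<Rightarrow> 'w \<Rightarrow> ('h \<Rightarrow>\<^sub>L 'h)"
  assumes prob: "prob_space M"
    and sa: "\<And>i \<omega>. i \<in> {1..n} \<Longrightarrow> \<omega> \<in> space M \<Longrightarrow> self_adjoint ip (X i \<omega>)"
    and indep: "prob_space.indep_vars M (\<lambda>_. borel) X {1..n}"
    and bounded: "\<And>i. i \<in> {1..n} \<Longrightarrow> AE \<omega> in M. norm (X i \<omega>) \<le> U"
  shows "rip (blinfun_apply (\<Sum>i=1..n. op_expectation M ip (\<lambda>\<omega>. X i \<omega> o\<^sub>L X i \<omega>)) x) x
    = (\<Sum>i=1..n. \<integral>\<omega>. (norm (blinfun_apply (X i \<omega>) x))\<^sup>2 \<partial>M)"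
  unfolding blinfun.sum_left rip_sum_left
proof (intro sum.cong refl op_expectation_square(2)[OF prob])
  interpret prob_space M by fact
  show "X i \<in> borel_measurable M" if "i \<in> {1..n}" for i
    using indep that by (simp add: indep_vars_def)
qed (use sa bounded in auto)

text \<open>The matrix tail bound holds for every compression with constants free of
  \<open>N\<close>, and the event for the operators lies in the lower limit of the matrix
  events.\<close>

theorem operator_tail:
  fixes M :: "'w measure" and n :: nat and X :: "nat \<Rightarrow> 'w \<Rightarrow> ('h \<Rightarrow>\<^sub>L 'h)" and \<theta> U :: real
  defines "V \<equiv> \<Sum>i=1..n. op_expectation M ip (\<lambda>\<omega>. X i \<omega> o\<^sub>L X i \<omega>)"
    and "\<gamma> \<equiv> 1 / (2 * (1 - \<theta> * U / 3))"
  assumes prob: "prob_space M" and e: "total_orthogonal e"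
    and sa: "\<And>i \<omega>. i \<in> {1..n} \<Longrightarrow> \<omega> \<in> space M \<Longrightarrow> self_adjoint ip (X i \<omega>)"
    and indep: "prob_space.indep_vars M (\<lambda>_. borel) X {1..n}"
    and centered: "\<And>i. i \<in> {1..n} \<Longrightarrow> op_expectation M ip (X i) = 0"
    and bounded: "\<And>i. i \<in> {1..n} \<Longrightarrow> AE \<omega> in M. norm (X i \<omega>) \<le> U"
    and \<theta>: "0 < \<theta>" "\<theta> * U < 3" and t: "0 < t" and v: "0 < v" "norm V \<le> v"
    and T: "\<And>N. (\<Sum>a<N. rip (blinfun_apply V (e a)) (e a)) \<le> T"
  shows "measure M {\<omega> \<in> space M. t < norm (\<Sum>i=1..n. X i \<omega>)}
    \<le> 2 * (T * ((exp (\<gamma> * (\<theta>\<^sup>2 * v)) - 1) / v)) / (2 * cosh (\<theta> * t) - 2)"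
proof -
  interpret prob_space M by fact
  \<comment> \<open>The parameter \<open>\<theta>\<close> is built into the matrices, so that
    \<open>trace_cosh_tail\<close> is used at level \<open>\<theta> * t\<close>.\<close>
  define W where "W i \<omega> = (\<lambda>j k. \<theta> * compress e (X i \<omega>) j k)" for i \<omega>
  define S where "S \<omega> = (\<Sum>i=1..n. X i \<omega>)" for \<omega>
  define Z where "Z N \<omega> = mtrace N (mexp N (\<lambda>j k. \<Sum>i=1..n. W i \<omega> j k))
    + mtrace N (mexp N (\<lambda>j k. - (\<Sum>i=1..n. W i \<omega> j k))) - 2 * real N" for N \<omega>
  let ?b = "\<theta> * U"
  have X_meas: "random_variable borel (X i)" if "i \<in> {1..n}" for i
    using indep that by (simp add: indep_vars_def)
  have E1: "is_op_expectation M ip (X i) 0" if i: "i \<in> {1..n}" for i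
    using op_expectation_exists[OF prob measurable_blinfun_apply_fixed[OF X_meas[OF i]] bounded[OF i]]
    by (simp add: centered[OF i])
  have norm_sq_int: "integrable M (\<lambda>\<omega>. (norm (blinfun_apply (X i \<omega>) x))\<^sup>2)" if i: "i \<in> {1..n}" for i x
    by (rule op_expectation_square(1)[OF prob X_meas[OF i] sa[OF i] bounded[OF i]])
  have rip_V: "rip (blinfun_apply V x) x = (\<Sum>i=1..n. expectation (\<lambda>\<omega>. (norm (blinfun_apply (X i \<omega>) x))\<^sup>2))" for x
    unfolding V_def by (rule variance_form[OF prob sa indep bounded])
  have W_meas_fun: "(\<lambda>A. \<lambda>j k. \<theta> * compress e A j k) \<in> borel_measurable borel"
    by (intro measurable_coordinatewise_then_product borel_measurable_continuous_onI continuous_intros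
        continuous_on_compress)
  have indep_W: "indep_vars (\<lambda>_. borel) W {1..n}"
    unfolding W_def[abs_def]
    using indep_vars_compose2[OF indep, of "\<lambda>_ A j k. \<theta> * compress e A j k" "\<lambda>_. borel"] W_meas_fun by simp
  have W_ent_meas: "random_variable borel (\<lambda>\<omega>. W i \<omega> j k)" if "i \<in> {1..n}" for i j k
    using indep_W that by (intro measurable_matrix_entry) (simp add: indep_vars_def)
  have W_sym: "symmetric_mat N (W i \<omega>)" if "i \<in> {1..n}" "\<omega> \<in> space M" for N i \<omega>
    using compress_symmetric[OF sa[OF that], of N e] by (simp add: symmetric_mat_def W_def)
  have scale_bounded: "form_bounded N (\<lambda>j k. \<theta> * A j k) (\<theta> * c) \<longleftrightarrow> form_bounded N A c" for N A c
    unfolding form_bounded_def vdot_mvec_scale using \<theta>(1) by (simp add: abs_mult mult.assoc)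
  have W_bnd: "AE \<omega> in M. form_bounded N (W i \<omega>) ?b" if i: "i \<in> {1..n}" for N i
    using bounded[OF i] by eventually_elim (simp add: W_def scale_bounded compress_form_bounded[OF e])
  have W_centered: "expectation (\<lambda>\<omega>. W i \<omega> j k) = 0" if i: "i \<in> {1..n}" for i j k
    using is_op_expectation_rip(2)[OF E1[OF i], of "e k" "e j"] rip_scaleR_left[of 0 0 "e j"]
    by (simp add: W_def compress_def)
  let ?V = "\<lambda>N j k. \<Sum>i=1..n. matrix_variance N (W i) j k"
  have WW_int: "integrable M (\<lambda>\<omega>. mmul N (W i \<omega>) (W i \<omega>) j k)" if i: "i \<in> {1..n}" and jk: "j < N" "k < N" for N i j k
  proof (rule integrable_const_bound[where B="real N * (?b * ?b)"])
    show "AE \<omega> in M. norm (mmul N (W i \<omega>) (W i \<omega>) j k) \<le> real N * (?b * ?b)"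
      using W_bnd[OF i, of N] AE_space
    proof eventually_elim
      case (elim \<omega>)
      obtain r x where r: "spectral_decomp N (W i \<omega>) r x" using spectral_theorem[OF W_sym[OF i elim(2)]] by blast
      have "\<bar>x k\<bar> \<le> ?b" if "k < N" for k by (rule eigenvalue_bounded[OF r elim(1) that])
      then have "\<bar>x k * x k\<bar> \<le> ?b * ?b" if "k < N" for k
        unfolding abs_mult using that by (intro mult_mono) (auto intro: order_trans[OF abs_ge_zero])
      then show ?case using spectral_entry_bounded[OF spectral_decomp_mmul[OF r r] _ jk] by simp
    qed
    show "random_variable borel (\<lambda>\<omega>. mmul N (W i \<omega>) (W i \<omega>) j k)"
      unfolding mmul_def by (intro borel_measurable_sum borel_measurable_times W_ent_meas i)
  qed
  have V_form: "vdot N (mvec N (?V N) y) y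
      = (\<Sum>i=1..n. expectation (\<lambda>\<omega>. vdot N (mvec N (W i \<omega>) y) (mvec N (W i \<omega>) y)))" for N y
    unfolding vdot_mvec_sum
  proof (intro sum.cong refl)
    fix i assume i: "i \<in> {1..n}"
    have "vdot N (mvec N (matrix_variance N (W i)) y) y = expectation (\<lambda>\<omega>. vdot N (mvec N (mmul N (W i \<omega>) (W i \<omega>)) y) y)"
      unfolding vdot_mvec_eq matrix_variance_def using WW_int[OF i]
      by (subst Bochner_Integration.integral_sum, (intro Bochner_Integration.integrable_sum integrable_mult_left; simp),
          intro sum.cong refl, subst Bochner_Integration.integral_sum, (intro integrable_mult_left; simp), simp)
    also have "\<dots> = expectation (\<lambda>\<omega>. vdot N (mvec N (W i \<omega>) y) (mvec N (W i \<omega>) y))"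
      using W_sym[OF i] by (intro Bochner_Integration.integral_cong) (auto simp: vdot_mmul_self)
    finally show "vdot N (mvec N (matrix_variance N (W i)) y) y
        = expectation (\<lambda>\<omega>. vdot N (mvec N (W i \<omega>) y) (mvec N (W i \<omega>) y))" .
  qed
  have V_form_nonneg: "0 \<le> vdot N (mvec N (?V N) y) y" for N y
    unfolding V_form by (intro sum_nonneg integral_nonneg_AE) (auto simp: vdot_nonneg)
  \<comment> \<open>The square of a compression is at most the compression of the square; this is
    Bessel's inequality for \<open>X i \<omega>\<close> applied to the vector.\<close>
  have V_form_le: "vdot N (mvec N (?V N) y) y \<le> \<theta>\<^sup>2 * rip (blinfun_apply V (\<Sum>j<N. y j *\<^sub>R e j)) (\<Sum>j<N. y j *\<^sub>R e j)" for N y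
    unfolding V_form rip_V sum_distrib_left
  proof (intro sum_mono)
    fix i assume i: "i \<in> {1..n}"
    let ?p = "\<Sum>j<N. y j *\<^sub>R e j"
    have "expectation (\<lambda>\<omega>. vdot N (mvec N (W i \<omega>) y) (mvec N (W i \<omega>) y))
      \<le> expectation (\<lambda>\<omega>. \<theta>\<^sup>2 * (norm (blinfun_apply (X i \<omega>) ?p))\<^sup>2)"
    proof (rule integral_mono_AE')
      show "integrable M (\<lambda>\<omega>. \<theta>\<^sup>2 * (norm (blinfun_apply (X i \<omega>) ?p))\<^sup>2)" by (intro integrable_mult_right norm_sq_int i)
      have "mvec N (W i \<omega>) y j = \<theta> * mvec N (compress e (X i \<omega>)) y j" for \<omega> j
        by (simp add: mvec_def W_def sum_distrib_left mult_ac)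
      then have "vdot N (mvec N (W i \<omega>) y) (mvec N (W i \<omega>) y) = \<theta>\<^sup>2 * (\<Sum>j<N. (rip (blinfun_apply (X i \<omega>) ?p) (e j))\<^sup>2)" for \<omega>
        by (simp add: vdot_def mvec_compress sum_distrib_left power2_eq_square mult_ac)
      then show "AE \<omega> in M. vdot N (mvec N (W i \<omega>) y) (mvec N (W i \<omega>) y) \<le> \<theta>\<^sup>2 * (norm (blinfun_apply (X i \<omega>) ?p))\<^sup>2"
        using bessel[OF e, of "{..<N}"] by (auto intro!: AE_I2 mult_left_mono)
    qed (auto simp: vdot_nonneg)
    then show "expectation (\<lambda>\<omega>. vdot N (mvec N (W i \<omega>) y) (mvec N (W i \<omega>) y))
      \<le> \<theta>\<^sup>2 * expectation (\<lambda>\<omega>. (norm (blinfun_apply (X i \<omega>) ?p))\<^sup>2)" by simp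
  qed
  have V_bounded: "form_bounded N (?V N) (\<theta>\<^sup>2 * v)" for N
    unfolding form_bounded_def
  proof
    fix y
    have "rip (blinfun_apply V (\<Sum>j<N. y j *\<^sub>R e j)) (\<Sum>j<N. y j *\<^sub>R e j) \<le> v * vdot N y y"
      using compress_form_bounded[OF e v(2), of N] unfolding form_bounded_def compress_form
      by (meson abs_le_D1)
    then have "\<theta>\<^sup>2 * rip (blinfun_apply V (\<Sum>j<N. y j *\<^sub>R e j)) (\<Sum>j<N. y j *\<^sub>R e j) \<le> \<theta>\<^sup>2 * (v * vdot N y y)"
      by (intro mult_left_mono) auto
    then show "\<bar>vdot N (mvec N (?V N) y) y\<bar> \<le> \<theta>\<^sup>2 * v * vdot N y y"
      using V_form_nonneg[of N y] V_form_le[of N y] by (simp add: mult.assoc)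
  qed
  have V_trace: "mtrace N (?V N) \<le> \<theta>\<^sup>2 * T" for N
  proof -
    have unit: "vdot N (mvec N (?V N) (\<lambda>i. if i = a then 1 else 0)) (\<lambda>i. if i = a then 1 else 0) = ?V N a a"
      if "a < N" for a
      using that by (subst vdot_unit) (simp_all add: mvec_def if_distrib cong: if_cong)
    have "(\<Sum>j<N. (if j = a then 1 else 0) *\<^sub>R e j) = e a" if "a < N" for a
      using that by (simp add: if_distrib[of "\<lambda>c. c *\<^sub>R _"] cong: if_cong)
    then have "?V N a a \<le> \<theta>\<^sup>2 * rip (blinfun_apply V (e a)) (e a)" if "a < N" for a
      using V_form_le[of N "\<lambda>i. if i = a then 1 else 0"] unit[OF that] that by simp
    then have "mtrace N (?V N) \<le> (\<Sum>a<N. \<theta>\<^sup>2 * rip (blinfun_apply V (e a)) (e a))"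
      unfolding mtrace_def by (intro sum_mono) simp
    also have "\<dots> \<le> \<theta>\<^sup>2 * T" unfolding sum_distrib_left[symmetric] by (intro mult_left_mono T) auto
    finally show ?thesis .
  qed
  have \<gamma>: "0 \<le> \<gamma>" using \<theta>(2) by (simp add: \<gamma>_def mult.commute)
  have c: "0 < 2 * cosh (\<theta> * t) - 2"
    using \<theta>(1) t cosh_real_nonneg_less_iff[of 0 "\<theta> * t"] by simp
  define F where "F N = {\<omega> \<in> space M. 2 * cosh (\<theta> * t) - 2 \<le> Z N \<omega>}" for N
  let ?bound = "2 * (T * ((exp (\<gamma> * (\<theta>\<^sup>2 * v)) - 1) / v)) / (2 * cosh (\<theta> * t) - 2)"
  have \<gamma>_exp: "exp x \<le> 1 + x + \<gamma> * x\<^sup>2" if "\<bar>x\<bar> \<le> ?b" for x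
    unfolding \<gamma>_def by (rule exp_bernstein_bound[OF that \<theta>(2)])
  have pos: "0 < \<theta>\<^sup>2 * v" "0 < \<theta> * t" using \<theta>(1) v(1) t by simp_all
  have tail: "Z N \<in> borel_measurable M"
    "prob (F N) \<le> 2 * (mtrace N (?V N) * ((exp (\<gamma> * (\<theta>\<^sup>2 * v)) - 1) / (\<theta>\<^sup>2 * v))) / (2 * cosh (\<theta> * t) - 2)" for N
    unfolding F_def Z_def
    by (rule trace_cosh_tail[OF indep_W W_sym W_bnd W_centered \<gamma>_exp \<gamma> pos(1) V_form_nonneg V_bounded pos(2)]; assumption)+
  have F_sets: "F N \<in> sets M" for N unfolding F_def using tail(1)[of N] by measurable
  have prob_F: "prob (F N) \<le> ?bound" for N
  proof -
    have "mtrace N (?V N) * ((exp (\<gamma> * (\<theta>\<^sup>2 * v)) - 1) / (\<theta>\<^sup>2 * v))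
        \<le> \<theta>\<^sup>2 * T * ((exp (\<gamma> * (\<theta>\<^sup>2 * v)) - 1) / (\<theta>\<^sup>2 * v))"
      using \<gamma> v(1) by (intro mult_right_mono V_trace divide_nonneg_nonneg) auto
    \<comment> \<open>The \<open>\<theta>\<^sup>2\<close> of the trace bound cancels that of the
      norm bound.\<close>
    also have "\<dots> = T * ((exp (\<gamma> * (\<theta>\<^sup>2 * v)) - 1) / v)" using \<theta>(1) by simp
    finally show ?thesis using tail(2)[of N] c
      by (elim order_trans) (intro divide_right_mono mult_left_mono; simp)
  qed
  \<comment> \<open>The sets \<open>G N\<close> increase and \<open>G N \<subseteq> F N\<close>, so
    continuity from below preserves the uniform bound; a union bound over \<open>N\<close> would
    lose it.\<close>
  define G where "G N = (\<Inter>m\<in>{N..}. F m)" for N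
  have G_sets: "G N \<in> sets M" for N
    unfolding G_def using F_sets by (intro sets.countable_INT') auto
  have "{\<omega> \<in> space M. t < norm (\<Sum>i=1..n. X i \<omega>)} \<subseteq> (\<Union>N. G N)"
  proof
    fix \<omega> assume "\<omega> \<in> {\<omega> \<in> space M. t < norm (\<Sum>i=1..n. X i \<omega>)}"
    then have \<omega>: "\<omega> \<in> space M" "t < norm (S \<omega>)" by (auto simp: S_def)
    have S_sa: "self_adjoint ip (S \<omega>)"
    proof -
      have "ip (\<Sum>i\<in>I. f i) y = (\<Sum>i\<in>I. ip (f i) y)" for I and f :: "nat \<Rightarrow> 'h" and y
        using linear_sum[OF bounded_linear.linear[OF bounded_linear_ip_left]] by simp
      moreover from this have "ip y (\<Sum>i\<in>I. f i) = (\<Sum>i\<in>I. ip y (f i))" for I and f :: "nat \<Rightarrow> 'h" and y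
        by (subst (1 2) ip_commute) (simp add: cnj_sum)
      ultimately show ?thesis
        using sa[OF _ \<omega>(1)] by (simp add: self_adjoint_def S_def blinfun.sum_left)
    qed
    have W_S: "(\<lambda>j k. \<Sum>i=1..n. W i \<omega> j k) = (\<lambda>j k. \<theta> * compress e (S \<omega>) j k)"
      by (simp add: fun_eq_iff W_def S_def compress_def blinfun.sum_left rip_sum_left sum_distrib_left)
    have "\<forall>\<^sub>F N in sequentially. \<omega> \<in> F N"
      using eventually_compress_not_form_bounded[OF e S_sa less_imp_le[OF t] \<omega>(2)]
    proof eventually_elim
      case (elim N)
      then have "\<not> form_bounded N (\<lambda>j k. \<Sum>i=1..n. W i \<omega> j k) (\<theta> * t)"
        unfolding W_S scale_bounded by simp
      moreover have "symmetric_mat N (\<lambda>j k. \<Sum>i=1..n. W i \<omega> j k)"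
        using compress_symmetric[OF S_sa, of N e] unfolding W_S by (simp add: symmetric_mat_def)
      ultimately show ?case
        using mtrace_cosh_ge[of N "\<lambda>j k. \<Sum>i=1..n. W i \<omega> j k" "\<theta> * t"] \<theta>(1) t \<omega>(1) by (simp add: F_def Z_def)
    qed
    then obtain N where "\<And>m. m \<ge> N \<Longrightarrow> \<omega> \<in> F m" unfolding eventually_sequentially by blast
    then show "\<omega> \<in> (\<Union>N. G N)" unfolding G_def by (intro UN_I[of N] INT_I) simp_all
  qed
  \<comment> \<open>Monotonicity asks for measurability of the covering union only.\<close>
  then have "measure M {\<omega> \<in> space M. t < norm (\<Sum>i=1..n. X i \<omega>)} \<le> prob (\<Union>N. G N)"
    using G_sets by (intro finite_measure_mono) auto
  also have "\<dots> \<le> ?bound"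
  proof (rule LIMSEQ_le_const2)
    show "(\<lambda>N. prob (G N)) \<longlonglongrightarrow> prob (\<Union>N. G N)"
      using G_sets by (intro finite_Lim_measure_incseq) (auto simp: incseq_def G_def)
    have "prob (G N) \<le> ?bound" for N
      using F_sets by (intro order_trans[OF finite_measure_mono prob_F[of N]]) (auto simp: G_def)
    then show "\<exists>N0. \<forall>N\<ge>N0. prob (G N) \<le> ?bound" by blast
  qed
  finally show ?thesis .
qed

end

section \<open>Bernstein's inequality\<close>

text \<open>The 4 collects a factor 2 for the two signs of the exponent and a factor 2 for the real
  sequence underlying a complex basis.\<close>

lemma cosh_tail_le_exp_tail:
  fixes x :: real
  assumes "x \<ge> 1"
  shows "4 * (exp (x / 2) - 1) / (2 * cosh x - 2) \<le> 14 * exp (- (x / 2))"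
proof -
  have "cosh 0 < cosh x" using assms by (subst cosh_real_nonneg_less_iff) auto
  then have c: "0 < 2 * cosh x - 2" by simp
  have "exp x \<ge> 5 / 2" using exp_lower_Taylor_quadratic[of x] assms one_le_power[of x 2] by linarith
  moreover have "exp (x / 2) \<ge> 1" using assms by simp
  moreover have "2 * cosh x \<ge> exp x" by (simp add: cosh_def)
  \<comment> \<open>With \<open>y = exp x\<close> the left side is at most
    \<open>4 * (y - 1)\<close> and the right side at least \<open>14 * (y - 2)\<close>; these
    compare as soon as \<open>y \<ge> 12 / 5\<close>.\<close>
  ultimately have "4 * (exp x - exp (x / 2)) \<le> 14 * (2 * cosh x - 2)" by argo
  moreover have "exp (- (x / 2)) * (exp x - exp (x / 2)) = exp (x / 2) - 1"
    by (simp add: right_diff_distrib flip: exp_add)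
  moreover have "exp (- (x / 2)) * (4 * (exp x - exp (x / 2))) \<le> exp (- (x / 2)) * (14 * (2 * cosh x - 2))"
    using calculation by (intro mult_left_mono) auto
  ultimately have "4 * (exp (x / 2) - 1) \<le> 14 * exp (- (x / 2)) * (2 * cosh x - 2)"
    by (metis mult.assoc mult.left_commute)
  then show ?thesis using c by (simp add: divide_le_eq)
qed

text \<open>The threshold is the larger root of
  \<open>t\<^sup>2 - t * U / 3 - \<sigma>\<^sup>2\<close>. Beyond it, twice the Bernstein exponent
  is at least 1.\<close>

lemma bernstein_threshold:
  fixes t U \<sigma> :: real
  assumes U: "U > 0" and t: "t \<ge> 1 / 6 * (U + sqrt (U\<^sup>2 + 36 * \<sigma>\<^sup>2))"
  shows "0 < t" "\<sigma>\<^sup>2 + t * U / 3 \<le> t\<^sup>2"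
proof -
  have s: "sqrt (U\<^sup>2 + 36 * \<sigma>\<^sup>2) \<le> 6 * t - U" using t by simp
  moreover have "0 \<le> sqrt (U\<^sup>2 + 36 * \<sigma>\<^sup>2)" by simp
  ultimately show "0 < t" using U by linarith
  have "U\<^sup>2 + 36 * \<sigma>\<^sup>2 \<le> (6 * t - U)\<^sup>2" using s by (rule sqrt_le_D)
  then show "\<sigma>\<^sup>2 + t * U / 3 \<le> t\<^sup>2" by (simp add: power2_eq_square algebra_simps)
qed

theorem mainTheorem2:
  fixes K :: "complex set"
    and smul :: "complex \<Rightarrow> 'h \<Rightarrow> 'h::{banach, second_countable_topology}"
    and ip :: "'h \<Rightarrow> 'h \<Rightarrow> complex"
    and M :: "'w measure"
    and n :: nat
    and X :: "nat \<Rightarrow> 'w \<Rightarrow> ('h \<Rightarrow>\<^sub>L 'h)"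
    and \<sigma> U t :: real
  assumes hilbert: "hilbert_space_over K smul ip"
    and prob: "prob_space M"
    and linear: "\<And>i \<omega>. i \<in> {1..n} \<Longrightarrow> \<omega> \<in> space M \<Longrightarrow> K_linear K smul (X i \<omega>)"
    and self_adj: "\<And>i \<omega>. i \<in> {1..n} \<Longrightarrow> \<omega> \<in> space M \<Longrightarrow> self_adjoint ip (X i \<omega>)"
    and hs: "\<And>i \<omega>. i \<in> {1..n} \<Longrightarrow> \<omega> \<in> space M \<Longrightarrow> hilbert_schmidt ip (X i \<omega>)"
    and indep: "prob_space.indep_vars M (\<lambda>_. borel) X {1..n}"
    and centered: "\<And>i. i \<in> {1..n} \<Longrightarrow> op_expectation M ip (X i) = 0"
    and sigma_nonneg: "\<sigma> \<ge> 0"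
    and variance: "\<sigma>\<^sup>2 \<ge> norm (\<Sum>i=1..n. op_expectation M ip (\<lambda>\<omega>. X i \<omega> o\<^sub>L X i \<omega>))"
    and U_pos: "U > 0"
    and bounded: "\<And>i. i \<in> {1..n} \<Longrightarrow> AE \<omega> in M. norm (X i \<omega>) \<le> U"
    and t_ge: "t \<ge> 1 / 6 * (U + sqrt (U\<^sup>2 + 36 * \<sigma>\<^sup>2))"
  shows "ennreal (\<P>(\<omega> in M. norm (\<Sum>i=1..n. X i \<omega>) > t))
    \<le> 14 * effective_rank ip (\<Sum>i=1..n. op_expectation M ip (\<lambda>\<omega>. X i \<omega> o\<^sub>L X i \<omega>))
        * ennreal (exp (- ((t\<^sup>2 / 2) / (\<sigma>\<^sup>2 + t * U / 3))))"
proof -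
  interpret separable_hilbert_space K smul ip
    using hilbert by (rule separable_hilbert_space.intro)
  interpret prob_space M by fact
  note thr = bernstein_threshold[OF U_pos t_ge]
  define V where "V = (\<Sum>i=1..n. op_expectation M ip (\<lambda>\<omega>. X i \<omega> o\<^sub>L X i \<omega>))"
  show ?thesis
  \<comment> \<open>Without summands there is no operator to supply an orthonormal basis; the event
    is then empty because \<open>t > 0\<close>.\<close>
  proof (cases "n = 0")
    case True
    then show ?thesis using thr(1) by simp
  next
    case False
    \<comment> \<open>The Hilbert-Schmidt property of \<open>X 1\<close> at any one sample point
      supplies an orthonormal basis, so the choice inside \<open>op_trace\<close> is
      meaningful.\<close>
    obtain \<omega>0 where "\<omega>0 \<in> space M" using not_empty by blast
    then have "\<exists>B. orthonormal_basis ip B"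
      using hs[of 1 \<omega>0] False unfolding hilbert_schmidt_def by auto
    then have B: "orthonormal_basis ip (SOME B. orthonormal_basis ip B)" by (rule someI_ex)
    let ?q = "\<lambda>x. rip (blinfun_apply V x) x"
    have q_eq: "?q x = (\<Sum>i=1..n. expectation (\<lambda>\<omega>. (norm (blinfun_apply (X i \<omega>) x))\<^sup>2))" for x
      unfolding V_def by (rule variance_form[OF prob self_adj indep bounded])
    have q_nonneg: "0 \<le> ?q x" for x unfolding q_eq by (intro sum_nonneg integral_nonneg_AE) auto
    \<comment> \<open>This is where linearity over the complex scalars enters: it lets the sequence
      \<open>e\<close> count each basis vector twice with equal weight.\<close>
    have q_ii: "?q (smul \<i> x) = ?q x" if K: "K = UNIV" for x
      unfolding q_eq using linear norm_smul_ii[OF K]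
      by (intro sum.cong refl Bochner_Integration.integral_cong) (auto simp: K_linear_def K)
    obtain e where e: "total_orthogonal e" and
      e_sum: "\<And>q N. (\<forall>x. 0 \<le> q x) \<Longrightarrow> q 0 = 0 \<Longrightarrow> (K = UNIV \<longrightarrow> (\<forall>x. q (smul \<i> x) = q x)) \<Longrightarrow>
        ennreal (\<Sum>a<N. q (e a)) \<le> 2 * (\<Sum>\<^sub>\<infinity>b\<in>(SOME B. orthonormal_basis ip B). ennreal (q b))"
      using total_orthogonal_sequence[OF B] by blast
    have e_sum: "ennreal (\<Sum>a<N. ?q (e a)) \<le> 2 * op_trace ip V" for N
      unfolding op_trace_def rip_def[symmetric] using q_nonneg q_ii rip_scaleR_left[of 0 0 0]
      by (intro e_sum) (auto simp: blinfun.zero_right)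
    have tail: "measure M {\<omega> \<in> space M. t < norm (\<Sum>i=1..n. X i \<omega>)}
        \<le> 2 * (T * ((exp (1 / (2 * (1 - \<theta> * U / 3)) * (\<theta>\<^sup>2 * v)) - 1) / v)) / (2 * cosh (\<theta> * t) - 2)"
      if "0 < \<theta>" "\<theta> * U < 3" "0 < v" "norm V \<le> v" "\<And>N. (\<Sum>a<N. ?q (e a)) \<le> T" for \<theta> v T
      using that unfolding V_def
      by (intro operator_tail[OF prob e self_adj indep centered bounded _ _ thr(1)])
    show ?thesis
    proof (cases "V = 0")
      case True
      \<comment> \<open>With \<open>T = 0\<close> the tail bound is 0;
        \<open>\<theta> = 1 / U\<close> and \<open>v = 1\<close> are merely admissible
        values.\<close>
      have "measure M {\<omega> \<in> space M. t < norm (\<Sum>i=1..n. X i \<omega>)} \<le> 0"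
        using tail[of "1 / U" 1 0] U_pos rip_scaleR_left[of 0 0] by (simp add: True)
      then have "ennreal (measure M {\<omega> \<in> space M. t < norm (\<Sum>i=1..n. X i \<omega>)}) = 0" by (rule ennreal_neg)
      then show ?thesis by simp
    next
      case False
      \<comment> \<open>The effective rank has the exact norm in its denominator, so \<sigma> may
        replace it only in the exponent.\<close>
      define v where "v = norm V"
      define x where "x = t\<^sup>2 / (\<sigma>\<^sup>2 + t * U / 3)"
      \<comment> \<open>The usual Bernstein parameter: it makes the argument of \<open>cosh\<close>
        equal to \<open>x\<close>, and \<open>1 / (2 * (1 - \<theta> * U / 3)) * (\<theta>\<^sup>2 *
        \<sigma>\<^sup>2)\<close> equal to \<open>x / 2\<close>.\<close>
      define \<theta> where "\<theta> = t / (\<sigma>\<^sup>2 + t * U / 3)"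
      have v: "0 < v" "v \<le> \<sigma>\<^sup>2" using False variance by (simp_all add: v_def V_def)
      have d: "0 < \<sigma>\<^sup>2 + t * U / 3" using v thr(1) U_pos by (intro add_pos_pos) auto
      have x: "1 \<le> x" using thr(2) d by (simp add: x_def)
      have \<theta>: "0 < \<theta>" "\<theta> * t = x" using thr(1) d by (simp_all add: \<theta>_def x_def power2_eq_square)
      have \<theta>U: "1 - \<theta> * U / 3 = \<sigma>\<^sup>2 / (\<sigma>\<^sup>2 + t * U / 3)"
        using d by (simp add: \<theta>_def field_simps)
      have "0 < \<sigma>\<^sup>2 / (\<sigma>\<^sup>2 + t * U / 3)" using v d by (intro divide_pos_pos) auto
      then have \<theta>U3: "\<theta> * U < 3" using \<theta>U by linarith
      have \<gamma>: "1 / (2 * (1 - \<theta> * U / 3)) * (\<theta>\<^sup>2 * v) \<le> x / 2"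
      proof -
        have "1 / (2 * (1 - \<theta> * U / 3)) * (\<theta>\<^sup>2 * \<sigma>\<^sup>2) = x / 2"
          unfolding \<theta>U unfolding \<theta>_def x_def using v d
          by (cases "\<sigma> = 0") (simp_all add: divide_simps power2_eq_square)
        moreover have "1 / (2 * (1 - \<theta> * U / 3)) * (\<theta>\<^sup>2 * v) \<le> 1 / (2 * (1 - \<theta> * U / 3)) * (\<theta>\<^sup>2 * \<sigma>\<^sup>2)"
          using v \<theta>U3 by (intro mult_left_mono) (auto simp: mult.commute)
        ultimately show ?thesis by (rule order.trans[OF _ eq_refl, rotated])
      qed
      show ?thesis
      proof (cases "op_trace ip V = \<infinity>")
        case True
        then have "effective_rank ip V = \<infinity>"
          using False by (simp add: effective_rank_def ennreal_top_divide)
        then show ?thesis unfolding V_def[symmetric] by (simp add: ennreal_mult_top ennreal_top_mult)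
      next
        case fin: False
        then obtain r where r: "0 \<le> r" "op_trace ip V = ennreal r"
          by (cases "op_trace ip V") auto
        have "ennreal (\<Sum>a<N. ?q (e a)) \<le> ennreal (2 * r)" for N
          using e_sum[of N] r by (simp add: ennreal_mult)
        then have T: "(\<Sum>a<N. ?q (e a)) \<le> 2 * r" for N
          using r(1) by (subst (asm) ennreal_le_iff) auto
        have c: "0 < 2 * cosh x - 2"
          using x cosh_real_nonneg_less_iff[of 0 x] by simp
        have "measure M {\<omega> \<in> space M. t < norm (\<Sum>i=1..n. X i \<omega>)}
          \<le> 2 * (2 * r * ((exp (1 / (2 * (1 - \<theta> * U / 3)) * (\<theta>\<^sup>2 * v)) - 1) / v)) / (2 * cosh x - 2)"
          using tail[OF \<theta>(1) \<theta>U3 v(1) eq_refl[OF v_def[symmetric]] T] unfolding \<theta>(2) .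
        also have "\<dots> \<le> 2 * (2 * r * ((exp (x / 2) - 1) / v)) / (2 * cosh x - 2)"
          using \<gamma> r(1) v(1) c by (intro divide_right_mono mult_left_mono diff_right_mono) auto
        also have "\<dots> = r / v * (4 * (exp (x / 2) - 1) / (2 * cosh x - 2))" by simp
        also have "\<dots> \<le> r / v * (14 * exp (- (x / 2)))"
          using r(1) v(1) by (intro mult_left_mono cosh_tail_le_exp_tail x) auto
        finally have "ennreal (measure M {\<omega> \<in> space M. t < norm (\<Sum>i=1..n. X i \<omega>)})
          \<le> ennreal (14 * (r / v) * exp (- (x / 2)))" by (intro ennreal_leI) (simp add: mult_ac)
        also have "\<dots> = 14 * effective_rank ip V * ennreal (exp (- (x / 2)))"
        proof -
          have "effective_rank ip V = ennreal (r / v)"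
            using False r v by (simp add: effective_rank_def divide_ennreal v_def)
          then show ?thesis
            using r(1) v(1) ennreal_mult'[of "14 * (r / v)"] ennreal_mult'[of 14 "r / v"] by simp
        qed
        also have "x / 2 = (t\<^sup>2 / 2) / (\<sigma>\<^sup>2 + t * U / 3)" by (simp add: x_def)
        finally show ?thesis by (simp add: V_def)
      qed
    qed
  qed
qed

end
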